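(* Let $\varepsilon>0$ and let $\mu,\nu,\bar\mu,\bar\nu\in\mathcal P_2(\mathbb R^d)$ have finite relative entropy with respect to the Lebesgue measure $\mathcal L_d$. Assume that each of the pairs $(\mu,\nu)$ and $(\bar\mu,\bar\nu)$ satisfies the following condition: either both densities with respect to $\mathcal L_d$ are bounded and compactly supported, or for each measure $\mathfrak p$ in the pair $\frac{d\mathfrak p}{d\mathcal L_d}$ is locally bounded away from zero on $\mathrm{int}(\mathrm{supp}(\mathfrak p))$ and $\mathfrak p(\partial\,\mathrm{supp}(\mathfrak p))=0$. Assume that $\mathcal H^{\mathrm{sym}}(\mu,\bar\mu)$ and $\mathcal H^{\mathrm{sym}}(\nu,\bar\nu)$ are both finite, and set $C_\varepsilon=\frac{d\varepsilon}2\log(4\pi\varepsilon)$. Then $$\begin{aligned}|\mathcal S^\varepsilon(\bar\mu,\bar\nu)-\mathcal S^\varepsilon(\mu,\nu)|\le{}&\varepsilon\big[\mathcal H^{\mathrm{sym}}(\mu,\bar\mu)\wedge\mathcal H^{\mathrm{sym}}(\nu,\bar\nu)\big]\\&+2\Big[\sqrt{\mathcal S^\varepsilon(\mu,\nu)+\varepsilon\mathcal H(\nu|\mathcal L_d)+C_\varepsilon}\,\|\mu-\bar\mu\|_{\dot H^{-1}(\mu)}+\sqrt{\mathcal S^\varepsilon(\mu,\nu)+\varepsilon\mathcal H(\mu|\mathcal L_d)+C_\varepsilon}\,\|\nu-\bar\nu\|_{\dot H^{-1}(\nu)}\Big]\\&+2\Big[\sqrt{\mathcal S^\varepsilon(\bar\mu,\bar\nu)+\varepsilon\mathcal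 H(\bar\nu|\mathcal L_d)+C_\varepsilon}\,\|\bar\mu-\mu\|_{\dot H^{-1}(\bar\mu)}+\sqrt{\mathcal S^\varepsilon(\bar\mu,\bar\nu)+\varepsilon\mathcal H(\bar\mu|\mathcal L_d)+C_\varepsilon}\,\|\bar\nu-\nu\|_{\dot H^{-1}(\bar\nu)}\Big]\end{aligned}$$ and $$\begin{aligned}\varepsilon\,\mathcal H^{\mathrm{sym}}(\pi^{\mu,\nu}_\varepsilon,\pi^{\bar\mu,\bar\nu}_\varepsilon)\le{}&\varepsilon\,\mathcal H^{\mathrm{sym}}(\mu,\bar\mu)+\varepsilon\,\mathcal H^{\mathrm{sym}}(\nu,\bar\nu)\\&+2\Big[\sqrt{\mathcal S^\varepsilon(\mu,\nu)+\varepsilon\mathcal H(\nu|\mathcal L_d)+C_\varepsilon}\,\|\mu-\bar\mu\|_{\dot H^{-1}(\mu)}+\sqrt{\mathcal S^\varepsilon(\mu,\nu)+\varepsilon\mathcal H(\mu|\mathcal L_d)+C_\varepsilon}\,\|\nu-\bar\nu\|_{\dot H^{-1}(\nu)}\Big]\\&+2\Big[\sqrt{\mathcal S^\varepsilon(\bar\mu,\bar\nu)+\varepsilon\mathcal H(\bar\nu|\mathcal L_d)+C_\varepsilon}\,\|\bar\mu-\mu\|_{\dot H^{-1}(\bar\mu)}+\sqrt{\mathcal S^\varepsilon(\bar\mu,\bar\nu)+\varepsilon\mathcal H(\bar\mu|\mathcal L_d)+C_\varepsilon}\,\|\bar\nu-\nu\|_{\dot H^{-1}(\bar\nu)}\B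ig].\end{aligned}$$
   Context: $\mathcal P_2(\mathbb R^d)$ is the set of probability measures with finite second moment. Quadratic entropic optimal transport: $\mathcal S^\varepsilon(\mu,\nu)=\inf_{\pi\in\Pi(\mu,\nu)}\int|x-y|^2d\pi+\varepsilon\,\mathcal H(\pi|\mu\otimes\nu)$, where $\Pi(\mu,\nu)$ is the set of couplings of $\mu,\nu$; the unique minimizer is denoted $\pi^{\mu,\nu}_\varepsilon$. For probabilities, $\mathcal H(\mathfrak p|\mathfrak q)=\int\log\frac{d\mathfrak p}{d\mathfrak q}d\mathfrak p$ if $\mathfrak p\ll\mathfrak q$, $+\infty$ otherwise; $\mathcal H(\mathfrak p|\mathcal L_d)=\int\log\frac{d\mathfrak p}{d\mathcal L_d}d\mathfrak p$ for $\mathfrak p\in\mathcal P_2(\mathbb R^d)$ with $\mathfrak p\ll\mathcal L_d$ (and $+\infty$ otherwise). $\mathcal H^{\mathrm{sym}}(\mathfrak p,\mathfrak q)=\mathcal H(\mathfrak p|\mathfrak q)+\mathcal H(\mathfrak q|\mathfrak p)$; $a\wedge b=\min\{a,b\}$. For a signed measure $\sigma$ and a probability $\mu$: $\|\sigma\|_{\dot H^{-1}(\mu)}=\sup\{|\langle h,\sigma\rangle|:\|h\|_{\dot H^1(\mu)}\le1\}$, where $\langle h,\sigma\rangle=\int h\,d\sigma$, $\|h\|^2_{\dot H^1(\mu)}=\int|\nabla h|^2d\mu$ ($\nabla$ the weak gradient), and $h$ ranges over all functions for which these quantities are well defined. *)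

theory Defs
  imports "HOL-Probability.Probability"
begin

definition P2 :: "'a::euclidean_space measure set" where
  "P2 = {p. prob_space p \<and> sets p = sets borel \<and> (\<integral>\<^sup>+x. ennreal ((norm x)\<^sup>2) \<partial>p) < \<infinity>}"

definition msupport :: "'a::euclidean_space measure \<Rightarrow> 'a set" where
  "msupport p = {x. \<forall>r>0. emeasure p (ball x r) > 0}"

text \<open>The Bochner integral in \<^const>\<open>KL_divergence\<close> is 0 for a non-integrable logarithmic density.
  If \<open>p\<close> is a probability and \<open>q\<close> is a probability, or if \<open>p \<in> P2\<close> and \<open>q\<close> is Lebesgue measure, then
  the negative part of that density is always \<open>p\<close>-integrable, so non-integrability means that the
  entropy is \<open>+\<infinity>\<close>.\<close>

definition rel_entropy :: "'a measure \<Rightarrow> 'a measure \<Rightarrow> ereal" where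
  "rel_entropy p q =
     (if absolutely_continuous q p \<and> integrable p (entropy_density (exp 1) q p)
      then ereal (KL_divergence (exp 1) q p) else \<infinity>)"

definition sym_entropy :: "'a measure \<Rightarrow> 'a measure \<Rightarrow> ereal" where
  "sym_entropy p q = rel_entropy p q + rel_entropy q p"

definition couplings :: "'a::euclidean_space measure \<Rightarrow> 'a measure \<Rightarrow> ('a \<times> 'a) measure set" where
  "couplings \<mu> \<nu> = {\<pi>. prob_space \<pi> \<and> sets \<pi> = sets borel \<and>
     distr \<pi> borel fst = \<mu> \<and> distr \<pi> borel snd = \<nu>}"

definition eot_objective ::
  "real \<Rightarrow> 'a::euclidean_space measure \<Rightarrow> 'a measure \<Rightarrow> ('a \<times> 'a) measure \<Rightarrow> ereal" where
  "eot_objective \<epsilon> \<mu> \<nu> \<pi> =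
     enn2ereal (\<integral>\<^sup>+z. ennreal ((norm (fst z - snd z))\<^sup>2) \<partial>\<pi>)
       + ereal \<epsilon> * rel_entropy \<pi> (\<mu> \<Otimes>\<^sub>M \<nu>)"

definition eot_cost :: "real \<Rightarrow> 'a::euclidean_space measure \<Rightarrow> 'a measure \<Rightarrow> ereal" where
  "eot_cost \<epsilon> \<mu> \<nu> = (INF \<pi>\<in>couplings \<mu> \<nu>. eot_objective \<epsilon> \<mu> \<nu> \<pi>)"

definition eot_plan :: "real \<Rightarrow> 'a::euclidean_space measure \<Rightarrow> 'a measure \<Rightarrow> ('a \<times> 'a) measure" where
  "eot_plan \<epsilon> \<mu> \<nu> = (THE \<pi>. is_arg_min (eot_objective \<epsilon> \<mu> \<nu>) (\<lambda>\<pi>. \<pi> \<in> couplings \<mu> \<nu>) \<pi>)"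

primrec ck_fun :: "nat \<Rightarrow> ('a::euclidean_space \<Rightarrow> real) \<Rightarrow> bool" where
  "ck_fun 0 f = continuous_on UNIV f"
| "ck_fun (Suc k) f = ((\<forall>x. f differentiable (at x)) \<and>
     (\<forall>i\<in>Basis. ck_fun k (\<lambda>x. frechet_derivative f (at x) i)))"

definition test_fun :: "'a::euclidean_space set \<Rightarrow> ('a \<Rightarrow> real) \<Rightarrow> bool" where
  "test_fun U \<phi> \<longleftrightarrow> (\<forall>k. ck_fun k \<phi>) \<and>
     compact (closure {x. \<phi> x \<noteq> 0}) \<and> closure {x. \<phi> x \<noteq> 0} \<subseteq> U"

definition locally_integrable_on ::
  "('a::euclidean_space \<Rightarrow> 'b::{banach,second_countable_topology}) \<Rightarrow> 'a set \<Rightarrow> bool" where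
  "locally_integrable_on f U \<longleftrightarrow> (\<forall>K. compact K \<and> K \<subseteq> U \<longrightarrow> set_integrable lborel K f)"

definition is_weak_gradient ::
  "'a::euclidean_space set \<Rightarrow> ('a \<Rightarrow> real) \<Rightarrow> ('a \<Rightarrow> 'a) \<Rightarrow> bool" where
  "is_weak_gradient U h g \<longleftrightarrow>
     h \<in> borel_measurable borel \<and> g \<in> borel_measurable borel \<and>
     locally_integrable_on h U \<and> locally_integrable_on g U \<and>
     (\<forall>\<phi>. test_fun U \<phi> \<longrightarrow> (\<forall>i\<in>Basis.
        (LINT x:U|lborel. h x * frechet_derivative \<phi> (at x) i)
          = - (LINT x:U|lborel. (g x \<bullet> i) * \<phi> x)))"

text \<open>The open set on which admissible functions must be weakly differentiable. If the boundary of
  the support is null, the interior of the support carries \<open>\<mu>\<close> and is the natural domain (an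
  admissible function may blow up at the boundary). Otherwise, as for a density living on a closed
  set with empty interior, the interior misses mass and the gradient is taken on the whole space.
  Arbitrary open sets of full measure must not be allowed: on the complement of a grid of hyperplanes
  every piecewise constant function has zero gradient, and the dual norm would degenerate.\<close>

definition grad_domain :: "'a::euclidean_space measure \<Rightarrow> 'a set" where
  "grad_domain \<mu> =
     (if emeasure \<mu> (frontier (msupport \<mu>)) = 0 then interior (msupport \<mu>) else UNIV)"

text \<open>For \<open>\<mu>\<close> absolutely continuous the integral below does not depend on the version \<open>g\<close> of
  the weak gradient.\<close>

definition hdot1_unit_ball :: "'a::euclidean_space measure \<Rightarrow> ('a \<Rightarrow> real) set" where
  "hdot1_unit_ball \<mu> = {h. \<exists>g. is_weak_gradient (grad_domain \<mu>) h g \<and>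
     (\<integral>\<^sup>+x. ennreal ((norm (g x))\<^sup>2) \<partial>\<mu>) \<le> 1}"

text \<open>The norm of the signed measure \<open>p - q\<close> in the dual of the homogeneous Sobolev space of
  \<open>\<mu>\<close>; the signed measure is given by two finite measures \<open>p\<close> and \<open>q\<close>.\<close>

definition hdot_neg1_norm ::
  "'a::euclidean_space measure \<Rightarrow> 'a measure \<Rightarrow> 'a measure \<Rightarrow> ereal" where
  "hdot_neg1_norm \<mu> p q =
     (SUP h\<in>{h \<in> hdot1_unit_ball \<mu>. integrable p h \<and> integrable q h}.
        ereal \<bar>(\<integral>x. h x \<partial>p) - (\<integral>x. h x \<partial>q)\<bar>)"

definition bounded_compactly_supported :: "'a::euclidean_space measure \<Rightarrow> bool" where
  "bounded_compactly_supported p \<longleftrightarrow>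
     (\<exists>B::real. AE x in lborel. RN_deriv lborel p x \<le> ennreal B) \<and> compact (msupport p)"

definition locally_bounded_below :: "'a::euclidean_space measure \<Rightarrow> bool" where
  "locally_bounded_below p \<longleftrightarrow>
     (\<forall>K. compact K \<and> K \<subseteq> interior (msupport p) \<longrightarrow>
        (\<exists>c::real. c > 0 \<and> (AE x in lborel. x \<in> K \<longrightarrow> ennreal c \<le> RN_deriv lborel p x))) \<and>
     emeasure p (frontier (msupport p)) = 0"

definition admissible_pair :: "'a::euclidean_space measure \<Rightarrow> 'a measure \<Rightarrow> bool" where
  "admissible_pair \<mu> \<nu> \<longleftrightarrow>
     (bounded_compactly_supported \<mu> \<and> bounded_compactly_supported \<nu>) \<or>
     (locally_bounded_below \<mu> \<and> locally_bounded_below \<nu>)"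

definition ereal_sqrt :: "ereal \<Rightarrow> ereal" where
  "ereal_sqrt x = (if x = \<infinity> then \<infinity> else ereal (sqrt (real_of_ereal x)))"

end

theory Submission
  imports Defs
begin

text \<open>Write \<open>c(x,y) = |x - y|\<^sup>2\<close>. The optimal plan for \<open>(\<mu>, \<nu>)\<close> has the Gibbs form
\<open>\<pi> = exp((\<phi>(x) + \<psi>(y) - c(x,y)) / \<epsilon>) \<mu> \<otimes> \<nu>\<close> with Schroedinger potentials \<open>\<phi>\<close>, \<open>\<psi>\<close>, and the cost is
\<open>S = \<integral>\<phi> d\<mu> + \<integral>\<psi> d\<nu>\<close>. For any plan \<open>\<pi>'\<close> of \<open>(\<mu>', \<nu>')\<close> with objective value \<open>S'\<close> the logarithm of
\<open>d\<pi>'/d\<pi>\<close> splits, which gives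
\<open>\<epsilon> H(\<pi>'|\<pi>) = S' - S + \<epsilon> H(\<mu>'|\<mu>) + \<epsilon> H(\<nu>'|\<nu>) + \<integral>\<phi> d(\<mu> - \<mu>') + \<integral>\<psi> d(\<nu> - \<nu>')\<close>.
The last two integrals are bounded by the dual Sobolev norms times \<open>\<parallel>\<nabla>\<phi>\<parallel>\<close> in \<open>L\<^sup>2(\<mu>)\<close> and \<open>\<parallel>\<nabla>\<psi>\<parallel>\<close> in
\<open>L\<^sup>2(\<nu>)\<close>. Adding the inequality for \<open>\<pi>'\<close> against \<open>\<pi>\<close> to the one for \<open>\<pi>\<close> against \<open>\<pi>'\<close> yields the
estimate for the plans; using \<open>H(\<pi>'|\<pi>) \<ge> H(\<mu>'|\<mu>)\<close> and \<open>H(\<pi>'|\<pi>) \<ge> H(\<nu>'|\<nu>)\<close> in each of them yields the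
estimate for the costs. The one-sided inequality is \<open>plan_stability\<close>.

The potentials. A minimising sequence of densities is Cauchy in \<open>L\<^sup>1\<close> by the three-point identity of
relative entropy (\<open>optimal_exists\<close>), and the minimiser satisfies a Pythagorean inequality
(\<open>optimal_pythagoras\<close>). Compared with the product coupling, it shows that the optimal density is
positive with integrable logarithm. Compared with the coupling that exchanges the second coordinates of
two independent pairs, it shows that \<open>G = ln(d\<pi>/d(\<mu> \<otimes> \<nu>)) + c / \<epsilon>\<close> satisfies
\<open>G(x,y) + G(x',y') = G(x,y') + G(x',y)\<close> almost everywhere, so \<open>G\<close> is a sum of a function of \<open>x\<close> and a
function of \<open>y\<close> (\<open>optimal_additive\<close>, \<open>optimal_splits\<close>).

The gradient. By the marginal constraint \<open>\<phi>(x) = |x|\<^sup>2 - \<epsilon> ln \<Lambda>(2x / \<epsilon>)\<close> for a Laplace transform \<open>\<Lambda>\<close>,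
which is smooth in the interior of its convex domain, and \<open>\<nabla>\<phi>(x) = 2 \<integral>(x - y) d\<pi>\<^sup>x(y)\<close>. The mean of
\<open>\<pi>\<^sup>x\<close> is controlled by comparing \<open>\<pi>\<^sup>x\<close> with a Gaussian centred at that mean, so
\<open>|\<nabla>\<phi>(x)|\<^sup>2 \<le> 4 \<epsilon> H(\<pi>\<^sup>x|N)\<close> for the Gaussian \<open>N\<close> centred at \<open>x\<close> with variance \<open>\<epsilon>/2\<close>, and
integrating over \<open>\<mu>\<close> bounds \<open>\<integral>|\<nabla>\<phi>|\<^sup>2 d\<mu>\<close> by four times
\<open>S + \<epsilon> H(\<nu>|L) + (d\<epsilon>/2) ln(pi \<epsilon>)\<close>, with \<open>L\<close> the Lebesgue measure (\<open>gradient_bound\<close>). Full mass of the domain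
together with a null boundary of the support, or compact supports, puts the domain of the weak gradient
inside the region of smoothness (\<open>dual_domain_covers\<close>).

Since \<open>\<phi>\<close> may fail to be \<open>\<mu>'\<close>-integrable, all of this is applied to bounded smooth functions of \<open>\<phi>\<close> and
\<open>\<psi>\<close>, and the entropy inequality passes to the limit by Fatou's lemma (\<open>entropy_of_competitor_le\<close>).\<close>

section \<open>Relative entropy as the integral of a pointwise divergence\<close>

text \<open>Between probability densities the terms \<open>- a + b\<close> integrate to zero, so the integral is the relative
entropy. They make the integrand nonnegative, which gives additivity and Fatou's lemma without
integrability conditions. The value \<open>\<infinity>\<close> encodes the failure of absolute continuity.\<close>

definition kl :: "real \<Rightarrow> real \<Rightarrow> ennreal" where
  "kl a b = (if a > 0 \<and> b \<le> 0 then \<infinity> else ennreal (a * ln (a / b) - a + b))"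

lemma kl_pos: "b > 0 \<Longrightarrow> kl a b = ennreal (a * ln (a / b) - a + b)"
  by (simp add: kl_def)

lemma kl_zero_left: "kl 0 b = ennreal b"
  by (simp add: kl_def)

lemma kl_measurable [measurable]:
  assumes [measurable]: "f \<in> borel_measurable M" "g \<in> borel_measurable M"
  shows "(\<lambda>x. kl (f x) (g x)) \<in> borel_measurable M"
  unfolding kl_def by measurable

text \<open>This is \<open>ln t \<le> t - 1\<close> at \<open>t = sqrt (b / a)\<close>.\<close>

lemma hellinger_le_kl:
  fixes a b :: real
  assumes "a \<ge> 0" "b > 0"
  shows "(sqrt a - sqrt b)\<^sup>2 \<le> a * ln (a / b) - a + b"
proof (cases "a = 0")
  case True then show ?thesis using assms by simp
next
  case False
  with assms have a: "a > 0" by simp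
  have "ln (sqrt (b / a)) \<le> sqrt (b / a) - 1"
    using a assms by (intro ln_le_minus_one) simp
  moreover have "ln (sqrt (b / a)) = - ln (a / b) / 2"
    using a assms by (simp add: ln_sqrt ln_div)
  ultimately have "a * (1 - sqrt (b / a)) * 2 \<le> a * ln (a / b)"
    using a by (simp add: mult_left_mono)
  moreover have "a * sqrt (b / a) = sqrt a * sqrt b"
    using a assms by (simp add: real_sqrt_divide field_simps)
  ultimately have "2 * a - 2 * (sqrt a * sqrt b) \<le> a * ln (a / b)"
    by (simp add: algebra_simps)
  then show ?thesis using a assms by (simp add: power2_diff)
qed

lemma kl_real_nonneg: "a \<ge> 0 \<Longrightarrow> b > 0 \<Longrightarrow> 0 \<le> a * ln (a / b) - a + (b::real)"
  using hellinger_le_kl[of a b] by (meson order_trans zero_le_power2)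

text \<open>A pointwise substitute for Pinsker's inequality: factor \<open>a - b\<close> through square roots, split the product
with the weight \<open>\<delta>\<close>, and use the Hellinger bound. Choosing \<open>\<delta>\<close> after integration bounds the total
variation by a multiple of the square root of the entropy.\<close>

lemma abs_diff_le_kl:
  fixes a b \<delta> :: real
  assumes "a \<ge> 0" "b \<ge> 0" "\<delta> > 0"
  shows "ennreal \<bar>a - b\<bar> \<le> ennreal (1/\<delta>) * kl a b + ennreal (\<delta> * (a + b))"
proof (cases "b > 0")
  case True
  let ?s = "sqrt a - sqrt b" and ?t = "sqrt a + sqrt b"
  have st: "a - b = ?s * ?t"
    using assms by (simp add: algebra_simps)
  have "0 \<le> (\<bar>?s\<bar> / \<delta> - ?t)\<^sup>2 * (\<delta>/2)" using assms by simp
  also have "\<dots> = ?s\<^sup>2 / (2*\<delta>) - \<bar>?s\<bar> * ?t + \<delta>/2 * ?t\<^sup>2"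
    using assms by (simp add: power2_diff power_divide) (simp add: field_simps power2_eq_square)
  finally have 1: "\<bar>?s\<bar> * ?t \<le> ?s\<^sup>2 / (2*\<delta>) + \<delta>/2 * ?t\<^sup>2" by simp
  have 2: "\<bar>a - b\<bar> = \<bar>?s\<bar> * ?t" unfolding st abs_mult using assms by simp
  have "0 \<le> ?s\<^sup>2" by simp
  then have 3: "?t\<^sup>2 \<le> 2 * (a + b)" using assms by (simp add: power2_sum power2_diff)
  have "?s\<^sup>2 / (2*\<delta>) \<le> ?s\<^sup>2 / \<delta>" using assms by (intro divide_left_mono) auto
  also have "\<dots> \<le> (a * ln (a / b) - a + b) / \<delta>"
    using hellinger_le_kl[OF assms(1) True] assms by (intro divide_right_mono) auto
  finally have "\<bar>a - b\<bar> \<le> (a * ln (a / b) - a + b) / \<delta> + \<delta> * (a + b)"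
    using 1 2 mult_left_mono[OF 3, of "\<delta>/2"] assms by (simp add: algebra_simps)
  then have "ennreal \<bar>a - b\<bar> \<le> ennreal ((a * ln (a / b) - a + b) / \<delta> + \<delta> * (a + b))"
    by (rule ennreal_leI)
  also have "\<dots> = ennreal (1/\<delta>) * kl a b + ennreal (\<delta> * (a + b))"
    using assms True kl_real_nonneg[OF assms(1) True]
    by (simp add: kl_pos ennreal_mult[symmetric] ennreal_plus[symmetric] del: ennreal_plus)
  finally show ?thesis .
next
  case False
  then have b: "b = 0" using assms by simp
  show ?thesis
  proof (cases "a = 0")
    case True then show ?thesis using b by simp
  next
    case False
    then have "kl a b = \<infinity>" using b assms by (simp add: kl_def)
    then show ?thesis using assms by (simp add: ennreal_mult_top)
  qed
qed

lemma kl_eq_0D: "kl a b = 0 \<Longrightarrow> a \<ge> 0 \<Longrightarrow> b \<ge> 0 \<Longrightarrow> a = b"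
proof -
  assume k: "kl a b = 0" and ab: "a \<ge> 0" "b \<ge> 0"
  show "a = b"
  proof (cases "b > 0")
    case True
    have "a * ln (a / b) - a + b \<le> 0" using k by (simp add: kl_pos True ennreal_eq_0_iff)
    then have "(sqrt a - sqrt b)\<^sup>2 \<le> 0"
      using hellinger_le_kl[OF ab(1) True] by linarith
    then have "sqrt a - sqrt b = 0" by (metis power2_less_eq_zero_iff)
    then show ?thesis by simp
  next
    case False
    then show ?thesis using k ab by (auto simp: kl_def split: if_splits)
  qed
qed

text \<open>The compensation identity: the linear terms cancel because \<open>m\<close> is the average, and the logarithm of
\<open>k\<close> enters through \<open>ln (m / k)\<close> only.\<close>

lemma kl_three_point:
  fixes a b k t :: real
  assumes ab: "a \<ge> 0" "b \<ge> 0" and k: "k > 0" and t: "0 < t" "t < 1"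
  defines "m \<equiv> (1 - t) * a + t * b"
  shows "ennreal (1 - t) * kl a k + ennreal t * kl b k
    = kl m k + (ennreal (1 - t) * kl a m + ennreal t * kl b m)"
proof (cases "m = 0")
  case True
  then have "(1 - t) * a = 0" "t * b = 0"
    using ab t unfolding m_def by (auto simp: add_nonneg_eq_0_iff)
  then have "a = 0" "b = 0" using t by auto
  then show ?thesis using True t k
    by (simp add: kl_zero_left ennreal_mult[symmetric] ennreal_plus[symmetric] algebra_simps del: ennreal_plus)
next
  case False
  then have m: "m > 0" unfolding m_def using ab t by (simp add: add_nonneg_nonneg order_less_le)
  have nn: "0 \<le> a * ln (a / k) - a + k" "0 \<le> b * ln (b / k) - b + k" "0 \<le> m * ln (m / k) - m + k"
    "0 \<le> a * ln (a / m) - a + m" "0 \<le> b * ln (b / m) - b + m"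
    using ab k m by (auto intro!: kl_real_nonneg)
  have A: "a * ln (a / k) = a * ln (a / m) + a * ln (m / k)" for a
    using k m by (cases "a = 0") (auto simp: ln_div[of a] ln_div[of m k] ln_div algebra_simps abs_if)
  have "(1 - t) * (a * ln (a / k) - a + k) + t * (b * ln (b / k) - b + k)
    = (m * ln (m / k) - m + k) + ((1 - t) * (a * ln (a / m) - a + m) + t * (b * ln (b / m) - b + m))"
    unfolding A[of a] A[of b] m_def[symmetric]
    by (simp add: algebra_simps) (simp add: m_def algebra_simps)
  then show ?thesis
    using nn t k m by (simp add: kl_pos ennreal_mult[symmetric] ennreal_plus[symmetric] del: ennreal_plus)
qed

lemma rel_entropy_cases:
  assumes "sigma_finite_measure q" "prob_space p" "sets p = sets q" "rel_entropy p q \<noteq> \<infinity>"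
  obtains f where "f \<in> borel_measurable q" "\<And>x. 0 \<le> f x" "p = density q (\<lambda>x. ennreal (f x))"
    "integrable p (\<lambda>x. ln (f x))" "rel_entropy p q = ereal (\<integral>x. ln (f x) \<partial>p)"
proof -
  interpret q: sigma_finite_measure q by fact
  interpret p: prob_space p by fact
  have ac: "absolutely_continuous q p" and int: "integrable p (entropy_density (exp 1) q p)"
    using assms(4) by (auto simp: rel_entropy_def split: if_splits)
  define f where "f x = enn2real (RN_deriv q p x)" for x
  have [measurable]: "f \<in> borel_measurable q" unfolding f_def by simp
  have fin: "AE x in q. RN_deriv q p x \<noteq> \<infinity>"
    by (rule q.RN_deriv_finite) (use assms ac p.sigma_finite_measure_axioms in auto)
  have "p = density q (RN_deriv q p)" using q.density_RN_deriv[OF ac] assms by simp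
  also have "\<dots> = density q (\<lambda>x. ennreal (f x))"
    by (rule density_cong) (use fin in \<open>auto simp: f_def top.not_eq_extremum\<close>)
  finally have p: "p = density q (\<lambda>x. ennreal (f x))" .
  have ed: "entropy_density (exp 1) q p = (\<lambda>x. ln (f x))"
    by (auto simp: entropy_density_def f_def log_def comp_def)
  show thesis
    by (rule that[of f]) (use p ac int in \<open>auto simp: f_def[abs_def] rel_entropy_def KL_divergence_def ed f_def\<close>)
qed

lemma rel_entropy_density_one:
  assumes "prob_space q" and [measurable]: "f \<in> borel_measurable q" and nn: "\<And>x. 0 \<le> f x"
    and pp: "prob_space (density q (\<lambda>x. ennreal (f x)))"
  shows "rel_entropy (density q (\<lambda>x. ennreal (f x))) q = enn2ereal (\<integral>\<^sup>+x. kl (f x) 1 \<partial>q)"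
proof -
  interpret q: prob_space q by fact
  let ?p = "density q (\<lambda>x. ennreal (f x))"
  interpret p: prob_space ?p by fact
  have ac: "absolutely_continuous q ?p" by (rule absolutely_continuousI_density) simp
  have RN: "AE x in q. RN_deriv q ?p x = ennreal (f x)"
    using q.RN_deriv_unique[of "\<lambda>x. ennreal (f x)" ?p] by (auto elim: AE_mp)
  have ed: "AE x in ?p. entropy_density (exp 1) q ?p x = ln (f x)"
    using RN nn by (auto simp: AE_density entropy_density_def log_def elim!: AE_mp)
  have edm: "entropy_density (exp 1) q ?p \<in> borel_measurable ?p" by simp
  have i1: "integrable ?p (entropy_density (exp 1) q ?p) \<longleftrightarrow> integrable q (\<lambda>x. f x * ln (f x))"
    using integrable_cong_AE[OF _ _ ed] nn by (simp add: integrable_real_density)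
  have i2: "KL_divergence (exp 1) q ?p = (\<integral>x. f x * ln (f x) \<partial>q)"
    unfolding KL_divergence_def using integral_cong_AE[OF _ _ ed] nn by (simp add: integral_real_density)
  have "(\<integral>\<^sup>+x. ennreal (f x) \<partial>q) = 1"
    using p.emeasure_space_1 by (simp add: emeasure_density)
  then have fi: "integrable q f" and f1: "(\<integral>x. f x \<partial>q) = 1"
    using nn integrableI_nn_integral_finite[of f q 1] by (auto simp: integral_eq_nn_integral)
  have klf: "kl (f x) 1 = ennreal (f x * ln (f x) - f x + 1)" for x by (simp add: kl_pos)
  have knn: "0 \<le> f x * ln (f x) - f x + 1" for x using kl_real_nonneg[of "f x" 1] nn[of x] by simp
  show ?thesis
  proof (cases "integrable q (\<lambda>x. f x * ln (f x))")
    case True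
    have "(\<integral>\<^sup>+x. kl (f x) 1 \<partial>q) = ennreal (\<integral>x. f x * ln (f x) - f x + 1 \<partial>q)"
      unfolding klf by (rule nn_integral_eq_integral) (use True fi knn in auto)
    moreover have "0 \<le> (\<integral>x. f x * ln (f x) - f x + 1 \<partial>q)" by (rule integral_nonneg_AE) (use knn in auto)
    moreover have "(\<integral>x. f x * ln (f x) - f x + 1 \<partial>q) = (\<integral>x. f x * ln (f x) \<partial>q)"
      using True fi f1 by (simp add: q.prob_space)
    ultimately show ?thesis using True ac i1 i2 by (simp add: rel_entropy_def)
  next
    case False
    have "(\<integral>\<^sup>+x. kl (f x) 1 \<partial>q) = \<infinity>"
    proof (rule ccontr)
      assume "(\<integral>\<^sup>+x. kl (f x) 1 \<partial>q) \<noteq> \<infinity>"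
      then have "integrable q (\<lambda>x. f x * ln (f x) - f x + 1)"
        unfolding klf by (intro integrableI_nonneg) (use knn in \<open>auto simp: top.not_eq_extremum\<close>)
      from Bochner_Integration.integrable_diff[OF Bochner_Integration.integrable_add[OF this fi] q.integrable_const[of 1]]
      have "integrable q (\<lambda>x. ((f x * ln (f x) - f x + 1) + f x) - 1)" .
      moreover have "(\<lambda>x. ((f x * ln (f x) - f x + 1) + f x) - 1) = (\<lambda>x. f x * ln (f x))" by auto
      ultimately show False using False by simp
    qed
    then show ?thesis using False i1 by (simp add: rel_entropy_def)
  qed
qed

lemma rel_entropy_density_density:
  assumes [measurable]: "f \<in> borel_measurable M" "g \<in> borel_measurable M"
    and f: "\<And>x. 0 \<le> f x" and g: "\<And>x. 0 < g x"
    and "prob_space (density M (\<lambda>x. ennreal (f x)))" "prob_space (density M (\<lambda>x. ennreal (g x)))"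
  shows "rel_entropy (density M (\<lambda>x. ennreal (f x))) (density M (\<lambda>x. ennreal (g x)))
    = enn2ereal (\<integral>\<^sup>+x. kl (f x) (g x) \<partial>M)"
proof -
  let ?q = "density M (\<lambda>x. ennreal (g x))"
  have e: "ennreal (g x) * ennreal (f x / g x) = ennreal (f x)" for x
    using f[of x] g[of x] by (simp add: ennreal_mult[symmetric] less_imp_le)
  have d: "density M (\<lambda>x. ennreal (f x)) = density ?q (\<lambda>x. ennreal (f x / g x))"
    by (subst density_density_eq) (auto simp: e)
  have k: "ennreal (g x) * kl (f x / g x) 1 = kl (f x) (g x)" for x
  proof -
    have "g x * (f x / g x * ln (f x / g x / 1) - f x / g x + 1) = f x * ln (f x / g x) - f x + g x"
      using g[of x] by (simp add: algebra_simps)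
    then show ?thesis
      using f[of x] g[of x] kl_real_nonneg[of "f x / g x" 1]
      by (simp add: kl_pos ennreal_mult[symmetric] less_imp_le)
  qed
  have "rel_entropy (density ?q (\<lambda>x. ennreal (f x / g x))) ?q = enn2ereal (\<integral>\<^sup>+x. kl (f x / g x) 1 \<partial>?q)"
    by (rule rel_entropy_density_one) (use assms f g d in \<open>auto simp: less_imp_le\<close>)
  also have "(\<integral>\<^sup>+x. kl (f x / g x) 1 \<partial>?q) = (\<integral>\<^sup>+x. kl (f x) (g x) \<partial>M)"
    by (simp add: nn_integral_density k)
  finally show ?thesis unfolding d .
qed

text \<open>The divergence is a supremum of functions that are affine in \<open>(a, b)\<close>; the best slope is
\<open>s = ln (a / b)\<close>. Lower semicontinuity, also at \<open>b = 0\<close>, follows.\<close>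

lemma kl_ge_linear:
  assumes a: "a \<ge> 0" and b: "b \<ge> 0"
  shows "ennreal (a * s - b * (exp s - 1)) \<le> kl a b"
proof (cases "a > 0 \<and> b \<le> 0")
  case True then show ?thesis by (simp add: kl_def)
next
  case False
  show ?thesis
  proof (cases "b > 0")
    case True
    have "0 \<le> a * ln (a / (b * exp s)) - a + b * exp s"
      using a True by (intro kl_real_nonneg) auto
    moreover have "a * ln (a / (b * exp s)) = a * ln (a / b) - a * s"
      using a True by (cases "a = 0") (auto simp: ln_div ln_mult algebra_simps)
    ultimately have "a * s - b * (exp s - 1) \<le> a * ln (a / b) - a + b"
      by (simp add: algebra_simps)
    then show ?thesis using True by (simp add: kl_pos ennreal_leI)
  next
    case False
    with \<open>\<not> (a > 0 \<and> b \<le> 0)\<close> a b have "a = 0" "b = 0" by auto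
    then show ?thesis by simp
  qed
qed

lemma kl_lsc:
  fixes f g :: "nat \<Rightarrow> real"
  assumes f: "f \<longlonglongrightarrow> a" and g: "g \<longlonglongrightarrow> b" and fn: "\<And>n. 0 \<le> f n" and gn: "\<And>n. 0 \<le> g n"
  shows "kl a b \<le> liminf (\<lambda>n. kl (f n) (g n))"
proof -
  have a: "a \<ge> 0" using LIMSEQ_le_const[OF f] fn by auto
  have b: "b \<ge> 0" using LIMSEQ_le_const[OF g] gn by auto
  have *: "ennreal (a * s - b * (exp s - 1)) \<le> liminf (\<lambda>n. kl (f n) (g n))" for s
  proof -
    have "(\<lambda>n. ennreal (f n * s - g n * (exp s - 1))) \<longlonglongrightarrow> ennreal (a * s - b * (exp s - 1))"
      by (intro tendsto_intros f g)
    then have "ennreal (a * s - b * (exp s - 1)) = liminf (\<lambda>n. ennreal (f n * s - g n * (exp s - 1)))"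
      by (intro lim_imp_Liminf[symmetric]) auto
    also have "\<dots> \<le> liminf (\<lambda>n. kl (f n) (g n))"
      by (intro Liminf_mono always_eventually allI kl_ge_linear fn gn)
    finally show ?thesis .
  qed
  consider "a > 0" "b > 0" | "a > 0" "b = 0" | "a = 0" using a b by force
  then show ?thesis
  proof cases
    case 1
    have "a * ln (a / b) - b * (exp (ln (a / b)) - 1) = a * ln (a / b) - a + b"
      using 1 by (simp add: algebra_simps)
    from *[of "ln (a / b)", unfolded this] show ?thesis using 1 by (simp add: kl_pos)
  next
    case 2
    have "ennreal r \<le> liminf (\<lambda>n. kl (f n) (g n))" for r
      using *[of "r / a"] 2 by simp
    then have "liminf (\<lambda>n. kl (f n) (g n)) = top"
      by (metis ennreal_le_epsilon ennreal_top_neq_one neq_top_trans top.extremum_uniqueI top_neq_ennreal ennreal_cases ennreal_less_iff gt_ex linorder_not_le order_le_less)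
    then show ?thesis by simp
  next
    case 3
    have "(\<lambda>n. ennreal (a * (- real n) - b * (exp (- real n) - 1))) \<longlonglongrightarrow> ennreal (0 - b * (0 - 1))"
      unfolding 3 mult_zero_left
      by (intro tendsto_intros filterlim_compose[OF exp_at_bot]
          filterlim_compose[OF filterlim_uminus_at_bot_at_top filterlim_real_sequentially])
    then have "ennreal b \<le> liminf (\<lambda>n. kl (f n) (g n))"
      by (intro LIMSEQ_le_const2[where X="\<lambda>n. ennreal (a * (- real n) - b * (exp (- real n) - 1))"]) (use *[of "- real _"] in auto)
    then show ?thesis using 3 by (simp add: kl_zero_left)
  qed
qed

lemma rel_entropy_nonneg:
  assumes q: "prob_space q" and p: "prob_space p" and s: "sets p = sets q"
  shows "0 \<le> rel_entropy p q"
proof (cases "rel_entropy p q = \<infinity>")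
  case False
  interpret q: prob_space q by fact
  obtain f where "f \<in> borel_measurable q" "\<And>x. 0 \<le> f x" "p = density q (\<lambda>x. ennreal (f x))"
    using rel_entropy_cases[OF q.sigma_finite_measure_axioms p s False] by metis
  then show ?thesis using rel_entropy_density_one[OF q, of f] p by simp
qed simp

text \<open>Data processing. With \<open>f = dp/dq\<close> and \<open>u\<close> the density of the images, \<open>u \<circ> X / f\<close> has \<open>p\<close>-integral at
most 1, and \<open>ln t \<le> t - 1\<close> compares the two logarithms.\<close>

lemma rel_entropy_distr_le:
  assumes q: "prob_space q" and p: "prob_space p" and s: "sets p = sets q" and X[measurable]: "X \<in> measurable q N"
    and fin: "rel_entropy (distr p N X) (distr q N X) \<noteq> \<infinity>"
  shows "rel_entropy (distr p N X) (distr q N X) \<le> rel_entropy p q"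
proof (cases "rel_entropy p q = \<infinity>")
  case False
  interpret q: prob_space q by fact
  interpret p: prob_space p by fact
  have Xp[measurable]: "X \<in> measurable p N" using X measurable_cong_sets[OF s refl] by blast
  interpret q': prob_space "distr q N X" by (rule q.prob_space_distr) measurable
  interpret p': prob_space "distr p N X" by (rule p.prob_space_distr) measurable
  obtain f where f[measurable]: "f \<in> borel_measurable q" and f0: "\<And>x. 0 \<le> f x" and pf: "p = density q (\<lambda>x. ennreal (f x))"
    and fi: "integrable p (\<lambda>x. ln (f x))" and fe: "rel_entropy p q = ereal (\<integral>x. ln (f x) \<partial>p)"
    using rel_entropy_cases[OF q.sigma_finite_measure_axioms p s False] by metis
  obtain u where u[measurable]: "u \<in> borel_measurable (distr q N X)" and u0: "\<And>x. 0 \<le> u x"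
    and pu: "distr p N X = density (distr q N X) (\<lambda>x. ennreal (u x))"
    and ui: "integrable (distr p N X) (\<lambda>x. ln (u x))"
    and ue: "rel_entropy (distr p N X) (distr q N X) = ereal (\<integral>x. ln (u x) \<partial>distr p N X)"
    using rel_entropy_cases[OF q'.sigma_finite_measure_axioms p'.prob_space_axioms _ fin] by (metis sets_distr)
  have uN[measurable]: "u \<in> borel_measurable N" using u by simp
  have uXi: "integrable p (\<lambda>x. ln (u (X x)))" and uXI: "(\<integral>x. ln (u x) \<partial>distr p N X) = (\<integral>x. ln (u (X x)) \<partial>p)"
    using ui by (auto simp: integrable_distr_eq integral_distr)
  have "AE y in distr p N X. 0 < u y" unfolding pu by (subst AE_density) auto
  then have uX: "AE x in p. 0 < u (X x)" by (rule AE_distrD[OF Xp])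
  have fp: "AE x in p. 0 < f x" unfolding pf by (subst AE_density) auto
  have mp: "g \<in> borel_measurable p" if "g \<in> borel_measurable q" for g :: "_ \<Rightarrow> real"
    using that measurable_cong_sets[OF s refl] by blast
  have rm: "(\<lambda>x. u (X x) / f x) \<in> borel_measurable p" by (rule mp) measurable
  have rle: "(\<integral>\<^sup>+x. ennreal (u (X x) / f x) \<partial>p) \<le> 1"
  proof -
    have "(\<integral>\<^sup>+x. ennreal (u (X x) / f x) \<partial>p) = (\<integral>\<^sup>+x. ennreal (f x) * ennreal (u (X x) / f x) \<partial>q)"
      unfolding pf by (rule nn_integral_density) measurable
    also have "\<dots> \<le> (\<integral>\<^sup>+x. ennreal (u (X x)) \<partial>q)"
    proof (rule nn_integral_mono)
      fix x show "ennreal (f x) * ennreal (u (X x) / f x) \<le> ennreal (u (X x))"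
        using f0[of x] u0 by (cases "f x = 0") (auto simp: ennreal_mult[symmetric])
    qed
    also have "\<dots> = (\<integral>\<^sup>+y. ennreal (u y) \<partial>distr q N X)" by (rule nn_integral_distr[symmetric]) measurable
    also have "\<dots> = (\<integral>\<^sup>+y. ennreal (u y) * indicator (space (distr q N X)) y \<partial>distr q N X)"
      by (rule nn_integral_cong) simp
    also have "\<dots> = emeasure (distr p N X) (space (distr q N X))"
      unfolding pu by (rule emeasure_density[symmetric]) (use u in auto)
    also have "\<dots> = 1" using p'.emeasure_space_1 by simp
    finally show ?thesis .
  qed
  have ri: "integrable p (\<lambda>x. u (X x) / f x)"
    using rle rm f0 u0 by (intro integrableI_nonneg) (auto intro: le_less_trans)
  have rI: "(\<integral>x. u (X x) / f x \<partial>p) \<le> 1"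
  proof -
    have "ennreal (\<integral>x. u (X x) / f x \<partial>p) \<le> ennreal 1"
      using rle nn_integral_eq_integral[OF ri] f0 u0 by simp
    then show ?thesis by (subst (asm) ennreal_le_iff) auto
  qed
  have "(\<integral>x. 1 - u (X x) / f x \<partial>p) \<le> (\<integral>x. ln (f x) - ln (u (X x)) \<partial>p)"
  proof (rule integral_mono_AE)
    show "AE x in p. 1 - u (X x) / f x \<le> ln (f x) - ln (u (X x))"
      using uX fp
    proof eventually_elim
      case (elim x)
      have "ln (u (X x) / f x) \<le> u (X x) / f x - 1" using elim by (intro ln_le_minus_one) simp
      then show ?case using elim by (simp add: ln_div)
    qed
  qed (use ri fi uXi in auto)
  moreover have "(\<integral>x. 1 - u (X x) / f x \<partial>p) = 1 - (\<integral>x. u (X x) / f x \<partial>p)" using ri p.prob_space by simp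
  moreover have "(\<integral>x. ln (f x) - ln (u (X x)) \<partial>p) = (\<integral>x. ln (f x) \<partial>p) - (\<integral>x. ln (u (X x)) \<partial>p)" using fi uXi by simp
  ultimately show ?thesis unfolding fe ue uXI using rI by simp
qed simp

text \<open>Transfers an identity in \<open>[0,\<infinity>]\<close>, where all terms have been moved to the side on which they are
positive, to the extended reals, where the transport objective is stated.\<close>

lemma enn2ereal_weighted_sum:
  fixes T H E :: ennreal and \<epsilon> g :: real
  assumes eps: "\<epsilon> > 0" and g: "g \<ge> 0" and e: "E + 1 = H + ennreal (1 / \<epsilon>) * T + ennreal g"
  shows "enn2ereal T + ereal \<epsilon> * enn2ereal H = ereal \<epsilon> * enn2ereal E + ereal (\<epsilon> * (1 - g))"
proof (cases "T = \<infinity> \<or> H = \<infinity>")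
  case True
  then have "E + 1 = \<infinity>" unfolding e using eps by (auto simp: ennreal_mult_top)
  then have "enn2ereal E = \<infinity>" by (simp add: ennreal_add_eq_top)
  moreover have "enn2ereal T \<ge> 0" "enn2ereal H \<ge> 0" "enn2ereal T = \<infinity> \<or> enn2ereal H = \<infinity>"
    using True by auto
  ultimately show ?thesis using eps by (cases "enn2ereal T"; cases "enn2ereal H") auto
next
  case False
  then obtain t h where TH: "T = ennreal t" "H = ennreal h" "t \<ge> 0" "h \<ge> 0"
    by (cases T; cases H) auto
  have e1: "E + 1 = ennreal (h + 1/\<epsilon> * t + g)"
    unfolding e TH using TH eps g
    by (simp add: ennreal_mult[symmetric] ennreal_plus[symmetric] del: ennreal_plus)
  then obtain r where E: "E = ennreal r" "r \<ge> 0" by (cases E) auto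
  have "ennreal (r + 1) = ennreal (h + 1/\<epsilon> * t + g)" using e1 E by (simp add: ennreal_plus)
  then have "r + 1 = h + 1/\<epsilon> * t + g" using E TH eps g by (subst (asm) ennreal_inj) auto
  then have "r = h + t / \<epsilon> + g - 1" by simp
  then have "\<epsilon> * r = \<epsilon> * h + t + \<epsilon> * g - \<epsilon>" using eps by (simp add: distrib_left right_diff_distrib)
  then have "\<epsilon> * r + \<epsilon> * (1 - g) = t + \<epsilon> * h" by (simp add: right_diff_distrib)
  then show ?thesis unfolding E TH using E(2) TH(3,4) by (simp add: enn2ereal_ennreal)
qed

section \<open>Auxiliary measure theory\<close>

text \<open>The Riesz--Fischer argument: a telescoping series that converges in norm converges almost everywhere
and is dominated by the sum of its absolute values.\<close>

lemma L1_summable_limit: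
  fixes f :: "nat \<Rightarrow> 'b \<Rightarrow> real"
  assumes int: "\<And>n. integrable M (f n)"
    and le: "\<And>n. (\<integral>\<^sup>+x. ennreal \<bar>f (Suc n) x - f n x\<bar> \<partial>M) \<le> ennreal (b n)"
    and b: "summable b" "\<And>n. 0 \<le> b n"
  obtains g w where "integrable M g" "integrable M w" "AE x in M. (\<lambda>n. f n x) \<longlonglongrightarrow> g x"
    "\<And>n. AE x in M. \<bar>f n x\<bar> \<le> w x"
proof -
  have [measurable]: "f n \<in> borel_measurable M" for n using int by auto
  define D where "D n x = f (Suc n) x - f n x" for n x
  have Dint: "integrable M (D n)" for n unfolding D_def[abs_def] using int by auto
  have "(\<integral>\<^sup>+x. (\<Sum>n. ennreal \<bar>D n x\<bar>) \<partial>M) = (\<Sum>n. \<integral>\<^sup>+x. ennreal \<bar>D n x\<bar> \<partial>M)"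
    unfolding D_def by (rule nn_integral_suminf) auto
  also have "\<dots> \<le> (\<Sum>n. ennreal (b n))"
    unfolding D_def by (intro suminf_le le) auto
  also have "\<dots> = ennreal (\<Sum>n. b n)" using b by (intro suminf_ennreal2) auto
  finally have "(\<integral>\<^sup>+x. (\<Sum>n. ennreal \<bar>D n x\<bar>) \<partial>M) \<noteq> \<infinity>" by (auto simp: top_unique)
  then have "AE x in M. (\<Sum>n. ennreal \<bar>D n x\<bar>) \<noteq> \<infinity>"
    by (intro nn_integral_PInf_AE) (auto simp: D_def)
  then have sumAE: "AE x in M. summable (\<lambda>n. norm (D n x))"
    by eventually_elim (auto intro!: summable_suminf_not_top)
  have Dle: "(\<integral>x. norm (D n x) \<partial>M) \<le> b n" for n
  proof -
    have "ennreal (\<integral>x. norm (D n x) \<partial>M) = (\<integral>\<^sup>+x. ennreal (norm (D n x)) \<partial>M)"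
      using Dint by (intro nn_integral_eq_integral[symmetric]) auto
    also have "\<dots> \<le> ennreal (b n)" using le[of n] by (simp add: D_def)
    finally show ?thesis using b by (simp add: ennreal_le_iff)
  qed
  have sn: "summable (\<lambda>n. \<integral>x. norm (D n x) \<partial>M)"
    by (rule summable_comparison_test[OF _ b(1)]) (use Dle in \<open>auto intro!: exI[of _ 0]\<close>)
  have I1: "integrable M (\<lambda>x. \<Sum>n. D n x)"
    by (rule integrable_suminf) (use Dint sumAE sn in auto)
  have I2: "integrable M (\<lambda>x. \<Sum>n. norm (D n x))"
    by (rule integrable_suminf) (use Dint sumAE sn in auto)
  have tel: "f n x = f 0 x + (\<Sum>k<n. D k x)" for n x
    unfolding D_def by (subst sum_lessThan_telescope) auto
  show thesis
  proof (rule that[of "\<lambda>x. f 0 x + (\<Sum>n. D n x)" "\<lambda>x. \<bar>f 0 x\<bar> + (\<Sum>n. norm (D n x))"])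
    show "integrable M (\<lambda>x. f 0 x + (\<Sum>n. D n x))" using int I1 by auto
    show "integrable M (\<lambda>x. \<bar>f 0 x\<bar> + (\<Sum>n. norm (D n x)))" using int I2 by auto
    show "AE x in M. (\<lambda>n. f n x) \<longlonglongrightarrow> f 0 x + (\<Sum>n. D n x)"
      using sumAE
    proof eventually_elim
      case (elim x)
      have "(\<lambda>n. \<Sum>k<n. D k x) \<longlonglongrightarrow> (\<Sum>n. D n x)"
        by (rule summable_LIMSEQ) (rule summable_norm_cancel[OF elim])
      then show ?case by (subst tel) (intro tendsto_intros)
    qed
    show "AE x in M. \<bar>f n x\<bar> \<le> \<bar>f 0 x\<bar> + (\<Sum>n. norm (D n x))" for n
      using sumAE
    proof eventually_elim
      case (elim x)
      have "\<bar>\<Sum>k<n. D k x\<bar> \<le> (\<Sum>k<n. norm (D k x))" by (metis norm_sum real_norm_def)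
      also have "\<dots> \<le> (\<Sum>k. norm (D k x))" by (rule sum_le_suminf) (use elim in auto)
      finally show ?case using tel[of n x] by linarith
    qed
  qed
qed

lemma prob_space_AE_ex:
  assumes M: "prob_space M" and Q: "AE x in M. Q x"
  shows "\<exists>x. Q x"
proof (rule ccontr)
  assume "\<not> (\<exists>x. Q x)"
  then have "AE x in M. False" using Q by simp
  then show False using prob_space.AE_False[OF M] by simp
qed

lemma integrable_weight_le_1:
  fixes f g :: "'b \<Rightarrow> real"
  assumes f: "integrable M f" and [measurable]: "g \<in> borel_measurable M" and g: "\<And>x. \<bar>g x\<bar> \<le> 1"
  shows "integrable M (\<lambda>x. g x * f x)"
proof (rule Bochner_Integration.integrable_bound[OF f])
  have "norm (g x * f x) \<le> norm (f x)" for x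
    using mult_right_mono[OF g[of x], of "\<bar>f x\<bar>"] by (simp add: abs_mult)
  then show "AE x in M. norm (g x * f x) \<le> norm (f x)" by simp
qed (use f in measurable)

lemma borel_measurable_of_integrable:
  fixes f :: "'a::topological_space \<Rightarrow> real"
  assumes "integrable M f" "sets M = sets borel"
  shows "f \<in> borel_measurable borel"
  using borel_measurable_integrable[OF assms(1)] measurable_cong_sets[OF assms(2) refl] by blast

text \<open>The complement of the support is covered by countably many null balls.\<close>

lemma AE_msupport:
  fixes p :: "'a::euclidean_space measure"
  assumes s: "sets p = sets borel"
  shows "AE x in p. x \<in> msupport p"
proof -
  define F where "F = {ball x r |x r. r > 0 \<and> emeasure p (ball x r) = 0}"
  have F: "S \<in> null_sets p \<and> open S" if "S \<in> F" for S
  proof -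
    from that obtain x r where "S = ball x r" "emeasure p (ball x r) = 0" unfolding F_def by blast
    then show ?thesis using s by (simp add: null_sets_def)
  qed
  have "\<exists>F'. F' \<subseteq> F \<and> countable F' \<and> \<Union>F' = \<Union>F" using Lindelof[of F] F by metis
  then obtain F' where F': "F' \<subseteq> F" "countable F'" "\<Union>F' = \<Union>F" by (elim exE conjE)
  have "S \<in> null_sets p" if "S \<in> F'" for S using subsetD[OF F'(1) that] F by blast
  then have "\<Union>F' \<in> null_sets p" using null_sets_UN'[OF F'(2), of id p] by simp
  moreover have "{x \<in> space p. x \<notin> msupport p} \<subseteq> \<Union>F'"
  proof
    fix x assume "x \<in> {x \<in> space p. x \<notin> msupport p}"
    then have "x \<notin> msupport p" by simp
    then obtain r where "r > 0" "\<not> 0 < emeasure p (ball x r)" unfolding msupport_def by blast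
    then have "r > 0" "emeasure p (ball x r) = 0" by (simp_all add: zero_less_iff_neq_zero)
    then have "ball x r \<in> F" "x \<in> ball x r" unfolding F_def by auto
    then show "x \<in> \<Union>F'" unfolding F'(3) by (rule UnionI)
  qed
  ultimately show ?thesis by (rule AE_I')
qed

section \<open>Couplings given by densities\<close>

locale eot_problem =
  fixes \<mu> \<nu> :: "'a::euclidean_space measure" and \<epsilon> :: real
  assumes eps: "\<epsilon> > 0" and mu_P2: "\<mu> \<in> P2" and nu_P2: "\<nu> \<in> P2"
begin

sublocale mu: prob_space \<mu> using mu_P2 by (simp add: P2_def)

sublocale nu: prob_space \<nu> using nu_P2 by (simp add: P2_def)

sublocale P: pair_prob_space \<mu> \<nu> ..

abbreviation P :: "('a \<times> 'a) measure" where "P \<equiv> \<mu> \<Otimes>\<^sub>M \<nu>"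

lemma sets_mu [measurable_cong, simp]: "sets \<mu> = sets borel" using mu_P2 by (simp add: P2_def)

lemma sets_nu [measurable_cong, simp]: "sets \<nu> = sets borel" using nu_P2 by (simp add: P2_def)

lemma space_mu [simp]: "space \<mu> = UNIV" using sets_eq_imp_space_eq[OF sets_mu] by simp

lemma space_nu [simp]: "space \<nu> = UNIV" using sets_eq_imp_space_eq[OF sets_nu] by simp

lemma mu_UNIV [simp]: "emeasure \<mu> UNIV = 1" using mu.emeasure_space_1 by simp

lemma nu_UNIV [simp]: "emeasure \<nu> UNIV = 1" using nu.emeasure_space_1 by simp

lemma space_P [simp]: "space P = UNIV" by (simp add: space_pair_measure)

lemma UNIV_sets_borel_prod [simp]: "UNIV \<in> sets (borel \<Otimes>\<^sub>M (borel :: 'a measure) :: ('a \<times> 'a) measure)"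
  using sets.top[of "borel \<Otimes>\<^sub>M borel :: ('a \<times> 'a) measure"] by (simp add: space_pair_measure)

lemma UNIV_sets_P [simp]: "UNIV \<in> sets P" using sets.top[of P] by simp

lemma sets_P: "sets P = sets borel"
  using sets_pair_measure_cong[OF sets_mu sets_nu] unfolding borel_prod .

definition cost :: "'a \<times> 'a \<Rightarrow> real" where "cost z = (norm (fst z - snd z))\<^sup>2"

definition gibbs :: "'a \<times> 'a \<Rightarrow> real" where "gibbs z = exp (- cost z / \<epsilon>)"

lemma cost_meas [measurable]: "cost \<in> borel_measurable (borel \<Otimes>\<^sub>M borel)"
  unfolding cost_def[abs_def] by measurable

lemma gibbs_meas [measurable]: "gibbs \<in> borel_measurable (borel \<Otimes>\<^sub>M borel)"
  unfolding gibbs_def[abs_def] by measurable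

lemma cost_nonneg [simp]: "0 \<le> cost z" by (simp add: cost_def)

lemma gibbs_pos [simp]: "0 < gibbs z" by (simp add: gibbs_def)

lemma gibbs_le_1: "gibbs z \<le> 1" using eps by (simp add: gibbs_def)

lemma integrable_sq_mu: "integrable \<mu> (\<lambda>x. (norm x)\<^sup>2)"
  by (rule integrableI_nonneg) (use mu_P2 in \<open>auto simp: P2_def\<close>)

lemma integrable_sq_nu: "integrable \<nu> (\<lambda>x. (norm x)\<^sup>2)"
  by (rule integrableI_nonneg) (use nu_P2 in \<open>auto simp: P2_def\<close>)

lemma cost_le: "cost z \<le> 2 * (norm (fst z))\<^sup>2 + 2 * (norm (snd z))\<^sup>2"
proof -
  have "cost z \<le> (norm (fst z) + norm (snd z))\<^sup>2"
    unfolding cost_def by (intro power_mono norm_triangle_ineq4) auto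
  also have "\<dots> \<le> 2 * (norm (fst z))\<^sup>2 + 2 * (norm (snd z))\<^sup>2"
    using zero_le_power2[of "norm (fst z) - norm (snd z)"] by (simp add: power2_sum power2_diff)
  finally show ?thesis .
qed

lemma distr_fst: "distr P \<mu> fst = \<mu>" by (rule nu.distr_pair_fst)

lemma distr_snd: "distr P \<nu> snd = \<nu>"
proof (rule measure_eqI)
  fix A assume "A \<in> sets (distr P \<nu> snd)"
  then have A: "A \<in> sets \<nu>" by simp
  then have "snd -` A \<inter> space P = space \<mu> \<times> A"
    by (auto simp: space_pair_measure sets.sets_into_space[THEN subsetD])
  then show "emeasure (distr P \<nu> snd) A = emeasure \<nu> A"
    using A by (simp add: emeasure_distr nu.emeasure_pair_measure_Times del: space_P)
qed simp

lemma integrable_P_fst: "integrable \<mu> f \<Longrightarrow> integrable P (\<lambda>z. f (fst z) :: real)"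
  using integrable_distr[of fst P \<mu> f] by (simp add: distr_fst)

lemma integrable_P_snd: "integrable \<nu> f \<Longrightarrow> integrable P (\<lambda>z. f (snd z) :: real)"
  using integrable_distr[of snd P \<nu> f] by (simp add: distr_snd)

lemma nn_integral_P_fst: "f \<in> borel_measurable borel \<Longrightarrow> (\<integral>\<^sup>+z. f (fst z) \<partial>P) = (\<integral>\<^sup>+x. f x \<partial>\<mu>)"
  using nn_integral_distr[of fst P \<mu> f] by (simp add: distr_fst)

lemma nn_integral_P_snd: "f \<in> borel_measurable borel \<Longrightarrow> (\<integral>\<^sup>+z. f (snd z) \<partial>P) = (\<integral>\<^sup>+x. f x \<partial>\<nu>)"
  using nn_integral_distr[of snd P \<nu> f] by (simp add: distr_snd)

lemma integrable_cost: "integrable P cost"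
proof (rule Bochner_Integration.integrable_bound)
  show "integrable P (\<lambda>z. 2 * (norm (fst z))\<^sup>2 + 2 * (norm (snd z))\<^sup>2)"
    using integrable_P_fst[OF integrable_sq_mu] integrable_P_snd[OF integrable_sq_nu] by auto
qed (use cost_le in \<open>auto intro!: AE_I2 order_trans[OF _ abs_ge_self]\<close>)

lemma integrable_gibbs: "integrable P gibbs"
  by (rule P.integrable_const_bound[of _ 1]) (auto simp: gibbs_le_1 less_imp_le)

text \<open>The divergence of the plan with density \<open>Z\<close> from the Gibbs measure \<open>exp (- c / \<epsilon>) \<mu> \<otimes> \<nu>\<close>, which is not
normalised. The transport objective is an increasing affine function of it (\<open>objective_eq\<close>), so the
optimal plan is an entropic projection onto the couplings.\<close>

definition excess :: "('a \<times> 'a \<Rightarrow> real) \<Rightarrow> ennreal" where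
  "excess Z = (\<integral>\<^sup>+z. kl (Z z) (gibbs z) \<partial>P)"

definition plan_density :: "('a \<times> 'a \<Rightarrow> real) \<Rightarrow> bool" where
  "plan_density Z \<longleftrightarrow> Z \<in> borel_measurable (borel \<Otimes>\<^sub>M borel) \<and> (\<forall>z. 0 \<le> Z z) \<and>
     density P (\<lambda>z. ennreal (Z z)) \<in> couplings \<mu> \<nu>"

lemma plan_density_meas: "plan_density Z \<Longrightarrow> Z \<in> borel_measurable (borel \<Otimes>\<^sub>M borel)"
  by (simp add: plan_density_def)

lemma plan_density_nonneg: "plan_density Z \<Longrightarrow> 0 \<le> Z z"
  unfolding plan_density_def by blast

lemma emeasure_marginals:
  assumes [measurable]: "Z \<in> borel_measurable (borel \<Otimes>\<^sub>M borel)" and A[measurable]: "A \<in> sets borel"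
  shows "emeasure (distr (density P Z) borel fst) A = (\<integral>\<^sup>+z. Z z * indicator A (fst z) \<partial>P)"
    "emeasure (distr (density P Z) borel snd) A = (\<integral>\<^sup>+z. Z z * indicator A (snd z) \<partial>P)"
proof -
  have m: "(fst -` A) \<in> sets P" "(snd -` A) \<in> sets P"
    using measurable_sets[OF measurable_fst, of A \<mu> \<nu>] measurable_sets[OF measurable_snd, of A \<nu> \<mu>] by auto
  have [measurable]: "fst \<in> measurable P borel" "snd \<in> measurable P borel" by measurable
  show "emeasure (distr (density P Z) borel fst) A = (\<integral>\<^sup>+z. Z z * indicator A (fst z) \<partial>P)"
    using m(1) by (simp add: emeasure_distr emeasure_density) (simp add: indicator_def)
  show "emeasure (distr (density P Z) borel snd) A = (\<integral>\<^sup>+z. Z z * indicator A (snd z) \<partial>P)"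
    using m(2) by (simp add: emeasure_distr emeasure_density) (simp add: indicator_def)
qed

lemma plan_density_iff:
  assumes [measurable]: "Z \<in> borel_measurable (borel \<Otimes>\<^sub>M borel)" and nn: "\<And>z. 0 \<le> Z z"
  shows "plan_density Z \<longleftrightarrow> (\<forall>A\<in>sets borel. (\<integral>\<^sup>+z. ennreal (Z z) * indicator A (fst z) \<partial>P) = emeasure \<mu> A \<and>
      (\<integral>\<^sup>+z. ennreal (Z z) * indicator A (snd z) \<partial>P) = emeasure \<nu> A)" (is "_ \<longleftrightarrow> ?R")
proof
  assume L: "plan_density Z"
  show ?R
  proof
    fix A :: "'a set" assume A: "A \<in> sets borel"
    show "(\<integral>\<^sup>+z. ennreal (Z z) * indicator A (fst z) \<partial>P) = emeasure \<mu> A \<and>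
      (\<integral>\<^sup>+z. ennreal (Z z) * indicator A (snd z) \<partial>P) = emeasure \<nu> A"
      using emeasure_marginals[of "\<lambda>z. ennreal (Z z)" A] A L by (simp add: plan_density_def couplings_def)
  qed
next
  assume R: ?R
  have "(\<integral>\<^sup>+z. ennreal (Z z) \<partial>P) = 1"
    using R[rule_format, of UNIV] by simp
  then have "prob_space (density P (\<lambda>z. ennreal (Z z)))"
    by (intro prob_spaceI) (subst emeasure_density, auto)
  moreover have "distr (density P (\<lambda>z. ennreal (Z z))) borel fst = \<mu>"
    by (rule measure_eqI) (use R emeasure_marginals in auto)
  moreover have "distr (density P (\<lambda>z. ennreal (Z z))) borel snd = \<nu>"
    by (rule measure_eqI) (use R emeasure_marginals in auto)
  ultimately show "plan_density Z" using assms sets_P by (simp add: plan_density_def couplings_def)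
qed

lemma plan_density_mass: "plan_density Z \<Longrightarrow> (\<integral>\<^sup>+z. ennreal (Z z) \<partial>P) = 1"
  using plan_density_iff[of Z] plan_density_meas plan_density_nonneg mu.emeasure_space_1
  by (metis (no_types, lifting) UNIV_I indicator_simps(1) mult.right_neutral nn_integral_cong sets.top space_borel space_mu)

lemma plan_density_integrable: "plan_density Z \<Longrightarrow> integrable P Z"
  using plan_density_mass[of Z] plan_density_meas[of Z] plan_density_nonneg[of Z]
  by (intro integrableI_nonneg) auto

lemma plan_density_integral: "plan_density Z \<Longrightarrow> (\<integral>z. Z z \<partial>P) = 1"
  using plan_density_mass[of Z] plan_density_meas[of Z] plan_density_nonneg[of Z]
  by (subst integral_eq_nn_integral) auto

lemma plan_density_one: "plan_density (\<lambda>_. 1)"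
proof (subst plan_density_iff)
  show "\<forall>A\<in>sets borel. (\<integral>\<^sup>+z. ennreal 1 * indicator A (fst z) \<partial>P) = emeasure \<mu> A \<and>
      (\<integral>\<^sup>+z. ennreal 1 * indicator A (snd z) \<partial>P) = emeasure \<nu> A"
    by (auto simp: nn_integral_P_fst nn_integral_P_snd)
qed auto

lemma plan_density_convex:
  assumes a: "plan_density Z" and b: "plan_density Z'" and t: "0 \<le> t" "t \<le> 1"
  shows "plan_density (\<lambda>z. (1 - t) * Z z + t * Z' z)"
proof -
  note [measurable] = plan_density_meas[OF a] plan_density_meas[OF b]
  note nn = plan_density_nonneg[OF a] plan_density_nonneg[OF b]
  have mix: "(\<integral>\<^sup>+z. ennreal ((1 - t) * Z z + t * Z' z) * h z \<partial>P)
      = ennreal (1 - t) * (\<integral>\<^sup>+z. ennreal (Z z) * h z \<partial>P)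
      + ennreal t * (\<integral>\<^sup>+z. ennreal (Z' z) * h z \<partial>P)"
    if [measurable]: "h \<in> borel_measurable (borel \<Otimes>\<^sub>M borel)" for h :: "'a \<times> 'a \<Rightarrow> ennreal"
    using t nn by (simp add: ennreal_mult distrib_right nn_integral_add nn_integral_cmult mult.assoc)
  have mass: "ennreal (1 - t) * x + ennreal t * x = x" for x
    using t by (simp add: distrib_right[symmetric] ennreal_plus[symmetric] del: ennreal_plus)
  show ?thesis
  proof (subst plan_density_iff, goal_cases)
    case 3
    show ?case
    proof (intro ballI)
      fix A :: "'a set" assume A[measurable]: "A \<in> sets borel"
      have m: "(\<lambda>z. indicator A (fst z) :: ennreal) \<in> borel_measurable (borel \<Otimes>\<^sub>M borel)"
        "(\<lambda>z. indicator A (snd z) :: ennreal) \<in> borel_measurable (borel \<Otimes>\<^sub>M borel)" by measurable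
      show "(\<integral>\<^sup>+z. ennreal ((1 - t) * Z z + t * Z' z) * indicator A (fst z) \<partial>P) = emeasure \<mu> A \<and>
        (\<integral>\<^sup>+z. ennreal ((1 - t) * Z z + t * Z' z) * indicator A (snd z) \<partial>P) = emeasure \<nu> A"
        using a b plan_density_iff[of Z] plan_density_iff[of Z'] nn A
        unfolding mix[OF m(1)] mix[OF m(2)] by (simp add: mass)
    qed
  qed (use t nn in auto)
qed

definition gibbs_mass :: real where "gibbs_mass = (\<integral>z. gibbs z \<partial>P)"

text \<open>All terms are nonnegative in this form, hence it also covers plans of infinite cost or entropy.\<close>

lemma excess_plus_one:
  assumes Z: "plan_density Z"
  shows "excess Z + 1 = (\<integral>\<^sup>+z. kl (Z z) 1 \<partial>P)
    + ennreal (1 / \<epsilon>) * (\<integral>\<^sup>+z. ennreal (cost z) \<partial>density P (\<lambda>z. ennreal (Z z))) + ennreal gibbs_mass"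
proof -
  note [measurable] = plan_density_meas[OF Z]
  note nn = plan_density_nonneg[OF Z]
  have gm: "ennreal gibbs_mass = (\<integral>\<^sup>+z. ennreal (gibbs z) \<partial>P)"
    unfolding gibbs_mass_def by (rule nn_integral_eq_integral[symmetric]) (auto simp: integrable_gibbs less_imp_le)
  have pt: "kl (Z z) (gibbs z) + 1 = kl (Z z) 1 + ennreal (1/\<epsilon>) * (ennreal (Z z) * ennreal (cost z)) + ennreal (gibbs z)" for z
  proof -
    have "Z z * ln (Z z / gibbs z) = Z z * ln (Z z) + Z z * cost z / \<epsilon>"
      using nn[of z] gibbs_pos[of z] by (cases "Z z = 0") (auto simp: ln_div gibbs_def algebra_simps)
    then have "(Z z * ln (Z z / gibbs z) - Z z + gibbs z) + 1
      = (Z z * ln (Z z / 1) - Z z + 1) + (1/\<epsilon>) * (Z z * cost z) + gibbs z" by simp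
    from arg_cong[OF this, of ennreal]
    have "ennreal ((Z z * ln (Z z / gibbs z) - Z z + gibbs z) + 1)
      = ennreal ((Z z * ln (Z z / 1) - Z z + 1) + (1/\<epsilon>) * (Z z * cost z) + gibbs z)" .
    moreover have "0 \<le> Z z * ln (Z z / gibbs z) - Z z + gibbs z" "0 \<le> Z z * ln (Z z / 1) - Z z + 1"
      using nn[of z] by (auto intro!: kl_real_nonneg simp del: div_by_1)
    moreover have "ennreal (1/\<epsilon>) * (ennreal (Z z) * ennreal (cost z)) = ennreal ((1/\<epsilon>) * (Z z * cost z))"
      using nn[of z] eps by (simp add: ennreal_mult[symmetric])
    ultimately show ?thesis
      using nn[of z] eps by (simp add: kl_pos ennreal_plus less_imp_le del: div_by_1)
  qed
  have "excess Z + 1 = (\<integral>\<^sup>+z. kl (Z z) (gibbs z) + 1 \<partial>P)"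
    unfolding excess_def using P.emeasure_space_1 by (subst nn_integral_add) auto
  also have "\<dots> = (\<integral>\<^sup>+z. kl (Z z) 1 \<partial>P) + ennreal (1/\<epsilon>) * (\<integral>\<^sup>+z. ennreal (Z z) * ennreal (cost z) \<partial>P) + ennreal gibbs_mass"
    unfolding pt gm by (subst nn_integral_add | subst nn_integral_cmult | simp)+
  finally show ?thesis by (simp add: nn_integral_density)
qed

lemma objective_eq:
  assumes Z: "plan_density Z"
  shows "eot_objective \<epsilon> \<mu> \<nu> (density P (\<lambda>z. ennreal (Z z)))
    = ereal \<epsilon> * enn2ereal (excess Z) + ereal (\<epsilon> * (1 - gibbs_mass))"
proof -
  note [measurable] = plan_density_meas[OF Z]
  note nn = plan_density_nonneg[OF Z]
  let ?T = "\<integral>\<^sup>+z. ennreal (cost z) \<partial>density P (\<lambda>z. ennreal (Z z))" and ?H = "\<integral>\<^sup>+z. kl (Z z) 1 \<partial>P"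
  have pp: "prob_space (density P (\<lambda>z. ennreal (Z z)))"
    using Z by (simp add: plan_density_def couplings_def)
  have o: "eot_objective \<epsilon> \<mu> \<nu> (density P (\<lambda>z. ennreal (Z z))) = enn2ereal ?T + ereal \<epsilon> * enn2ereal ?H"
    unfolding eot_objective_def cost_def
    by (subst rel_entropy_density_one) (auto simp: nn pp P.prob_space_axioms)
  have g: "0 \<le> gibbs_mass" unfolding gibbs_mass_def by (simp add: less_imp_le)
  show ?thesis unfolding o by (rule enn2ereal_weighted_sum[OF eps g excess_plus_one[OF Z]])
qed

lemma excess_one_finite: "excess (\<lambda>_. 1) < \<infinity>"
proof -
  have "kl 1 1 = 0" by (simp add: kl_pos)
  moreover have "(\<integral>\<^sup>+z. ennreal (cost z) \<partial>P) < \<infinity>"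
    using integrable_cost by (simp add: nn_integral_eq_integral)
  ultimately have "excess (\<lambda>_. 1) + 1 < \<infinity>"
    unfolding excess_plus_one[OF plan_density_one]
    using integrable_cost by (simp add: density_1 ennreal_mult_less_top)
  then show ?thesis by (simp)
qed

text \<open>A coupling that is singular to the product has objective \<open>\<infinity>\<close>, so the minimisation runs over densities.\<close>

lemma coupling_density:
  assumes p: "\<pi> \<in> couplings \<mu> \<nu>" and fin: "eot_objective \<epsilon> \<mu> \<nu> \<pi> \<noteq> \<infinity>"
  obtains Z where "plan_density Z" "\<pi> = density P (\<lambda>z. ennreal (Z z))"
proof -
  have pr: "prob_space \<pi>" "sets \<pi> = sets P" using p sets_P by (auto simp: couplings_def)
  have "rel_entropy \<pi> P \<noteq> \<infinity>"
  proof
    assume "rel_entropy \<pi> P = \<infinity>"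
    then show False using fin eps by (simp add: eot_objective_def)
  qed
  from rel_entropy_cases[OF P.sigma_finite_measure_axioms pr this]
  obtain f where f: "f \<in> borel_measurable P" "\<And>x. 0 \<le> f x" "\<pi> = density P (\<lambda>x. ennreal (f x))" by metis
  then have "f \<in> borel_measurable (borel \<Otimes>\<^sub>M borel)"
    using measurable_cong_sets[OF sets_pair_measure_cong[OF sets_mu sets_nu] refl] by blast
  then show thesis using that[of f] f p by (simp add: plan_density_def)
qed

end

section \<open>Existence of the optimal plan\<close>

context eot_problem
begin

lemma excess_three_point:
  assumes Z: "plan_density Z" and Z': "plan_density Z'" and t: "0 < t" "t < 1"
  defines "M \<equiv> \<lambda>z. (1 - t) * Z z + t * Z' z"
  shows "ennreal (1 - t) * excess Z + ennreal t * excess Z' = excess M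
    + (ennreal (1 - t) * (\<integral>\<^sup>+z. kl (Z z) (M z) \<partial>P) + ennreal t * (\<integral>\<^sup>+z. kl (Z' z) (M z) \<partial>P))"
proof -
  note [measurable] = plan_density_meas[OF Z] plan_density_meas[OF Z']
  note nn = plan_density_nonneg[OF Z] plan_density_nonneg[OF Z']
  have [measurable]: "M \<in> borel_measurable (borel \<Otimes>\<^sub>M borel)" unfolding M_def by measurable
  have "ennreal (1 - t) * excess Z + ennreal t * excess Z'
    = (\<integral>\<^sup>+z. ennreal (1 - t) * kl (Z z) (gibbs z) + ennreal t * kl (Z' z) (gibbs z) \<partial>P)"
    unfolding excess_def by (subst nn_integral_add | subst nn_integral_cmult | simp)+
  also have "\<dots> = (\<integral>\<^sup>+z. kl (M z) (gibbs z) + (ennreal (1 - t) * kl (Z z) (M z) + ennreal t * kl (Z' z) (M z)) \<partial>P)"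
    unfolding M_def by (intro nn_integral_cong kl_three_point nn gibbs_pos t)
  also have "\<dots> = excess M
    + (ennreal (1 - t) * (\<integral>\<^sup>+z. kl (Z z) (M z) \<partial>P) + ennreal t * (\<integral>\<^sup>+z. kl (Z' z) (M z) \<partial>P))"
    unfolding excess_def by (subst nn_integral_add | subst nn_integral_cmult | simp)+
  finally show ?thesis .
qed

lemma excess_lsc:
  assumes [measurable]: "\<And>n::nat. Z n \<in> borel_measurable (borel \<Otimes>\<^sub>M borel)" and nn: "\<And>n z. 0 \<le> Z n z"
    and lim: "AE z in P. (\<lambda>n. Z n z) \<longlonglongrightarrow> Z' z"
  shows "excess Z' \<le> liminf (\<lambda>n. excess (Z n))"
proof -
  have "excess Z' \<le> (\<integral>\<^sup>+z. liminf (\<lambda>n. kl (Z n z) (gibbs z)) \<partial>P)"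
    unfolding excess_def
    by (rule nn_integral_mono_AE) (use lim in \<open>eventually_elim, intro kl_lsc tendsto_const nn less_imp_le[OF gibbs_pos]\<close>)
  also have "\<dots> \<le> liminf (\<lambda>n. excess (Z n))"
    unfolding excess_def by (rule nn_integral_liminf) auto
  finally show ?thesis .
qed

definition optimal :: "('a \<times> 'a \<Rightarrow> real) \<Rightarrow> bool" where
  "optimal Z \<longleftrightarrow> plan_density Z \<and> (\<forall>Z'. plan_density Z' \<longrightarrow> excess Z \<le> excess Z')"

text \<open>The midpoint of two nearly optimal plans is a competitor. By the three-point identity the divergences of
both plans from the midpoint are bounded by their joint excess over the infimum.\<close>

lemma nearly_optimal_close:
  assumes Z: "plan_density Z" and Z': "plan_density Z'" and e: "0 \<le> e" and \<delta>: "\<delta> > 0"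
    and I: "\<And>Y. plan_density Y \<Longrightarrow> ennreal I \<le> excess Y" "0 \<le> I"
    and le: "excess Z \<le> ennreal (I + e)" "excess Z' \<le> ennreal (I + e)"
  shows "(\<integral>\<^sup>+z. ennreal \<bar>Z' z - Z z\<bar> \<partial>P) \<le> ennreal (2 * e / \<delta> + 4 * \<delta>)"
proof -
  note [measurable] = plan_density_meas[OF Z] plan_density_meas[OF Z']
  note nn = plan_density_nonneg[OF Z] plan_density_nonneg[OF Z']
  define M where "M = (\<lambda>z. (1 - 1/2) * Z z + 1/2 * Z' z)"
  have M: "plan_density M" unfolding M_def by (rule plan_density_convex) (use Z Z' in auto)
  note [measurable] = plan_density_meas[OF M] and nnM = plan_density_nonneg[OF M]
  let ?A = "\<integral>\<^sup>+z. kl (Z z) (M z) \<partial>P" and ?B = "\<integral>\<^sup>+z. kl (Z' z) (M z) \<partial>P"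
  have half: "ennreal (1 - 1/2) = ennreal (1/2)" by simp
  have "ennreal I + ennreal (1/2) * (?A + ?B) \<le> excess M + ennreal (1/2) * (?A + ?B)"
    using I M by (intro add_right_mono) auto
  also have "\<dots> = ennreal (1/2) * excess Z + ennreal (1/2) * excess Z'"
  proof -
    have "ennreal (1/2) * excess Z + ennreal (1/2) * excess Z' = excess M + (ennreal (1/2) * ?A + ennreal (1/2) * ?B)"
      unfolding M_def by (rule excess_three_point[OF Z Z', of "1/2", unfolded half]) auto
    then show ?thesis by (simp only: distrib_left)
  qed
  also have "\<dots> \<le> ennreal (1/2) * ennreal (I + e) + ennreal (1/2) * ennreal (I + e)"
    by (intro add_mono mult_left_mono le) auto
  also have "\<dots> = ennreal I + ennreal e"
  proof -
    have "ennreal (1/2) + ennreal (1/2) = 1" by (subst ennreal_plus[symmetric]) auto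
    then have "ennreal (1/2) * x + ennreal (1/2) * x = x" for x by (metis distrib_right mult_1)
    then show ?thesis using I e by (simp add: ennreal_plus)
  qed
  finally have "ennreal (1/2) * (?A + ?B) \<le> ennreal e" by (simp add: ennreal_add_left_cancel_le)
  then have "ennreal 2 * (ennreal (1/2) * (?A + ?B)) \<le> ennreal 2 * ennreal e" by (intro mult_left_mono) auto
  moreover have "ennreal 2 * ennreal (1/2) = 1" by (subst ennreal_mult[symmetric]) auto
  ultimately have AB: "?A + ?B \<le> ennreal (2 * e)" using e by (simp add: mult.assoc[symmetric] ennreal_mult)
  have "ennreal \<bar>Z' z - Z z\<bar> \<le> ennreal (1/\<delta>) * (kl (Z z) (M z) + kl (Z' z) (M z)) + ennreal (\<delta> * (Z z + Z' z + 2 * M z))" for z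
  proof -
    have "ennreal \<bar>Z' z - Z z\<bar> \<le> ennreal (\<bar>Z z - M z\<bar> + \<bar>Z' z - M z\<bar>)" by (intro ennreal_leI) auto
    also have "\<dots> = ennreal \<bar>Z z - M z\<bar> + ennreal \<bar>Z' z - M z\<bar>" by simp
    also have "\<dots> \<le> (ennreal (1/\<delta>) * kl (Z z) (M z) + ennreal (\<delta> * (Z z + M z)))
        + (ennreal (1/\<delta>) * kl (Z' z) (M z) + ennreal (\<delta> * (Z' z + M z)))"
      by (intro add_mono abs_diff_le_kl nn nnM \<delta>)
    also have "\<dots> = ennreal (1/\<delta>) * (kl (Z z) (M z) + kl (Z' z) (M z)) + (ennreal (\<delta> * (Z z + M z)) + ennreal (\<delta> * (Z' z + M z)))"
      by (simp add: distrib_left add_ac)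
    also have "ennreal (\<delta> * (Z z + M z)) + ennreal (\<delta> * (Z' z + M z)) = ennreal (\<delta> * (Z z + Z' z + 2 * M z))"
      using \<delta> nn[of z] nnM[of z] by (simp add: ennreal_plus[symmetric] algebra_simps del: ennreal_plus)
    finally show ?thesis .
  qed
  then have "(\<integral>\<^sup>+z. ennreal \<bar>Z' z - Z z\<bar> \<partial>P)
      \<le> (\<integral>\<^sup>+z. ennreal (1/\<delta>) * (kl (Z z) (M z) + kl (Z' z) (M z)) + ennreal (\<delta> * (Z z + Z' z + 2 * M z)) \<partial>P)"
    by (intro nn_integral_mono)
  also have "\<dots> = ennreal (1/\<delta>) * (?A + ?B) + (\<integral>\<^sup>+z. ennreal (\<delta> * (Z z + Z' z + 2 * M z)) \<partial>P)"
    by (subst nn_integral_add | subst nn_integral_cmult | simp)+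
  also have "(\<integral>\<^sup>+z. ennreal (\<delta> * (Z z + Z' z + 2 * M z)) \<partial>P) = ennreal (\<integral>z. \<delta> * (Z z + Z' z + 2 * M z) \<partial>P)"
    using plan_density_integrable[OF Z] plan_density_integrable[OF Z'] plan_density_integrable[OF M] nn nnM \<delta>
    by (intro nn_integral_eq_integral) auto
  also have "(\<integral>z. \<delta> * (Z z + Z' z + 2 * M z) \<partial>P) = 4 * \<delta>"
    using plan_density_integrable[OF Z] plan_density_integrable[OF Z'] plan_density_integrable[OF M]
      plan_density_integral[OF Z] plan_density_integral[OF Z'] plan_density_integral[OF M] by simp
  also have "ennreal (1/\<delta>) * (?A + ?B) + ennreal (4 * \<delta>) \<le> ennreal (1/\<delta>) * ennreal (2 * e) + ennreal (4 * \<delta>)"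
    by (intro add_right_mono mult_left_mono AB) auto
  also have "\<dots> = ennreal (2 * e / \<delta> + 4 * \<delta>)"
    using e \<delta> by (simp add: ennreal_mult[symmetric] ennreal_plus[symmetric] del: ennreal_plus)
  finally show ?thesis .
qed

text \<open>Csiszar's construction of an entropic projection: a minimising sequence with geometric gaps is summable
in \<open>L\<^sup>1\<close>, the marginal constraints pass to the limit by dominated convergence, and the excess is lower
semicontinuous.\<close>

lemma optimal_exists: "\<exists>Z. optimal Z"
proof -
  define J where "J = (INF Z\<in>{Z. plan_density Z}. excess Z)"
  have "J \<le> excess (\<lambda>_. 1)" unfolding J_def by (rule INF_lower) (simp add: plan_density_one)
  then have "J < \<infinity>" using excess_one_finite by (rule le_less_trans)
  then obtain I where I: "J = ennreal I" "0 \<le> I" by (cases J) auto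
  have low: "ennreal I \<le> excess Y" if "plan_density Y" for Y
    unfolding I(1)[symmetric] J_def by (rule INF_lower) (simp add: that)
  have "\<exists>Z. plan_density Z \<and> excess Z \<le> ennreal (I + (1/16)^n)" for n :: nat
  proof -
    have "J < ennreal (I + (1/16)^n)" unfolding I using I by (intro ennreal_lessI) (auto intro: add_nonneg_pos)
    then show ?thesis unfolding J_def INF_less_iff by (auto intro: less_imp_le)
  qed
  then obtain Z where Z: "\<And>n. plan_density (Z n)" and Zle: "\<And>n. excess (Z n) \<le> ennreal (I + (1/16)^n)" by metis
  note [measurable] = plan_density_meas[OF Z]
  note nn = plan_density_nonneg[OF Z]
  \<comment> \<open>The gap \<open>16\<^sup>-\<^sup>n\<close> and \<open>\<delta> = 4\<^sup>-\<^sup>n\<close> balance the two terms of \<open>nearly_optimal_close\<close>.\<close>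
  have close: "(\<integral>\<^sup>+z. ennreal \<bar>Z (Suc n) z - Z n z\<bar> \<partial>P) \<le> ennreal (6 * (1/4)^n)" for n
  proof -
    have p: "(1/16::real)^n = (1/4)^n * (1/4)^n" by (simp add: power_mult_distrib[symmetric])
    have "excess (Z (Suc n)) \<le> ennreal (I + (1/16)^n)"
      by (rule order_trans[OF Zle]) (auto intro!: ennreal_leI)
    from nearly_optimal_close[OF Z Z _ _ low I(2) Zle this, of "(1/4)^n"]
    have "(\<integral>\<^sup>+z. ennreal \<bar>Z (Suc n) z - Z n z\<bar> \<partial>P) \<le> ennreal (2 * (1/16)^n / (1/4)^n + 4 * (1/4)^n)" by simp
    also have "2 * (1/16::real)^n / (1/4)^n + 4 * (1/4)^n = 6 * (1/4)^n"
      unfolding p by simp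
    finally show ?thesis .
  qed
  obtain g w where g: "integrable P g" and w: "integrable P w" and lim: "AE z in P. (\<lambda>n. Z n z) \<longlonglongrightarrow> g z"
    and dom: "\<And>n. AE z in P. \<bar>Z n z\<bar> \<le> w z"
    by (rule L1_summable_limit[of P Z "\<lambda>n. 6 * (1/4)^n"])
      (use plan_density_integrable[OF Z] close in auto)
  \<comment> \<open>Densities are required to be nonnegative everywhere, not almost everywhere.\<close>
  define Y where "Y z = max 0 (g z)" for z
  have [measurable]: "g \<in> borel_measurable P" "w \<in> borel_measurable P" using g w by auto
  have gm[measurable]: "g \<in> borel_measurable (borel \<Otimes>\<^sub>M borel)"
    using measurable_cong_sets[OF sets_pair_measure_cong[OF sets_mu sets_nu] refl] g by blast
  have Ym[measurable]: "Y \<in> borel_measurable (borel \<Otimes>\<^sub>M borel)" unfolding Y_def[abs_def] by measurable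
  have Ylim: "AE z in P. (\<lambda>n. Z n z) \<longlonglongrightarrow> Y z"
    using lim
  proof eventually_elim
    case (elim z)
    have "0 \<le> g z" using LIMSEQ_le_const[OF elim] nn by auto
    then show ?case using elim by (simp add: Y_def)
  qed
  have dom': "AE z in P. ennreal (Z n z) * h z \<le> ennreal (w z)" if "\<And>z. h z \<le> 1" for n and h :: "'a \<times> 'a \<Rightarrow> ennreal"
    using dom[of n]
  proof eventually_elim
    case (elim z)
    have "ennreal (Z n z) * h z \<le> ennreal (w z) * 1"
      using elim by (intro mult_mono ennreal_leI that) auto
    then show ?case by simp
  qed
  have wfin: "(\<integral>\<^sup>+z. ennreal (w z) \<partial>P) < \<infinity>"
  proof -
    have "(\<integral>\<^sup>+z. ennreal (w z) \<partial>P) \<le> (\<integral>\<^sup>+z. ennreal (norm (w z)) \<partial>P)" by (intro nn_integral_mono ennreal_leI) auto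
    also have "\<dots> < \<infinity>" using w by (simp add: integrable_iff_bounded)
    finally show ?thesis .
  qed
  have conv: "(\<lambda>n. \<integral>\<^sup>+z. ennreal (Z n z) * h z \<partial>P) \<longlonglongrightarrow> (\<integral>\<^sup>+z. ennreal (Y z) * h z \<partial>P)"
    if [measurable]: "h \<in> borel_measurable (borel \<Otimes>\<^sub>M borel)" and h1: "\<And>z. h z = 0 \<or> h z = 1" for h :: "'a \<times> 'a \<Rightarrow> ennreal"
  proof (rule nn_integral_dominated_convergence[where w="\<lambda>z. ennreal (w z)"])
    show "AE z in P. ennreal (Z n z) * h z \<le> ennreal (w z)" for n
      by (rule dom') (use h1 in \<open>metis order.refl zero_le\<close>)
    show "AE z in P. (\<lambda>n. ennreal (Z n z) * h z) \<longlonglongrightarrow> ennreal (Y z) * h z"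
      using Ylim
    proof eventually_elim
      case (elim z)
      then show ?case using h1[of z] by (auto intro!: tendsto_intros)
    qed
  qed (use wfin in auto)
  have Y: "plan_density Y"
  proof (subst plan_density_iff, goal_cases)
    case 3
    show ?case
    proof
      fix A :: "'a set" assume A[measurable]: "A \<in> sets borel"
      have "(\<lambda>n. \<integral>\<^sup>+z. ennreal (Z n z) * indicator A (fst z) \<partial>P) \<longlonglongrightarrow> (\<integral>\<^sup>+z. ennreal (Y z) * indicator A (fst z) \<partial>P)"
        by (rule conv) (auto simp: indicator_def)
      moreover have "(\<lambda>n. \<integral>\<^sup>+z. ennreal (Z n z) * indicator A (snd z) \<partial>P) \<longlonglongrightarrow> (\<integral>\<^sup>+z. ennreal (Y z) * indicator A (snd z) \<partial>P)"
        by (rule conv) (auto simp: indicator_def)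
      moreover have "(\<integral>\<^sup>+z. ennreal (Z n z) * indicator A (fst z) \<partial>P) = emeasure \<mu> A"
        "(\<integral>\<^sup>+z. ennreal (Z n z) * indicator A (snd z) \<partial>P) = emeasure \<nu> A" for n
        using Z[of n] plan_density_iff[of "Z n"] nn A by auto
      ultimately show "(\<integral>\<^sup>+z. ennreal (Y z) * indicator A (fst z) \<partial>P) = emeasure \<mu> A \<and>
        (\<integral>\<^sup>+z. ennreal (Y z) * indicator A (snd z) \<partial>P) = emeasure \<nu> A"
        by (auto dest: LIMSEQ_unique[OF tendsto_const])
    qed
  qed (auto simp: Y_def)
  have "excess Y \<le> liminf (\<lambda>n. excess (Z n))" by (rule excess_lsc[OF _ nn Ylim]) measurable
  also have "\<dots> \<le> liminf (\<lambda>n. ennreal (I + (1/16)^n))" by (intro Liminf_mono always_eventually allI Zle)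
  also have "\<dots> = ennreal (I + 0)"
    by (intro lim_imp_Liminf tendsto_intros LIMSEQ_realpow_zero) auto
  finally have "excess Y \<le> ennreal I" by simp
  then show ?thesis unfolding optimal_def using Y low by (meson order_trans)
qed

lemma optimal_finite: "optimal Z \<Longrightarrow> excess Z < \<infinity>"
  using plan_density_one excess_one_finite unfolding optimal_def by (meson le_less_trans)

text \<open>On the segment from \<open>Z\<close> to \<open>Z'\<close> the three-point identity and optimality bound the divergence of \<open>Z'\<close>
from the point at time \<open>t\<close>, uniformly in \<open>t\<close>; then let \<open>t\<close> tend to 0 with Fatou's lemma.\<close>

lemma optimal_pythagoras:
  assumes Z: "optimal Z" and Z': "plan_density Z'"
  shows "excess Z + (\<integral>\<^sup>+z. kl (Z' z) (Z z) \<partial>P) \<le> excess Z'"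
proof (cases "excess Z' = \<infinity>")
  case True then show ?thesis by simp
next
  case False
  have Zp: "plan_density Z" using Z by (simp add: optimal_def)
  note [measurable] = plan_density_meas[OF Zp] plan_density_meas[OF Z']
  note nn = plan_density_nonneg[OF Zp] plan_density_nonneg[OF Z']
  obtain I where I: "excess Z = ennreal I" "0 \<le> I" using optimal_finite[OF Z] by (cases "excess Z") auto
  obtain J where J: "excess Z' = ennreal J" "0 \<le> J" using False by (cases "excess Z'") auto
  define t where "t n = 1 / (real n + 2)" for n
  have t: "0 < t n" "t n < 1" for n by (auto simp: t_def)
  define M where "M n = (\<lambda>z. (1 - t n) * Z z + t n * Z' z)" for n
  have M: "plan_density (M n)" for n
    unfolding M_def by (rule plan_density_convex) (use Zp Z' t[of n] in auto)
  note [measurable] = plan_density_meas[OF M]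
  have le: "(\<integral>\<^sup>+z. kl (Z' z) (M n z) \<partial>P) \<le> ennreal (J - I)" for n
  proof -
    let ?A = "\<integral>\<^sup>+z. kl (Z z) (M n z) \<partial>P" and ?B = "\<integral>\<^sup>+z. kl (Z' z) (M n z) \<partial>P"
    have "ennreal I + ennreal (t n) * ?B \<le> excess (M n) + (ennreal (1 - t n) * ?A + ennreal (t n) * ?B)"
      using Z M[of n] unfolding I(1)[symmetric] optimal_def by (intro add_mono) auto
    also have "\<dots> = ennreal (1 - t n) * ennreal I + ennreal (t n) * ennreal J"
      unfolding I(1)[symmetric] J(1)[symmetric] M_def using excess_three_point[OF Zp Z' t] by simp
    also have "\<dots> = ennreal (I + t n * (J - I))"
    proof -
      have "(1 - t n) * I + t n * J = I + t n * (J - I)" by (simp add: algebra_simps)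
      then show ?thesis using I J t[of n]
        by (simp add: ennreal_mult[symmetric] ennreal_plus[symmetric] del: ennreal_plus)
    qed
    finally have *: "ennreal I + ennreal (t n) * ?B \<le> ennreal (I + t n * (J - I))" .
    then have "ennreal (t n) * ?B \<noteq> \<infinity>" by (auto simp: top_unique)
    then have "?B \<noteq> \<infinity>" using t[of n] by (auto simp: ennreal_mult_top)
    then obtain B where B: "?B = ennreal B" "0 \<le> B" by (cases ?B) auto
    have "ennreal (I + t n * B) \<le> ennreal (I + t n * (J - I))"
      using * B I t[of n] by (simp add: ennreal_mult[symmetric] ennreal_plus[symmetric] del: ennreal_plus)
    then have "I + t n * B \<le> I + t n * (J - I) \<or> I + t n * B \<le> 0"
      by (metis ennreal_le_iff2)
    moreover have "J \<ge> I" using Z Z' I J unfolding optimal_def by (metis ennreal_le_iff)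
    ultimately have "t n * B \<le> t n * (J - I)" using I t[of n] B
      by (smt (verit) mult_nonneg_nonneg)
    then have "B \<le> J - I" using t[of n] by simp
    then show ?thesis using B by (simp add: ennreal_leI)
  qed
  have "(\<integral>\<^sup>+z. kl (Z' z) (Z z) \<partial>P) \<le> (\<integral>\<^sup>+z. liminf (\<lambda>n. kl (Z' z) (M n z)) \<partial>P)"
  proof (rule nn_integral_mono, rule kl_lsc)
    fix z
    have "t = (\<lambda>n. inverse (real (Suc (n + 1))))"
      by (auto simp: t_def fun_eq_iff inverse_eq_divide)
    then have "t \<longlonglongrightarrow> 0"
      using LIMSEQ_ignore_initial_segment[OF LIMSEQ_inverse_real_of_nat, of 1] by simp
    then have "(\<lambda>n. (1 - t n) * Z z + t n * Z' z) \<longlonglongrightarrow> (1 - 0) * Z z + 0 * Z' z"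
      by (intro tendsto_intros)
    then show "(\<lambda>n. M n z) \<longlonglongrightarrow> Z z" by (simp add: M_def)
  qed (use nn plan_density_nonneg[OF M] in auto)
  also have "\<dots> \<le> liminf (\<lambda>n. \<integral>\<^sup>+z. kl (Z' z) (M n z) \<partial>P)" by (rule nn_integral_liminf) measurable
  also have "\<dots> \<le> ennreal (J - I)" by (intro Liminf_le always_eventually) (use le in auto)
  finally have "(\<integral>\<^sup>+z. kl (Z' z) (Z z) \<partial>P) \<le> ennreal (J - I)" .
  then have "excess Z + (\<integral>\<^sup>+z. kl (Z' z) (Z z) \<partial>P) \<le> ennreal I + ennreal (J - I)"
    unfolding I(1) by (intro add_left_mono)
  moreover have "J \<ge> I" using Z Z' I J unfolding optimal_def by (metis ennreal_le_iff)
  ultimately show ?thesis using I J by (simp add: ennreal_plus[symmetric] del: ennreal_plus)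
qed

end

section \<open>Exchanging second coordinates of two independent pairs\<close>

context eot_problem
begin

lemma meas_P: "f \<in> borel_measurable P \<longleftrightarrow> f \<in> borel_measurable (borel \<Otimes>\<^sub>M borel)"
  using measurable_cong_sets[OF sets_pair_measure_cong[OF sets_mu sets_nu] refl] by blast

sublocale PP: pair_prob_space P P ..

abbreviation PP where "PP \<equiv> P \<Otimes>\<^sub>M P"

lemma space_PP [simp]: "space PP = UNIV" by (simp add: space_pair_measure)

definition swap_snd :: "('a \<times> 'a) \<times> ('a \<times> 'a) \<Rightarrow> ('a \<times> 'a) \<times> ('a \<times> 'a)" where
  "swap_snd w = ((fst (fst w), snd (snd w)), (fst (snd w), snd (fst w)))"

lemma swap_snd_simps [simp]:
  "fst (swap_snd w) = (fst (fst w), snd (snd w))" "snd (swap_snd w) = (fst (snd w), snd (fst w))"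
  "swap_snd (swap_snd w) = w"
  by (auto simp: swap_snd_def)

lemma swap_snd_meas [measurable]: "swap_snd \<in> measurable ((borel \<Otimes>\<^sub>M borel) \<Otimes>\<^sub>M (borel \<Otimes>\<^sub>M borel)) ((borel \<Otimes>\<^sub>M borel) \<Otimes>\<^sub>M (borel \<Otimes>\<^sub>M borel))"
  unfolding swap_snd_def[abs_def] by measurable

lemma nn_integral_PP_iterated:
  assumes [measurable]: "F \<in> borel_measurable ((borel \<Otimes>\<^sub>M borel) \<Otimes>\<^sub>M (borel \<Otimes>\<^sub>M borel))"
  shows "(\<integral>\<^sup>+w. F w \<partial>PP) = (\<integral>\<^sup>+x. \<integral>\<^sup>+y. \<integral>\<^sup>+x'. \<integral>\<^sup>+y'. F ((x, y), (x', y')) \<partial>\<nu> \<partial>\<mu> \<partial>\<nu> \<partial>\<mu>)"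
proof -
  have "(\<integral>\<^sup>+w. F w \<partial>PP) = (\<integral>\<^sup>+z. \<integral>\<^sup>+z'. F (z, z') \<partial>P \<partial>P)"
    by (rule P.nn_integral_fst[symmetric]) measurable
  also have "\<dots> = (\<integral>\<^sup>+x. \<integral>\<^sup>+y. \<integral>\<^sup>+z'. F ((x, y), z') \<partial>P \<partial>\<nu> \<partial>\<mu>)"
    by (rule nu.nn_integral_fst[symmetric]) measurable
  also have "\<dots> = (\<integral>\<^sup>+x. \<integral>\<^sup>+y. \<integral>\<^sup>+x'. \<integral>\<^sup>+y'. F ((x, y), (x', y')) \<partial>\<nu> \<partial>\<mu> \<partial>\<nu> \<partial>\<mu>)"
    by (intro nn_integral_cong nu.nn_integral_fst[symmetric]) measurable
  finally show ?thesis .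
qed

text \<open>The coordinates \<open>y\<close> and \<open>y'\<close> are separated by an integral over \<open>x'\<close>, so this takes three applications
of Fubini's theorem.\<close>

lemma nn_integral_swap_snd:
  assumes F[measurable]: "F \<in> borel_measurable ((borel \<Otimes>\<^sub>M borel) \<Otimes>\<^sub>M (borel \<Otimes>\<^sub>M borel))"
  shows "(\<integral>\<^sup>+w. F (swap_snd w) \<partial>PP) = (\<integral>\<^sup>+w. F w \<partial>PP)"
proof -
  interpret nunu: pair_sigma_finite \<nu> \<nu> ..
  have "(\<integral>\<^sup>+w. F (swap_snd w) \<partial>PP) = (\<integral>\<^sup>+x. \<integral>\<^sup>+y. \<integral>\<^sup>+x'. \<integral>\<^sup>+y'. F ((x, y'), (x', y)) \<partial>\<nu> \<partial>\<mu> \<partial>\<nu> \<partial>\<mu>)"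
    by (subst nn_integral_PP_iterated) (auto simp: swap_snd_def)
  also have "\<dots> = (\<integral>\<^sup>+x. \<integral>\<^sup>+x'. \<integral>\<^sup>+y. \<integral>\<^sup>+y'. F ((x, y'), (x', y)) \<partial>\<nu> \<partial>\<nu> \<partial>\<mu> \<partial>\<mu>)"
    by (intro nn_integral_cong P.Fubini') measurable
  also have "\<dots> = (\<integral>\<^sup>+x. \<integral>\<^sup>+x'. \<integral>\<^sup>+y'. \<integral>\<^sup>+y. F ((x, y'), (x', y)) \<partial>\<nu> \<partial>\<nu> \<partial>\<mu> \<partial>\<mu>)"
    by (intro nn_integral_cong nunu.Fubini') measurable
  also have "\<dots> = (\<integral>\<^sup>+x. \<integral>\<^sup>+y'. \<integral>\<^sup>+x'. \<integral>\<^sup>+y. F ((x, y'), (x', y)) \<partial>\<nu> \<partial>\<mu> \<partial>\<nu> \<partial>\<mu>)"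
    by (intro nn_integral_cong P.Fubini'[symmetric]) measurable
  also have "\<dots> = (\<integral>\<^sup>+w. F w \<partial>PP)" by (rule nn_integral_PP_iterated[OF F, symmetric])
  finally show ?thesis .
qed

lemma sets_PP: "sets PP = sets ((borel \<Otimes>\<^sub>M borel) \<Otimes>\<^sub>M (borel \<Otimes>\<^sub>M borel))"
  by (intro sets_pair_measure_cong) auto

lemma distr_swap_snd: "distr PP PP swap_snd = PP"
proof (rule measure_eqI)
  fix A assume "A \<in> sets (distr PP PP swap_snd)"
  then have A': "A \<in> sets PP" and A[measurable]: "A \<in> sets ((borel \<Otimes>\<^sub>M borel) \<Otimes>\<^sub>M (borel \<Otimes>\<^sub>M borel))"
    using sets_PP by auto
  have "emeasure (distr PP PP swap_snd) A = (\<integral>\<^sup>+w. indicator A w \<partial>distr PP PP swap_snd)"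
    using A' by simp
  also have "\<dots> = (\<integral>\<^sup>+w. indicator A (swap_snd w) \<partial>PP)" by (rule nn_integral_distr) measurable
  also have "\<dots> = (\<integral>\<^sup>+w. indicator A w \<partial>PP)" by (rule nn_integral_swap_snd) measurable
  also have "\<dots> = emeasure PP A" using A' by simp
  finally show "emeasure (distr PP PP swap_snd) A = emeasure PP A" .
qed simp

lemma integral_swap_snd:
  fixes F :: "('a \<times> 'a) \<times> ('a \<times> 'a) \<Rightarrow> real"
  assumes [measurable]: "F \<in> borel_measurable ((borel \<Otimes>\<^sub>M borel) \<Otimes>\<^sub>M (borel \<Otimes>\<^sub>M borel))"
  shows "(\<integral>w. F (swap_snd w) \<partial>PP) = (\<integral>w. F w \<partial>PP)"
  using integral_distr[of swap_snd PP PP F] by (simp add: distr_swap_snd)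

lemma integrable_swap_snd:
  fixes F :: "('a \<times> 'a) \<times> ('a \<times> 'a) \<Rightarrow> real"
  assumes "integrable PP F"
  shows "integrable PP (\<lambda>w. F (swap_snd w))"
  using integrable_distr[of swap_snd PP PP F] assms by (simp add: distr_swap_snd)

lemma AE_swap_snd: "AE w in PP. Q w \<Longrightarrow> AE w in PP. Q (swap_snd w)"
  using AE_distrD[of swap_snd PP PP Q, unfolded distr_swap_snd] by simp

lemma distr_swap_pairs: "distr PP PP (\<lambda>w. (snd w, fst w)) = PP"
  using PP.distr_pair_swap by (simp add: case_prod_beta')

lemma integral_swap_pairs:
  fixes F :: "('a \<times> 'a) \<times> ('a \<times> 'a) \<Rightarrow> real"
  assumes [measurable]: "F \<in> borel_measurable ((borel \<Otimes>\<^sub>M borel) \<Otimes>\<^sub>M (borel \<Otimes>\<^sub>M borel))"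
  shows "(\<integral>w. F (snd w, fst w) \<partial>PP) = (\<integral>w. F w \<partial>PP)"
  using integral_distr[of "\<lambda>w. (snd w, fst w)" PP PP F] by (simp add: distr_swap_pairs)

lemma distr_PP_fst: "distr PP P fst = P" by (rule P.distr_pair_fst)

lemma integrable_PP_fst: "integrable P f \<Longrightarrow> integrable PP (\<lambda>w. f (fst w) :: real)"
  using integrable_distr[of fst PP P f] by (simp add: distr_PP_fst)

lemma integrable_swap_pairs:
  fixes F :: "('a \<times> 'a) \<times> ('a \<times> 'a) \<Rightarrow> real"
  assumes "integrable PP F"
  shows "integrable PP (\<lambda>w. F (snd w, fst w))"
  using integrable_distr[of "\<lambda>w. (snd w, fst w)" PP PP F] assms by (simp add: distr_swap_pairs)

lemma AE_PP_fst: "AE z in P. Q z \<Longrightarrow> AE w in PP. Q (fst w)"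
  using AE_distrD[of fst PP P Q, unfolded distr_PP_fst] by simp

lemma AE_PP_snd: "AE z in P. Q z \<Longrightarrow> AE w in PP. Q (snd w)"
  using AE_distrD[of "\<lambda>w. (snd w, fst w)" PP PP "\<lambda>w. Q (fst w)", unfolded distr_swap_pairs] AE_PP_fst[of Q] by simp

end

section \<open>Schroedinger potentials\<close>

context eot_problem
begin

text \<open>The product coupling has density 1 and finite excess, hence finite divergence from the optimal plan,
which rules out zeros of the optimal density.\<close>

lemma optimal_pos:
  assumes Z: "optimal Z"
  shows "AE z in P. 0 < Z z"
proof -
  have [measurable]: "Z \<in> borel_measurable (borel \<Otimes>\<^sub>M borel)" using Z plan_density_meas by (simp add: optimal_def)
  have "(\<integral>\<^sup>+z. kl 1 (Z z) \<partial>P) \<le> excess (\<lambda>_. 1)"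
    by (rule order_trans[OF _ optimal_pythagoras[OF Z plan_density_one]]) (auto simp: add_increasing)
  then have "(\<integral>\<^sup>+z. kl 1 (Z z) \<partial>P) \<noteq> \<infinity>" using excess_one_finite by auto
  then have "AE z in P. kl 1 (Z z) \<noteq> \<infinity>" by (intro nn_integral_PInf_AE) auto
  then show ?thesis by eventually_elim (auto simp: kl_def split: if_splits)
qed

lemma optimal_ln_integrable:
  assumes Z: "optimal Z"
  shows "integrable P (\<lambda>z. ln (Z z))"
proof -
  have pd: "plan_density Z" using Z by (simp add: optimal_def)
  note [measurable] = plan_density_meas[OF pd]
  have "(\<integral>\<^sup>+z. kl 1 (Z z) \<partial>P) \<le> excess (\<lambda>_. 1)"
    by (rule order_trans[OF _ optimal_pythagoras[OF Z plan_density_one]]) (auto simp: add_increasing)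
  then have fin: "(\<integral>\<^sup>+z. kl 1 (Z z) \<partial>P) < \<infinity>" using excess_one_finite by (rule le_less_trans)
  define F where "F z = (if 0 < Z z then Z z - 1 - ln (Z z) else 0)" for z
  have [measurable]: "F \<in> borel_measurable (borel \<Otimes>\<^sub>M borel)" unfolding F_def[abs_def] by measurable
  have F0: "0 \<le> F z" for z unfolding F_def using ln_le_minus_one[of "Z z"] by auto
  have "AE z in P. ennreal (F z) = kl 1 (Z z)"
    using optimal_pos[OF Z] by eventually_elim (auto simp: F_def kl_pos ln_div algebra_simps)
  then have "(\<integral>\<^sup>+z. ennreal (F z) \<partial>P) = (\<integral>\<^sup>+z. kl 1 (Z z) \<partial>P)" by (rule nn_integral_cong_AE)
  then have "integrable P F" using fin F0 by (intro integrableI_nonneg) auto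
  then have "integrable P (\<lambda>z. Z z - 1 - F z)" using plan_density_integrable[OF pd] by auto
  then show ?thesis
    by (rule integrable_cong_AE_imp) (use optimal_pos[OF Z] in \<open>auto simp: F_def\<close>)
qed

text \<open>The logarithmic density relative to the Gibbs measure, that is, the derivative of the excess up to a
constant. Schroedinger's equation says that it is a sum of functions of one variable.\<close>

definition log_ratio :: "('a \<times> 'a \<Rightarrow> real) \<Rightarrow> 'a \<times> 'a \<Rightarrow> real" where
  "log_ratio Z z = ln (Z z) + cost z / \<epsilon>"

lemma log_ratio_integrable: "optimal Z \<Longrightarrow> integrable P (log_ratio Z)"
  unfolding log_ratio_def[abs_def] using optimal_ln_integrable integrable_cost by auto

text \<open>Adding a bounded function to a density of finite excess keeps the excess finite.\<close>

lemma kl_bounded_perturbation: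
  assumes "0 \<le> a" "0 \<le> b" "b \<le> a + 1"
  shows "kl b (gibbs z) \<le> kl a (gibbs z) + ennreal (2 * a + 1 + cost z / \<epsilon>)"
proof -
  have 1: "b * ln b \<le> a * ln a + 1 + a"
  proof (cases "b \<le> 1")
    case True
    have "b * ln b \<le> 0"
      using True assms by (cases "b = 0") (auto simp: mult_nonneg_nonpos)
    moreover have "0 \<le> a * ln a + 1 + a"
      using kl_real_nonneg[of a 1] assms by auto
    ultimately show ?thesis by simp
  next
    case False
    have "b * ln b \<le> (a + 1) * ln (a + 1)" using False assms by (intro mult_mono) auto
    also have "\<dots> \<le> a * ln a + 1 + a"
    proof (cases "a = 0")
      case False
      with assms have a: "a > 0" by simp
      have "ln (a + 1) - ln a \<le> ((a + 1) - a) / a" by (rule ln_diff_le) (use a in auto)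
      then have "a * (ln (a + 1) - ln a) \<le> a * (1 / a)" using a by (intro mult_left_mono) auto
      moreover have "ln (a + 1) \<le> (a + 1) - 1" by (rule ln_le_minus_one) (use a in auto)
      ultimately show ?thesis using a by (simp add: algebra_simps)
    qed simp
    finally show ?thesis .
  qed
  have split: "x * ln (x / gibbs z) = x * ln x + x * (cost z / \<epsilon>)" if "0 \<le> x" for x
    using that gibbs_pos[of z] by (cases "x = 0") (auto simp: ln_div gibbs_def algebra_simps)
  have "b * (cost z / \<epsilon>) \<le> (a + 1) * (cost z / \<epsilon>)" using assms eps by (intro mult_right_mono) auto
  then have "b * ln (b / gibbs z) - b + gibbs z \<le> (a * ln (a / gibbs z) - a + gibbs z) + (2 * a + 1 + cost z / \<epsilon>)"
    using 1 assms unfolding split[OF assms(1)] split[OF assms(2)] distrib_right by linarith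
  then have "kl b (gibbs z) \<le> ennreal ((a * ln (a / gibbs z) - a + gibbs z) + (2 * a + 1 + cost z / \<epsilon>))"
    by (simp add: kl_pos ennreal_leI)
  also have "\<dots> = kl a (gibbs z) + ennreal (2 * a + 1 + cost z / \<epsilon>)"
    using kl_real_nonneg[OF assms(1) gibbs_pos[of z]] assms eps by (subst ennreal_plus) (auto simp: kl_pos)
  finally show ?thesis .
qed

text \<open>First-order optimality. By the definition of \<open>log_ratio\<close> the Pythagorean inequality is this statement as
soon as the excess of \<open>Z'\<close> is finite.\<close>

lemma optimal_variation:
  assumes Z: "optimal Z" and Z': "plan_density Z'" and close: "\<And>z. \<bar>Z' z - Z z\<bar> \<le> 1"
  shows "0 \<le> (\<integral>z. (Z' z - Z z) * log_ratio Z z \<partial>P)"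
proof -
  have pd: "plan_density Z" using Z by (simp add: optimal_def)
  note [measurable] = plan_density_meas[OF pd] plan_density_meas[OF Z']
  note nn = plan_density_nonneg[OF pd] plan_density_nonneg[OF Z']
  have Gi: "integrable P (log_ratio Z)" by (rule log_ratio_integrable[OF Z])
  have [measurable]: "log_ratio Z \<in> borel_measurable (borel \<Otimes>\<^sub>M borel)" using Gi meas_P by auto
  have "excess Z' \<le> (\<integral>\<^sup>+z. kl (Z z) (gibbs z) + ennreal (2 * Z z + 1 + cost z / \<epsilon>) \<partial>P)"
    unfolding excess_def
    by (intro nn_integral_mono kl_bounded_perturbation nn) (use close[of _] in \<open>simp add: abs_le_iff algebra_simps\<close>)
  also have "\<dots> = excess Z + (\<integral>\<^sup>+z. ennreal (2 * Z z + 1 + cost z / \<epsilon>) \<partial>P)"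
    unfolding excess_def by (rule nn_integral_add) auto
  also have "(\<integral>\<^sup>+z. ennreal (2 * Z z + 1 + cost z / \<epsilon>) \<partial>P) = ennreal (\<integral>z. 2 * Z z + 1 + cost z / \<epsilon> \<partial>P)"
    using plan_density_integrable[OF pd] integrable_cost nn eps by (intro nn_integral_eq_integral) auto
  finally have fin: "excess Z' < \<infinity>" using optimal_finite[OF Z]
    by (simp add: le_less_trans ennreal_add_less_top)
  define r where "r a b = a * ln (a / b) - a + b" for a b :: real
  let ?g = gibbs
  have py: "excess Z + (\<integral>\<^sup>+z. kl (Z' z) (Z z) \<partial>P) \<le> excess Z'" by (rule optimal_pythagoras[OF Z Z'])
  have 1: "integrable P (\<lambda>z. r (Z z) (?g z))" "excess Z = ennreal (\<integral>z. r (Z z) (?g z) \<partial>P)"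
  proof -
    have e: "excess Z = (\<integral>\<^sup>+z. ennreal (r (Z z) (?g z)) \<partial>P)" by (simp add: excess_def kl_pos r_def)
    have m: "(\<lambda>z. r (Z z) (?g z)) \<in> borel_measurable P" unfolding r_def by measurable
    have n: "0 \<le> r (Z z) (?g z)" for z unfolding r_def by (intro kl_real_nonneg nn gibbs_pos)
    show i: "integrable P (\<lambda>z. r (Z z) (?g z))"
      using m n e optimal_finite[OF Z] by (intro integrableI_nonneg) auto
    show "excess Z = ennreal (\<integral>z. r (Z z) (?g z) \<partial>P)" unfolding e using i n by (intro nn_integral_eq_integral) auto
  qed
  have 2: "integrable P (\<lambda>z. r (Z' z) (?g z))" "excess Z' = ennreal (\<integral>z. r (Z' z) (?g z) \<partial>P)" "0 \<le> (\<integral>z. r (Z' z) (?g z) \<partial>P)"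
  proof -
    have e: "excess Z' = (\<integral>\<^sup>+z. ennreal (r (Z' z) (?g z)) \<partial>P)" by (simp add: excess_def kl_pos r_def)
    have m: "(\<lambda>z. r (Z' z) (?g z)) \<in> borel_measurable P" unfolding r_def by measurable
    have n: "0 \<le> r (Z' z) (?g z)" for z unfolding r_def by (intro kl_real_nonneg nn gibbs_pos)
    show i: "integrable P (\<lambda>z. r (Z' z) (?g z))"
      using m n e fin by (intro integrableI_nonneg) auto
    show "excess Z' = ennreal (\<integral>z. r (Z' z) (?g z) \<partial>P)" unfolding e using i n by (intro nn_integral_eq_integral) auto
    show "0 \<le> (\<integral>z. r (Z' z) (?g z) \<partial>P)" using n by simp
  qed
  have di: "integrable P (\<lambda>z. (Z' z - Z z) * log_ratio Z z)"
  proof (rule Bochner_Integration.integrable_bound[OF Gi])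
    show "AE z in P. norm ((Z' z - Z z) * log_ratio Z z) \<le> norm (log_ratio Z z)"
      using close by (auto intro!: AE_I2 simp: abs_mult mult_left_le_one_le)
  qed measurable
  have pt: "AE z in P. kl (Z' z) (Z z) = ennreal (r (Z' z) (Z z)) \<and> 0 \<le> r (Z' z) (Z z) \<and>
      r (Z' z) (Z z) = r (Z' z) (?g z) - r (Z z) (?g z) - (Z' z - Z z) * log_ratio Z z"
    using optimal_pos[OF Z]
  proof eventually_elim
    case (elim z)
    have "Z' z * ln (Z' z / ?g z) = Z' z * ln (Z' z / Z z) + Z' z * log_ratio Z z"
      using elim nn(2)[of z] gibbs_pos[of z]
      by (cases "Z' z = 0") (auto simp: ln_div log_ratio_def gibbs_def algebra_simps)
    moreover have "Z z * ln (Z z / ?g z) = Z z * log_ratio Z z"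
      using elim gibbs_pos[of z] by (auto simp: ln_div log_ratio_def gibbs_def algebra_simps)
    ultimately show ?case using elim kl_real_nonneg[OF nn(2)[of z] elim]
      by (simp add: kl_pos r_def left_diff_distrib)
  qed
  have "integrable P (\<lambda>z. r (Z' z) (?g z) - r (Z z) (?g z) - (Z' z - Z z) * log_ratio Z z)" (is "integrable P ?R")
    using 1 2 di by auto
  moreover have "(\<integral>\<^sup>+z. kl (Z' z) (Z z) \<partial>P) = (\<integral>\<^sup>+z. ennreal (?R z) \<partial>P)"
    by (rule nn_integral_cong_AE) (use pt in \<open>eventually_elim, auto\<close>)
  moreover have nnR: "AE z in P. 0 \<le> ?R z" using pt by eventually_elim auto
  ultimately have 3: "(\<integral>\<^sup>+z. kl (Z' z) (Z z) \<partial>P) = ennreal (\<integral>z. ?R z \<partial>P)"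
    by (simp add: nn_integral_eq_integral)
  have nR: "0 \<le> (\<integral>z. ?R z \<partial>P)" using nnR by (rule integral_nonneg_AE)
  have nZ: "0 \<le> (\<integral>z. r (Z z) (?g z) \<partial>P)"
    unfolding r_def by (intro integral_nonneg_AE AE_I2 kl_real_nonneg nn gibbs_pos)
  have "(\<integral>z. r (Z z) (?g z) \<partial>P) + (\<integral>z. ?R z \<partial>P) \<le> (\<integral>z. r (Z' z) (?g z) \<partial>P)"
    using py 2(3) nZ nR 
    unfolding 1(2) 2(2) 3 by (simp add: ennreal_plus[symmetric] del: ennreal_plus)
  moreover have "(\<integral>z. ?R z \<partial>P) = (\<integral>z. r (Z' z) (?g z) \<partial>P) - (\<integral>z. r (Z z) (?g z) \<partial>P) - (\<integral>z. (Z' z - Z z) * log_ratio Z z \<partial>P)"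
    using 1 2 di by simp
  ultimately show ?thesis by simp
qed

lemma meas_PP_section:
  fixes F :: "('a \<times> 'a) \<times> ('a \<times> 'a) \<Rightarrow> real"
  assumes "F \<in> borel_measurable ((borel \<Otimes>\<^sub>M borel) \<Otimes>\<^sub>M (borel \<Otimes>\<^sub>M borel))"
  shows "(\<lambda>z'. F (z, z')) \<in> borel_measurable P"
  using measurable_compose[OF measurable_Pair1'[of z "borel \<Otimes>\<^sub>M borel" "borel \<Otimes>\<^sub>M borel"], of F borel] assms
  by (simp add: space_pair_measure meas_P)

text \<open>Take two independent pairs \<open>(x,y)\<close>, \<open>(x',y')\<close> and move the amount \<open>\<theta>\<close> of mass from \<open>(x,y)\<close> to \<open>(x,y')\<close>. The
first marginal is untouched. Since \<open>\<theta>\<close> is symmetric in the two pairs, \<open>y\<close> and \<open>y'\<close> have the same law under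
it, so the second marginal is kept as well. The bound \<open>\<theta> \<le> Z\<close> keeps the density nonnegative, and
\<open>\<theta> \<le> 1\<close> makes the perturbation bounded.\<close>

lemma swap_plan:
  fixes \<theta> :: "('a \<times> 'a) \<times> ('a \<times> 'a) \<Rightarrow> real"
  assumes Z: "plan_density Z"
    and [measurable]: "\<theta> \<in> borel_measurable ((borel \<Otimes>\<^sub>M borel) \<Otimes>\<^sub>M (borel \<Otimes>\<^sub>M borel))"
    and \<theta>: "\<And>w. 0 \<le> \<theta> w" "\<And>w. \<theta> w \<le> 1" "\<And>w. \<theta> w \<le> Z (fst w)" "\<And>w. \<theta> (snd w, fst w) = \<theta> w"
  defines "k \<equiv> \<lambda>z. (\<integral>z'. \<theta> (swap_snd (z, z')) \<partial>P) - (\<integral>z'. \<theta> (z, z') \<partial>P)"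
  shows "plan_density (\<lambda>z. Z z + k z)" "\<And>z. \<bar>k z\<bar> \<le> 1"
    "\<And>h. integrable P h \<Longrightarrow> (\<integral>z. k z * h z \<partial>P) = (\<integral>w. \<theta> w * (h (fst (swap_snd w)) - h (fst w)) \<partial>PP)"
proof -
  note [measurable] = plan_density_meas[OF Z]
  note nn = plan_density_nonneg[OF Z]
  have bint: "integrable P f" if [measurable]: "f \<in> borel_measurable P" and "\<And>z. 0 \<le> f z" "\<And>z. f z \<le> 1" for f :: "'a \<times> 'a \<Rightarrow> real"
    by (rule P.integrable_const_bound[of _ 1]) (use that in auto)
  have t1: "(\<lambda>z'. \<theta> (z, z')) \<in> borel_measurable P" for z
    using meas_PP_section[where F=\<theta> and z=z] by simp
  have t2: "(\<lambda>z'. \<theta> (swap_snd (z, z'))) \<in> borel_measurable P" for z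
  proof -
    have "(\<lambda>w. \<theta> (swap_snd w)) \<in> borel_measurable ((borel \<Otimes>\<^sub>M borel) \<Otimes>\<^sub>M (borel \<Otimes>\<^sub>M borel))" by measurable
    from meas_PP_section[where F="\<lambda>w. \<theta> (swap_snd w)" and z=z, OF this] show ?thesis .
  qed
  have i1: "integrable P (\<lambda>z'. \<theta> (z, z'))" and i2: "integrable P (\<lambda>z'. \<theta> (swap_snd (z, z')))" for z
    by (rule bint[OF t1 \<theta>(1) \<theta>(2)], rule bint[OF t2 \<theta>(1) \<theta>(2)])
  define k1 where "k1 z = (\<integral>z'. \<theta> (z, z') \<partial>P)" for z
  define k3 where "k3 z = (\<integral>z'. \<theta> (swap_snd (z, z')) \<partial>P)" for z
  have k: "k z = k3 z - k1 z" for z by (simp add: k_def k1_def k3_def)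
  have [measurable]: "k1 \<in> borel_measurable (borel \<Otimes>\<^sub>M borel)" "k3 \<in> borel_measurable (borel \<Otimes>\<^sub>M borel)"
    unfolding k1_def[abs_def] k3_def[abs_def] by measurable
  have le1: "(\<integral>z'. f z' \<partial>P) \<le> c" if "integrable P f" "\<And>z'. f z' \<le> c" for f :: "'a \<times> 'a \<Rightarrow> real" and c
  proof -
    have "(\<integral>z'. f z' \<partial>P) \<le> (\<integral>z'. c \<partial>P)" by (intro integral_mono that) auto
    then show ?thesis using P.prob_space by simp
  qed
  have k1: "0 \<le> k1 z" "k1 z \<le> 1" "k1 z \<le> Z z" for z
  proof -
    have t3: "\<theta> (z, z') \<le> Z z" for z' using \<theta>(3)[of "(z, z')"] by simp
    show "0 \<le> k1 z" "k1 z \<le> 1" "k1 z \<le> Z z"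
      unfolding k1_def
      by (rule Bochner_Integration.integral_nonneg[OF \<theta>(1)], rule le1[OF i1 \<theta>(2)], rule le1[OF i1 t3])
  qed
  have k3: "0 \<le> k3 z" "k3 z \<le> 1" for z
    unfolding k3_def
    by (rule Bochner_Integration.integral_nonneg[OF \<theta>(1)], rule le1[OF i2 \<theta>(2)])
  show kb: "\<bar>k z\<bar> \<le> 1" for z unfolding k using k1[of z] k3[of z] by linarith
  have \<theta>mult: "integrable PP (\<lambda>w. \<theta> w * f w)" if "integrable PP f" for f
    by (rule integrable_weight_le_1[OF that]) (measurable, simp add: \<theta>(1,2))
  have \<theta>mult': "integrable PP (\<lambda>w. \<theta> (swap_snd w) * f w)" if "integrable PP f" for f
    by (rule integrable_weight_le_1[OF that]) (measurable, simp add: \<theta>(1,2))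
  show main: "(\<integral>z. k z * h z \<partial>P) = (\<integral>w. \<theta> w * (h (fst (swap_snd w)) - h (fst w)) \<partial>PP)" if h: "integrable P h" for h
  proof -
    have [measurable]: "h \<in> borel_measurable (borel \<Otimes>\<^sub>M borel)" using h meas_P by auto
    have hf: "integrable PP (\<lambda>w. h (fst w))" by (rule integrable_PP_fst[OF h])
    have hs: "integrable PP (\<lambda>w. h (fst (swap_snd w)))" by (rule integrable_swap_snd[OF hf])
    have A1: "(\<integral>w. \<theta> w * h (fst w) \<partial>PP) = (\<integral>z. k1 z * h z \<partial>P)"
      unfolding k1_def using PP.integral_fst'[OF \<theta>mult[OF hf]] by simp
    have "(\<integral>w. \<theta> w * h (fst (swap_snd w)) \<partial>PP) = (\<integral>w. \<theta> (swap_snd w) * h (fst w) \<partial>PP)"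
      using integral_swap_snd[of "\<lambda>w. \<theta> (swap_snd w) * h (fst w)"] by simp
    also have "\<dots> = (\<integral>z. k3 z * h z \<partial>P)"
      unfolding k3_def using PP.integral_fst'[OF \<theta>mult'[OF hf]] by simp
    finally have A3: "(\<integral>w. \<theta> w * h (fst (swap_snd w)) \<partial>PP) = (\<integral>z. k3 z * h z \<partial>P)" .
    have kh: "integrable P (\<lambda>z. k1 z * h z)" "integrable P (\<lambda>z. k3 z * h z)"
      by (rule integrable_weight_le_1[OF h]; use k1 k3 in simp)+
    have "(\<integral>w. \<theta> w * (h (fst (swap_snd w)) - h (fst w)) \<partial>PP)
      = (\<integral>w. \<theta> w * h (fst (swap_snd w)) \<partial>PP) - (\<integral>w. \<theta> w * h (fst w) \<partial>PP)"
      using \<theta>mult[OF hs] \<theta>mult[OF hf] by (simp add: right_diff_distrib)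
    also have "\<dots> = (\<integral>z. k3 z * h z - k1 z * h z \<partial>P)" unfolding A1 A3 using kh by simp
    finally show ?thesis by (simp add: k left_diff_distrib)
  qed
  have Zint: "integrable P (\<lambda>z. Z z * h z)" and kint: "integrable P (\<lambda>z. k z * h z)"
    if [measurable]: "h \<in> borel_measurable (borel \<Otimes>\<^sub>M borel)" and h: "\<And>z. 0 \<le> h z" "\<And>z. h z \<le> (1::real)" for h
  proof -
    show "integrable P (\<lambda>z. Z z * h z)"
      using integrable_weight_le_1[OF plan_density_integrable[OF Z], of h] h by (simp add: mult.commute)
    have "\<bar>k z * h z\<bar> \<le> 1" for z
      using kb[of z] h[of z] by (simp add: abs_mult mult_le_one)
    then show "integrable P (\<lambda>z. k z * h z)" unfolding k by (intro P.integrable_const_bound[of _ 1]) auto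
  qed
  have marg: "(\<integral>\<^sup>+z. ennreal (Z z + k z) * ennreal (h z) \<partial>P) = (\<integral>\<^sup>+z. ennreal (Z z) * ennreal (h z) \<partial>P)"
    if [measurable]: "h \<in> borel_measurable (borel \<Otimes>\<^sub>M borel)" and h: "\<And>z. 0 \<le> h z" "\<And>z. h z \<le> (1::real)"
      and 0: "(\<integral>z. k z * h z \<partial>P) = 0" for h
  proof -
    have p: "0 \<le> Z z + k z" for z unfolding k using k1[of z] k3[of z] by linarith
    have "(\<integral>\<^sup>+z. ennreal (Z z + k z) * ennreal (h z) \<partial>P) = (\<integral>\<^sup>+z. ennreal (Z z * h z + k z * h z) \<partial>P)"
      using p h by (intro nn_integral_cong) (simp add: ennreal_mult[symmetric] distrib_right)
    also have "\<dots> = ennreal (\<integral>z. Z z * h z + k z * h z \<partial>P)"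
    proof (rule nn_integral_eq_integral)
      show "integrable P (\<lambda>z. Z z * h z + k z * h z)"
        by (intro Bochner_Integration.integrable_add Zint kint that)
      show "AE z in P. 0 \<le> Z z * h z + k z * h z"
        using mult_nonneg_nonneg[OF p h(1)] by (simp add: distrib_right)
    qed
    also have "\<dots> = ennreal (\<integral>z. Z z * h z \<partial>P)" using Zint[OF that(1-3)] kint[OF that(1-3)] 0 by simp
    also have "\<dots> = (\<integral>\<^sup>+z. ennreal (Z z * h z) \<partial>P)"
      using Zint[OF that(1-3)] nn h by (intro nn_integral_eq_integral[symmetric]) auto
    finally show ?thesis using nn h by (simp add: ennreal_mult)
  qed
  have kz: "(\<integral>z. k z * indicator A (fst z) \<partial>P) = 0" "(\<integral>z. k z * indicator A (snd z) \<partial>P) = 0"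
    if [measurable]: "A \<in> sets borel" for A
  proof -
    have ind: "integrable P (\<lambda>z. indicator A (fst z) :: real)" "integrable P (\<lambda>z. indicator A (snd z) :: real)"
      by (rule P.integrable_const_bound[of _ 1]; simp)+
    show "(\<integral>z. k z * indicator A (fst z) \<partial>P) = 0" unfolding main[OF ind(1)] by simp
    have e: "(\<integral>w. \<theta> w * indicator A (snd (snd w)) \<partial>PP) = (\<integral>w. \<theta> w * indicator A (snd (fst w)) \<partial>PP)"
      using integral_swap_pairs[of "\<lambda>w. \<theta> w * indicator A (snd (fst w))"] by (simp add: \<theta>(4))
    have i: "integrable PP (\<lambda>w. indicator A (snd (fst w)) :: real)" by (rule integrable_PP_fst[OF ind(2)])
    show "(\<integral>z. k z * indicator A (snd z) \<partial>P) = 0"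
      unfolding main[OF ind(2)] using e \<theta>mult[OF i] \<theta>mult[OF integrable_swap_pairs[OF i]]
      by (simp add: right_diff_distrib)
  qed
  show "plan_density (\<lambda>z. Z z + k z)"
  proof (subst plan_density_iff, goal_cases)
    case 1 show ?case unfolding k by measurable
    case (2 z) show ?case unfolding k using k1[of z] k3[of z] by linarith
    case 3
    show ?case
    proof
      fix A :: "'a set" assume A[measurable]: "A \<in> sets borel"
      have e: "ennreal (indicator A x) = indicator A x" for x :: 'a by (simp add: indicator_def)
      show "(\<integral>\<^sup>+z. ennreal (Z z + k z) * indicator A (fst z) \<partial>P) = emeasure \<mu> A \<and>
        (\<integral>\<^sup>+z. ennreal (Z z + k z) * indicator A (snd z) \<partial>P) = emeasure \<nu> A"
        using marg[of "\<lambda>z. indicator A (fst z)"] marg[of "\<lambda>z. indicator A (snd z)"] kz[OF A]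
          Z plan_density_iff[of Z] nn A unfolding e by simp
    qed
  qed
qed

text \<open>Testing optimality with swaps supported where the exchange lowers \<open>log_ratio\<close> shows that almost no such
pairs exist. Exchanging once more reverses the sign, so equality holds.\<close>

lemma optimal_additive:
  assumes Z: "optimal Z"
  shows "AE w in PP. log_ratio Z (fst (swap_snd w)) + log_ratio Z (snd (swap_snd w))
    = log_ratio Z (fst w) + log_ratio Z (snd w)"
proof -
  define G where "G = log_ratio Z"
  have pd: "plan_density Z" using Z by (simp add: optimal_def)
  note Zm[measurable] = plan_density_meas[OF pd]
  note nn = plan_density_nonneg[OF pd]
  have Gi: "integrable P G" unfolding G_def by (rule log_ratio_integrable[OF Z])
  have Gm[measurable]: "G \<in> borel_measurable (borel \<Otimes>\<^sub>M borel)" using Gi meas_P by auto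
  define D where "D w = G (fst (swap_snd w)) + G (snd (swap_snd w)) - G (fst w) - G (snd w)" for w
  have Dm[measurable]: "D \<in> borel_measurable ((borel \<Otimes>\<^sub>M borel) \<Otimes>\<^sub>M (borel \<Otimes>\<^sub>M borel))"
    unfolding D_def[abs_def] by measurable
  \<comment> \<open>\<open>D\<close> is the change of \<open>log_ratio\<close>, summed over both pairs, under the exchange.\<close>
  define \<theta> where "\<theta> w = (if D w < 0 then min 1 (min (Z (fst w)) (Z (snd w))) else 0)" for w
  have \<theta>m[measurable]: "\<theta> \<in> borel_measurable ((borel \<Otimes>\<^sub>M borel) \<Otimes>\<^sub>M (borel \<Otimes>\<^sub>M borel))"
    unfolding \<theta>_def[abs_def] by measurable
  have Dsym: "D (snd w, fst w) = D w" for w by (simp add: D_def)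
  have \<theta>: "0 \<le> \<theta> w" "\<theta> w \<le> 1" "\<theta> w \<le> Z (fst w)" "\<theta> (snd w, fst w) = \<theta> w" for w
    using nn[of "fst w"] nn[of "snd w"] by (auto simp: \<theta>_def Dsym min_def)
  note sp = swap_plan[of Z \<theta>, OF pd \<theta>m \<theta>]
  have i1: "integrable PP (\<lambda>w. G (fst w))" by (rule integrable_PP_fst[OF Gi])
  have i2: "integrable PP (\<lambda>w. G (fst (swap_snd w)))" by (rule integrable_swap_snd[OF i1])
  have i3: "integrable PP (\<lambda>w. G (snd w))" using integrable_swap_pairs[OF i1] by simp
  have i4: "integrable PP (\<lambda>w. G (snd (swap_snd w)))" by (rule integrable_swap_snd[OF i3])
  have \<theta>mult: "integrable PP (\<lambda>w. \<theta> w * f w)" if "integrable PP f" for f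
    by (rule integrable_weight_le_1[OF that]) (measurable, simp add: \<theta>(1,2))
  have "0 \<le> (\<integral>w. \<theta> w * (G (fst (swap_snd w)) - G (fst w)) \<partial>PP)"
  proof -
    have "0 \<le> (\<integral>z. ((Z z + ((\<integral>z'. \<theta> (swap_snd (z, z')) \<partial>P) - (\<integral>z'. \<theta> (z, z') \<partial>P))) - Z z) * log_ratio Z z \<partial>P)"
      by (rule optimal_variation[OF Z sp(1)]) (simp only: add_diff_cancel_left' sp(2))
    then show ?thesis by (simp only: add_diff_cancel_left' G_def[symmetric] sp(3)[OF Gi])
  qed
  moreover have "(\<integral>w. \<theta> w * (G (snd (swap_snd w)) - G (snd w)) \<partial>PP) = (\<integral>w. \<theta> w * (G (fst (swap_snd w)) - G (fst w)) \<partial>PP)"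
    using integral_swap_pairs[of "\<lambda>w. \<theta> w * (G (fst (swap_snd w)) - G (fst w))"] by (simp add: \<theta>(4))
  moreover have "(\<integral>w. \<theta> w * D w \<partial>PP) = (\<integral>w. \<theta> w * (G (fst (swap_snd w)) - G (fst w)) \<partial>PP) + (\<integral>w. \<theta> w * (G (snd (swap_snd w)) - G (snd w)) \<partial>PP)"
  proof -
    have "\<theta> w * D w = \<theta> w * (G (fst (swap_snd w)) - G (fst w)) + \<theta> w * (G (snd (swap_snd w)) - G (snd w))" for w
      by (simp add: D_def algebra_simps)
    then show ?thesis
      using \<theta>mult[OF Bochner_Integration.integrable_diff[OF i2 i1]] \<theta>mult[OF Bochner_Integration.integrable_diff[OF i4 i3]] by simp
  qed
  ultimately have ge: "0 \<le> (\<integral>w. \<theta> w * D w \<partial>PP)" by simp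
  have Di: "integrable PP D" unfolding D_def[abs_def] using i1 i2 i3 i4 by auto
  have neg: "0 \<le> - (\<theta> w * D w)" for w using \<theta>(1)[of w] by (auto simp: \<theta>_def mult_nonneg_nonpos)
  have "0 \<le> (\<integral>w. - (\<theta> w * D w) \<partial>PP)" using neg by (intro integral_nonneg_AE) auto
  with ge have "(\<integral>w. - (\<theta> w * D w) \<partial>PP) = 0" by simp
  then have "AE w in PP. - (\<theta> w * D w) = 0"
    using integral_nonneg_eq_0_iff_AE[of PP "\<lambda>w. - (\<theta> w * D w)"] neg \<theta>mult[OF Di] by auto
  then have D0: "AE w in PP. 0 \<le> D w"
    using AE_PP_fst[OF optimal_pos[OF Z]] AE_PP_snd[OF optimal_pos[OF Z]]
  proof eventually_elim
    case (elim w) then show ?case by (cases "D w < 0") (auto simp: \<theta>_def min_def split: if_splits)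
  qed
  from AE_swap_snd[OF D0] D0 show ?thesis
    by eventually_elim (simp add: D_def G_def[symmetric])
qed

text \<open>Freeze the second pair at a typical point \<open>z0\<close>. Fubini's theorem turns integrability of the sum into
integrability of each term.\<close>

lemma optimal_splits:
  assumes Z: "optimal Z"
  obtains a b where "integrable \<mu> a" "integrable \<nu> b" "AE z in P. log_ratio Z z = a (fst z) + b (snd z)"
proof -
  define G where "G = log_ratio Z"
  have Gi: "integrable P G" unfolding G_def by (rule log_ratio_integrable[OF Z])
  have Gm[measurable]: "G \<in> borel_measurable (borel \<Otimes>\<^sub>M borel)" using Gi meas_P by auto
  have "AE z0 in P. AE z in P. G (fst z0, snd z) + G (fst z, snd z0) = G z0 + G z"
    using PP.AE_pair[OF optimal_additive[OF Z]] by (simp add: G_def)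
  from prob_space_AE_ex[OF P.prob_space_axioms this] obtain z0 where z0: "AE z in P. G (fst z0, snd z) + G (fst z, snd z0) = G z0 + G z" by blast
  define a where "a x = G (x, snd z0) - G z0" for x
  define b where "b y = G (fst z0, y)" for y
  have [measurable]: "a \<in> borel_measurable borel" "b \<in> borel_measurable borel"
    unfolding a_def[abs_def] b_def[abs_def] by measurable
  have ab: "AE z in P. G z = a (fst z) + b (snd z)"
    using z0 by eventually_elim (auto simp: a_def b_def)
  have abi: "integrable P (\<lambda>z. a (fst z) + b (snd z))"
    by (rule integrable_cong_AE_imp[OF Gi]) (use ab in \<open>auto elim!: AE_mp\<close>)
  have "AE x in \<mu>. integrable \<nu> (\<lambda>y. a x + b y)" using P.AE_integrable_fst'[OF abi] by simp
  from prob_space_AE_ex[OF mu.prob_space_axioms this] obtain x where "integrable \<nu> (\<lambda>y. a x + b y)" by blast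
  then have "integrable \<nu> (\<lambda>y. (a x + b y) - a x)" by (intro Bochner_Integration.integrable_diff) auto
  then have bi: "integrable \<nu> b" by simp
  have "integrable P (\<lambda>z. (a (fst z) + b (snd z)) - b (snd z))"
    by (intro Bochner_Integration.integrable_diff abi integrable_P_snd bi)
  then have "integrable P (\<lambda>z. a (fst z))" by simp
  then have ai: "integrable \<mu> a" using integrable_distr_eq[of fst P \<mu> a] by (simp add: distr_fst)
  show thesis by (rule that[OF ai bi]) (use ab in \<open>simp add: G_def\<close>)
qed

definition gibbs_density :: "('a \<Rightarrow> real) \<Rightarrow> ('a \<Rightarrow> real) \<Rightarrow> 'a \<times> 'a \<Rightarrow> real" where
  "gibbs_density \<phi> \<psi> z = exp ((\<phi> (fst z) + \<psi> (snd z) - cost z) / \<epsilon>)"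

lemma gibbs_density_pos [simp]: "0 < gibbs_density \<phi> \<psi> z" by (simp add: gibbs_density_def)

lemma gibbs_density_meas [measurable]:
  assumes [measurable]: "\<phi> \<in> borel_measurable borel" "\<psi> \<in> borel_measurable borel"
  shows "gibbs_density \<phi> \<psi> \<in> borel_measurable (borel \<Otimes>\<^sub>M borel)"
  unfolding gibbs_density_def[abs_def] by measurable

lemma potentials_exist:
  obtains \<phi> \<psi> where "integrable \<mu> \<phi>" "integrable \<nu> \<psi>" "optimal (gibbs_density \<phi> \<psi>)"
proof -
  obtain Z where Z: "optimal Z" using optimal_exists by blast
  from optimal_splits[OF Z] obtain a b where ab: "integrable \<mu> a" "integrable \<nu> b"
    and eq: "AE z in P. log_ratio Z z = a (fst z) + b (snd z)" by metis
  have pd: "plan_density Z" using Z by (simp add: optimal_def)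
  note [measurable] = plan_density_meas[OF pd]
  define \<rho> where "\<rho> = gibbs_density (\<lambda>x. \<epsilon> * a x) (\<lambda>y. \<epsilon> * b y)"
  have [measurable]: "a \<in> borel_measurable borel" "b \<in> borel_measurable borel"
    using ab borel_measurable_integrable measurable_cong_sets[OF sets_mu refl] measurable_cong_sets[OF sets_nu refl] by blast+
  have [measurable]: "\<rho> \<in> borel_measurable (borel \<Otimes>\<^sub>M borel)" unfolding \<rho>_def by measurable
  have AE: "AE z in P. Z z = \<rho> z"
    using eq optimal_pos[OF Z]
  proof eventually_elim
    case (elim z)
    have "Z z = exp (ln (Z z))" using elim by simp
    also have "ln (Z z) = (\<epsilon> * a (fst z) + \<epsilon> * b (snd z) - cost z) / \<epsilon>"
      using elim eps by (simp add: log_ratio_def field_simps)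
    finally show ?case by (simp add: \<rho>_def gibbs_density_def)
  qed
  have de: "density P (\<lambda>z. ennreal (\<rho> z)) = density P (\<lambda>z. ennreal (Z z))"
    by (rule density_cong) (use AE in auto)
  have ee: "excess \<rho> = excess Z"
    unfolding excess_def by (rule nn_integral_cong_AE) (use AE in \<open>eventually_elim, simp\<close>)
  have "plan_density \<rho>"
    using pd unfolding plan_density_def de by (auto simp: \<rho>_def less_imp_le)
  then have "optimal \<rho>" using Z unfolding optimal_def ee by simp
  then show thesis
    using that[of "\<lambda>x. \<epsilon> * a x" "\<lambda>y. \<epsilon> * b y"] ab by (simp add: \<rho>_def)
qed

lemma integral_plan_fst:
  fixes f :: "'a \<Rightarrow> real"
  assumes Z: "plan_density Z" and f: "integrable \<mu> f"
  shows "integrable P (\<lambda>z. Z z * f (fst z))" "(\<integral>z. Z z * f (fst z) \<partial>P) = (\<integral>x. f x \<partial>\<mu>)"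
proof -
  note [measurable] = plan_density_meas[OF Z]
  note nn = plan_density_nonneg[OF Z]
  have [measurable]: "f \<in> borel_measurable borel"
    using f borel_measurable_integrable measurable_cong_sets[OF sets_mu refl] by blast
  have d: "distr (density P (\<lambda>z. ennreal (Z z))) borel fst = \<mu>"
    using Z by (simp add: plan_density_def couplings_def)
  have "integrable (density P (\<lambda>z. ennreal (Z z))) (\<lambda>z. f (fst z))"
    using integrable_distr_eq[of fst "density P (\<lambda>z. ennreal (Z z))" borel f] f unfolding d by simp
  then show "integrable P (\<lambda>z. Z z * f (fst z))" using nn by (subst (asm) integrable_real_density) auto
  have "(\<integral>x. f x \<partial>\<mu>) = (\<integral>z. f (fst z) \<partial>density P (\<lambda>z. ennreal (Z z)))"
    using integral_distr[of fst "density P (\<lambda>z. ennreal (Z z))" borel f] unfolding d by simp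
  then show "(\<integral>z. Z z * f (fst z) \<partial>P) = (\<integral>x. f x \<partial>\<mu>)" using nn by (subst (asm) integral_real_density) auto
qed

lemma integral_plan_snd:
  fixes f :: "'a \<Rightarrow> real"
  assumes Z: "plan_density Z" and f: "integrable \<nu> f"
  shows "integrable P (\<lambda>z. Z z * f (snd z))" "(\<integral>z. Z z * f (snd z) \<partial>P) = (\<integral>x. f x \<partial>\<nu>)"
proof -
  note [measurable] = plan_density_meas[OF Z]
  note nn = plan_density_nonneg[OF Z]
  have [measurable]: "f \<in> borel_measurable borel"
    using f borel_measurable_integrable measurable_cong_sets[OF sets_nu refl] by blast
  have d: "distr (density P (\<lambda>z. ennreal (Z z))) borel snd = \<nu>"
    using Z by (simp add: plan_density_def couplings_def)
  have "integrable (density P (\<lambda>z. ennreal (Z z))) (\<lambda>z. f (snd z))"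
    using integrable_distr_eq[of snd "density P (\<lambda>z. ennreal (Z z))" borel f] f unfolding d by simp
  then show "integrable P (\<lambda>z. Z z * f (snd z))" using nn by (subst (asm) integrable_real_density) auto
  have "(\<integral>x. f x \<partial>\<nu>) = (\<integral>z. f (snd z) \<partial>density P (\<lambda>z. ennreal (Z z)))"
    using integral_distr[of snd "density P (\<lambda>z. ennreal (Z z))" borel f] unfolding d by simp
  then show "(\<integral>z. Z z * f (snd z) \<partial>P) = (\<integral>x. f x \<partial>\<nu>)" using nn by (subst (asm) integral_real_density) auto
qed

text \<open>The right-hand side is the value of the objective: the cost terms of \<open>log_ratio\<close> and of the objective cancel.\<close>

lemma excess_gibbs_density:
  assumes \<phi>: "integrable \<mu> \<phi>" and \<psi>: "integrable \<nu> \<psi>" and opt: "plan_density (gibbs_density \<phi> \<psi>)"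
  shows "ereal \<epsilon> * enn2ereal (excess (gibbs_density \<phi> \<psi>)) + ereal (\<epsilon> * (1 - gibbs_mass))
    = ereal ((\<integral>x. \<phi> x \<partial>\<mu>) + (\<integral>y. \<psi> y \<partial>\<nu>))"
proof -
  let ?\<rho> = "gibbs_density \<phi> \<psi>"
  have r: "?\<rho> z * ln (?\<rho> z / gibbs z) - ?\<rho> z + gibbs z
    = (?\<rho> z * \<phi> (fst z) + ?\<rho> z * \<psi> (snd z)) / \<epsilon> - ?\<rho> z + gibbs z" for z
  proof -
    have "?\<rho> z / gibbs z = exp ((\<phi> (fst z) + \<psi> (snd z)) / \<epsilon>)"
      by (simp add: gibbs_density_def gibbs_def exp_diff[symmetric] diff_divide_distrib)
    then show ?thesis by (simp add: distrib_left add_divide_distrib)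
  qed
  have n: "0 \<le> (?\<rho> z * \<phi> (fst z) + ?\<rho> z * \<psi> (snd z)) / \<epsilon> - ?\<rho> z + gibbs z" for z
    unfolding r[symmetric] by (intro kl_real_nonneg less_imp_le[OF gibbs_density_pos] gibbs_pos)
  note i = integral_plan_fst[OF opt \<phi>] integral_plan_snd[OF opt \<psi>] plan_density_integrable[OF opt]
    plan_density_integral[OF opt] integrable_gibbs
  have "excess ?\<rho> = (\<integral>\<^sup>+z. ennreal ((?\<rho> z * \<phi> (fst z) + ?\<rho> z * \<psi> (snd z)) / \<epsilon> - ?\<rho> z + gibbs z) \<partial>P)"
    unfolding excess_def by (simp add: kl_pos r)
  also have "\<dots> = ennreal (\<integral>z. (?\<rho> z * \<phi> (fst z) + ?\<rho> z * \<psi> (snd z)) / \<epsilon> - ?\<rho> z + gibbs z \<partial>P)"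
    using i n by (intro nn_integral_eq_integral) auto
  finally have e: "excess ?\<rho> = ennreal (\<integral>z. (?\<rho> z * \<phi> (fst z) + ?\<rho> z * \<psi> (snd z)) / \<epsilon> - ?\<rho> z + gibbs z \<partial>P)" .
  have "(\<integral>z. (?\<rho> z * \<phi> (fst z) + ?\<rho> z * \<psi> (snd z)) / \<epsilon> - ?\<rho> z + gibbs z \<partial>P)
    = ((\<integral>x. \<phi> x \<partial>\<mu>) + (\<integral>y. \<psi> y \<partial>\<nu>)) / \<epsilon> - 1 + gibbs_mass"
    using i by (simp add: gibbs_mass_def)
  moreover have "0 \<le> (\<integral>z. (?\<rho> z * \<phi> (fst z) + ?\<rho> z * \<psi> (snd z)) / \<epsilon> - ?\<rho> z + gibbs z \<partial>P)"
    using n by (intro integral_nonneg_AE) auto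
  ultimately obtain E where E: "excess ?\<rho> = ennreal E" "0 \<le> E"
      "E = ((\<integral>x. \<phi> x \<partial>\<mu>) + (\<integral>y. \<psi> y \<partial>\<nu>)) / \<epsilon> - 1 + gibbs_mass" using e by blast
  have "\<epsilon> * E + \<epsilon> * (1 - gibbs_mass) = (\<integral>x. \<phi> x \<partial>\<mu>) + (\<integral>y. \<psi> y \<partial>\<nu>)"
    unfolding E(3) using eps by (simp add: field_simps)
  then show ?thesis unfolding E(1) using E(2) by (simp add: enn2ereal_ennreal)
qed

lemma objective_mono:
  assumes "optimal Z" "\<pi> \<in> couplings \<mu> \<nu>"
  shows "eot_objective \<epsilon> \<mu> \<nu> (density P (\<lambda>z. ennreal (Z z))) \<le> eot_objective \<epsilon> \<mu> \<nu> \<pi>"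
proof (cases "eot_objective \<epsilon> \<mu> \<nu> \<pi> = \<infinity>")
  case False
  from coupling_density[OF assms(2) this] obtain Z' where Z': "plan_density Z'" "\<pi> = density P (\<lambda>z. ennreal (Z' z))" .
  have "excess Z \<le> excess Z'" "plan_density Z" using assms Z' by (auto simp: optimal_def)
  then show ?thesis using eps unfolding Z'(2) objective_eq[OF Z'(1)] objective_eq[OF \<open>plan_density Z\<close>]
    by (intro add_right_mono ereal_mult_left_mono) (auto simp: less_eq_ennreal.rep_eq)
qed simp

lemma eot_cost_eq:
  assumes "integrable \<mu> \<phi>" "integrable \<nu> \<psi>" "optimal (gibbs_density \<phi> \<psi>)"
  shows "eot_cost \<epsilon> \<mu> \<nu> = ereal ((\<integral>x. \<phi> x \<partial>\<mu>) + (\<integral>y. \<psi> y \<partial>\<nu>))"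
proof -
  let ?\<rho> = "gibbs_density \<phi> \<psi>"
  have pd: "plan_density ?\<rho>" using assms by (simp add: optimal_def)
  have "eot_cost \<epsilon> \<mu> \<nu> = eot_objective \<epsilon> \<mu> \<nu> (density P (\<lambda>z. ennreal (?\<rho> z)))"
    unfolding eot_cost_def
    by (rule INF_eqI) (use objective_mono[OF assms(3)] pd in \<open>auto simp: plan_density_def\<close>)
  also have "\<dots> = ereal ((\<integral>x. \<phi> x \<partial>\<mu>) + (\<integral>y. \<psi> y \<partial>\<nu>))"
    unfolding objective_eq[OF pd] by (rule excess_gibbs_density[OF assms(1,2) pd])
  finally show ?thesis .
qed

text \<open>Uniqueness: a second minimiser has zero divergence from the first by the Pythagorean inequality.\<close>

lemma eot_plan_eq:
  assumes opt: "optimal Z"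
  shows "eot_plan \<epsilon> \<mu> \<nu> = density P (\<lambda>z. ennreal (Z z))"
  unfolding eot_plan_def
proof (rule the_equality)
  have pd: "plan_density Z" using opt by (simp add: optimal_def)
  let ?p = "density P (\<lambda>z. ennreal (Z z))"
  show "is_arg_min (eot_objective \<epsilon> \<mu> \<nu>) (\<lambda>\<pi>. \<pi> \<in> couplings \<mu> \<nu>) ?p"
    using objective_mono[OF opt] pd by (auto simp: is_arg_min_def plan_density_def not_less)
  fix \<pi> assume m: "is_arg_min (eot_objective \<epsilon> \<mu> \<nu>) (\<lambda>\<pi>. \<pi> \<in> couplings \<mu> \<nu>) \<pi>"
  have pc: "?p \<in> couplings \<mu> \<nu>" using pd by (simp add: plan_density_def)
  then have le: "eot_objective \<epsilon> \<mu> \<nu> \<pi> \<le> eot_objective \<epsilon> \<mu> \<nu> ?p" and c: "\<pi> \<in> couplings \<mu> \<nu>"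
    using m by (auto simp: is_arg_min_def not_less)
  obtain I where I: "excess Z = ennreal I" "0 \<le> I" using optimal_finite[OF opt] by (cases "excess Z") auto
  have "eot_objective \<epsilon> \<mu> \<nu> ?p \<noteq> \<infinity>" unfolding objective_eq[OF pd] I using I by (simp add: enn2ereal_ennreal)
  with le have "eot_objective \<epsilon> \<mu> \<nu> \<pi> \<noteq> \<infinity>" by auto
  from coupling_density[OF c this] obtain Z' where Z': "plan_density Z'" "\<pi> = density P (\<lambda>z. ennreal (Z' z))" .
  have "ereal \<epsilon> * enn2ereal (excess Z') \<le> ereal \<epsilon> * enn2ereal (excess Z)"
    using le unfolding Z'(2) objective_eq[OF Z'(1)] objective_eq[OF pd] by (simp add: ereal_add_le_add_iff2)
  then have "enn2ereal (excess Z') \<le> enn2ereal (excess Z)"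
    using eps by (simp add: ereal_mult_le_mult_iff)
  then have "excess Z' \<le> excess Z" by (simp add: less_eq_ennreal.rep_eq)
  then have "ennreal I + (\<integral>\<^sup>+z. kl (Z' z) (Z z) \<partial>P) \<le> ennreal I + 0"
    using order_trans[OF optimal_pythagoras[OF opt Z'(1)], of "excess Z"] unfolding I(1) by simp
  then have "(\<integral>\<^sup>+z. kl (Z' z) (Z z) \<partial>P) = 0" by (subst (asm) ennreal_add_left_cancel_le) auto
  moreover note [measurable] = plan_density_meas[OF pd] plan_density_meas[OF Z'(1)]
  ultimately have "AE z in P. kl (Z' z) (Z z) = 0" by (subst (asm) nn_integral_0_iff_AE) auto
  then have "AE z in P. Z' z = Z z"
    by eventually_elim (rule kl_eq_0D, auto intro: plan_density_nonneg[OF pd] plan_density_nonneg[OF Z'(1)])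
  then show "\<pi> = ?p" unfolding Z'(2) by (intro density_cong) auto
qed

end

section \<open>Laplace transforms inside their domain\<close>

lemma exp_diff_le: "\<bar>exp v - exp u\<bar> \<le> \<bar>v - u\<bar> * (exp u + exp v :: real)"
proof -
  have *: "exp b - exp a \<le> (b - a) * exp b" for a b :: real
  proof -
    have "exp b * (1 + (a - b)) \<le> exp b * exp (a - b)" by (intro mult_left_mono exp_ge_add_one_self) auto
    then show ?thesis by (simp add: exp_diff algebra_simps)
  qed
  show ?thesis
  proof (cases "u \<le> v")
    case True
    have "(v - u) * exp v \<le> (v - u) * (exp u + exp v)" using True by (intro mult_left_mono) auto
    then show ?thesis using *[of v u] True by simp
  next
    case False
    have "(u - v) * exp u \<le> (u - v) * (exp u + exp v)" using False by (intro mult_left_mono) auto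
    moreover have "\<bar>exp v - exp u\<bar> = exp u - exp v" "\<bar>v - u\<bar> = u - v" using False by auto
    ultimately show ?thesis using *[of u v] by (simp only:)
  qed
qed

text \<open>The weight is kept outside the measure so that \<open>\<nu>\<close> remains finite and the transform is measurable on the
whole space; where the integral diverges, \<open>mass\<close> and \<open>moment\<close> are 0.\<close>

locale laplace_transform = prob_space \<nu> for \<nu> :: "'a::euclidean_space measure" +
  fixes w :: "'a \<Rightarrow> real" and s :: real
  assumes sets_eq [measurable_cong, simp]: "sets \<nu> = sets borel"
    and w_meas [measurable]: "w \<in> borel_measurable borel" and w_pos: "\<And>y. 0 < w y" and s_pos: "0 < s"
begin

definition tilt :: "'a \<Rightarrow> 'a \<Rightarrow> real" where "tilt x y = w y * exp (s * (x \<bullet> y))"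

definition dom :: "'a set" where "dom = {x. integrable \<nu> (tilt x)}"

definition mass :: "'a \<Rightarrow> real" where "mass x = (\<integral>y. tilt x y \<partial>\<nu>)"

definition moment :: "'a \<Rightarrow> 'a" where "moment x = (\<integral>y. tilt x y *\<^sub>R y \<partial>\<nu>)"

lemma space_eq [simp]: "space \<nu> = UNIV" using sets_eq_imp_space_eq[OF sets_eq] by simp

lemma tilt_meas [measurable]: "(\<lambda>z. tilt (fst z) (snd z)) \<in> borel_measurable (borel \<Otimes>\<^sub>M borel)"
  unfolding tilt_def by measurable

lemma tilt_meas' [measurable]: "tilt x \<in> borel_measurable borel"
  unfolding tilt_def[abs_def] by measurable

lemma tilt_pos: "0 < tilt x y" using w_pos by (simp add: tilt_def)

lemma mass_meas [measurable]: "mass \<in> borel_measurable borel"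
  unfolding mass_def[abs_def]
  by (rule borel_measurable_lebesgue_integral) (use tilt_meas in \<open>simp add: case_prod_beta'\<close>)

lemma moment_meas [measurable]: "moment \<in> borel_measurable borel"
proof -
  have "(\<lambda>z. tilt (fst z) (snd z) *\<^sub>R snd z) \<in> borel_measurable (borel \<Otimes>\<^sub>M borel)" by measurable
  then show ?thesis unfolding moment_def[abs_def]
    by (intro borel_measurable_lebesgue_integral) (simp add: case_prod_beta')
qed

lemma mass_pos: "x \<in> dom \<Longrightarrow> 0 < mass x"
proof -
  assume x: "x \<in> dom"
  have "0 \<le> mass x" unfolding mass_def using tilt_pos by (intro integral_nonneg_AE) (auto intro: less_imp_le)
  moreover have "mass x \<noteq> 0"
  proof
    assume "mass x = 0"
    then have "AE y in \<nu>. tilt x y = 0"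
      using integral_nonneg_eq_0_iff_AE[of \<nu> "tilt x"] x tilt_pos by (auto simp: mass_def dom_def less_imp_le)
    then have "AE y in \<nu>. False" by eventually_elim (use tilt_pos in \<open>metis less_irrefl\<close>)
    then show False by simp
  qed
  ultimately show ?thesis by simp
qed

lemma convex_dom: "convex dom"
proof (rule convexI)
  fix x y u v assume x: "x \<in> dom" and y: "y \<in> dom" and uv: "0 \<le> u" "0 \<le> v" "u + v = (1::real)"
  have le: "tilt (u *\<^sub>R x + v *\<^sub>R y) z \<le> u * tilt x z + v * tilt y z" for z
  proof -
    have "exp (u *\<^sub>R (s * (x \<bullet> z)) + v *\<^sub>R (s * (y \<bullet> z))) \<le> u * exp (s * (x \<bullet> z)) + v * exp (s * (y \<bullet> z))"
    proof -
      have "u = 1 - v" using uv by simp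
      then show ?thesis using convex_onD[OF exp_convex, of v "s * (x \<bullet> z)" "s * (y \<bullet> z)"] uv(1,2) by simp
    qed
    then have "w z * exp (u *\<^sub>R (s * (x \<bullet> z)) + v *\<^sub>R (s * (y \<bullet> z))) \<le> w z * (u * exp (s * (x \<bullet> z)) + v * exp (s * (y \<bullet> z)))"
      using w_pos[of z] by (intro mult_left_mono) auto
    then show ?thesis by (simp add: tilt_def algebra_simps)
  qed
  have "integrable \<nu> (\<lambda>z. u * tilt x z + v * tilt y z)" using x y by (auto simp: dom_def)
  then have "integrable \<nu> (tilt (u *\<^sub>R x + v *\<^sub>R y))"
    by (rule Bochner_Integration.integrable_bound)
      (use le tilt_pos in \<open>auto intro!: AE_I2 simp: abs_of_pos intro: order_trans[OF _ abs_ge_self]\<close>)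
  then show "u *\<^sub>R x + v *\<^sub>R y \<in> dom" by (simp add: dom_def)
qed

text \<open>Near an interior point \<open>x0\<close> the tilts, also multiplied by \<open>norm y\<close>, are bounded by a multiple of the sum of
the tilts at the points \<open>x0 \<plusminus> R i\<close> with \<open>i\<close> in the basis: the largest coordinate of \<open>y\<close> controls its norm,
and half of the exponent is spent on the polynomial factor.\<close>

lemma local_domination:
  assumes x0: "x0 \<in> interior dom"
  obtains r W where "r > 0" "integrable \<nu> W"
    "\<And>x y. x \<in> ball x0 r \<Longrightarrow> tilt x y \<le> W y" "\<And>x y. x \<in> ball x0 r \<Longrightarrow> norm y * tilt x y \<le> W y"
    "ball x0 r \<subseteq> dom"
proof -
  obtain \<rho> where \<rho>: "\<rho> > 0" "ball x0 \<rho> \<subseteq> dom" using x0 by (auto simp: mem_interior)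
  define R where "R = \<rho> / 2"
  define n where "n = real DIM('a)"
  have R: "R > 0" "R < \<rho>" and n: "n \<ge> 1" using \<rho> by (auto simp: R_def n_def)
  define r where "r = R / (2 * n)"
  have r: "r > 0" using R n by (simp add: r_def)
  define W0 where "W0 y = (\<Sum>i\<in>Basis. tilt (x0 + R *\<^sub>R i) y + tilt (x0 - R *\<^sub>R i) y)" for y
  define c where "c = 1 + 2 * n / (s * R)"
  have c: "c \<ge> 1" using R n s_pos by (simp add: c_def)
  have in_dom: "x0 + R *\<^sub>R i \<in> dom" "x0 - R *\<^sub>R i \<in> dom" if "i \<in> Basis" for i
    using that \<rho> R by (auto intro!: subsetD[OF \<rho>(2)] simp: dist_norm)
  have W0i: "integrable \<nu> W0" unfolding W0_def[abs_def]
    using in_dom by (intro Bochner_Integration.integrable_sum Bochner_Integration.integrable_add) (auto simp: dom_def)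
  have W0nn: "0 \<le> W0 y" for y unfolding W0_def using tilt_pos by (intro sum_nonneg add_nonneg_nonneg) (auto intro: less_imp_le)
  \<comment> \<open>\<open>r\<close> is chosen such that \<open>|(x - x0) \<bullet> y| \<le> (R / 2) max |y \<bullet> i|\<close>.\<close>
  have key: "tilt x y \<le> W0 y \<and> norm y * tilt x y \<le> (2 * n / (s * R)) * W0 y" if x: "x \<in> ball x0 r" for x y
  proof -
    have fin: "finite (Basis :: 'a set)" "(Basis :: 'a set) \<noteq> {}" by auto
    obtain j where j: "j \<in> Basis" "\<And>i. i \<in> Basis \<Longrightarrow> \<bar>y \<bullet> i\<bar> \<le> \<bar>y \<bullet> j\<bar>"
    proof -
      have "Max ((\<lambda>i. \<bar>y \<bullet> i\<bar>) ` Basis) \<in> (\<lambda>i. \<bar>y \<bullet> i\<bar>) ` Basis" by (rule Max_in) auto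
      then obtain j where "j \<in> Basis" "Max ((\<lambda>i. \<bar>y \<bullet> i\<bar>) ` Basis) = \<bar>y \<bullet> j\<bar>" unfolding image_iff by blast
      moreover have "\<bar>y \<bullet> i\<bar> \<le> Max ((\<lambda>i. \<bar>y \<bullet> i\<bar>) ` Basis)" if "i \<in> Basis" for i
        using that by (intro Max_ge) auto
      ultimately show thesis using that by simp
    qed
    let ?t = "\<bar>y \<bullet> j\<bar>"
    have "norm y \<le> (\<Sum>i\<in>Basis. \<bar>y \<bullet> i\<bar>)" by (rule norm_le_l1)
    also have "\<dots> \<le> (\<Sum>i\<in>(Basis::'a set). ?t)" by (intro sum_mono j)
    finally have ny: "norm y \<le> n * ?t" by (simp add: n_def)
    have "(x - x0) \<bullet> y \<le> norm (x - x0) * norm y" by (rule norm_cauchy_schwarz)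
    also have "\<dots> \<le> r * (n * ?t)" using x ny r by (intro mult_mono) (auto simp: dist_norm norm_minus_commute)
    also have "\<dots> = (R / 2) * ?t" using n by (simp add: r_def)
    finally have d: "x \<bullet> y \<le> x0 \<bullet> y + (R / 2) * ?t" by (simp add: inner_diff_left)
    have "tilt x y \<le> w y * exp (s * (x0 \<bullet> y + (R / 2) * ?t))"
      unfolding tilt_def using w_pos[of y] s_pos d by (intro mult_left_mono) auto
    also have "\<dots> = w y * exp (s * (x0 \<bullet> y)) * exp (s * (R / 2) * ?t)" by (simp add: algebra_simps exp_add)
    finally have 1: "tilt x y \<le> w y * exp (s * (x0 \<bullet> y)) * exp (s * (R / 2) * ?t)" .
    have e1: "1 \<le> exp (s * (R / 2) * ?t)" using s_pos R by simp
    have "s * (R / 2) * ?t \<le> exp (s * (R / 2) * ?t)" using exp_ge_add_one_self[of "s * (R / 2) * ?t"] by linarith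
    then have e2: "?t \<le> (2 / (s * R)) * exp (s * (R / 2) * ?t)" using s_pos R by (simp add: field_simps)
    have ee: "exp (s * (R / 2) * ?t) * exp (s * (R / 2) * ?t) = exp (s * R * ?t)" by (simp add: exp_add[symmetric] algebra_simps)
    have big: "w y * exp (s * (x0 \<bullet> y)) * exp (s * R * ?t) \<le> W0 y"
    proof -
      have "w y * exp (s * (x0 \<bullet> y)) * exp (s * R * ?t) \<le> tilt (x0 + R *\<^sub>R j) y + tilt (x0 - R *\<^sub>R j) y"
      proof (cases "0 \<le> y \<bullet> j")
        case True
        then have "w y * exp (s * (x0 \<bullet> y)) * exp (s * R * ?t) = tilt (x0 + R *\<^sub>R j) y"
          by (simp add: tilt_def exp_add[symmetric] inner_add_left inner_commute algebra_simps)
        then show ?thesis using tilt_pos[of "x0 - R *\<^sub>R j" y] by simp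
      next
        case False
        then have "w y * exp (s * (x0 \<bullet> y)) * exp (s * R * ?t) = tilt (x0 - R *\<^sub>R j) y"
          by (simp add: tilt_def exp_add[symmetric] inner_diff_left inner_commute algebra_simps)
        then show ?thesis using tilt_pos[of "x0 + R *\<^sub>R j" y] by simp
      qed
      also have "\<dots> \<le> W0 y" unfolding W0_def
        by (rule member_le_sum[where f="\<lambda>i. tilt (x0 + R *\<^sub>R i) y + tilt (x0 - R *\<^sub>R i) y", OF j(1)])
          (simp_all add: tilt_pos less_imp_le add_nonneg_nonneg)
      finally show ?thesis .
    qed
    have wp: "0 \<le> w y * exp (s * (x0 \<bullet> y))" using w_pos[of y] by simp
    have "tilt x y * 1 \<le> (w y * exp (s * (x0 \<bullet> y)) * exp (s * (R / 2) * ?t)) * exp (s * (R / 2) * ?t)"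
      using 1 e1 wp by (intro mult_mono) auto
    then have A: "tilt x y \<le> W0 y" using big ee by (simp add: mult.assoc)
    have "norm y * tilt x y \<le> (n * ((2 / (s * R)) * exp (s * (R / 2) * ?t))) * (w y * exp (s * (x0 \<bullet> y)) * exp (s * (R / 2) * ?t))"
      using ny e2 1 n tilt_pos[of x y] s_pos R
      by (intro mult_mono order_trans[OF ny mult_left_mono]) (auto simp: less_imp_le)
    also have "\<dots> = (2 * n / (s * R)) * (w y * exp (s * (x0 \<bullet> y)) * (exp (s * (R / 2) * ?t) * exp (s * (R / 2) * ?t)))"
      by (simp add: mult_ac)
    also have "\<dots> \<le> (2 * n / (s * R)) * W0 y"
      unfolding ee using big n s_pos R by (intro mult_left_mono) auto
    finally show ?thesis using A by simp
  qed
  have le: "W0 y \<le> c * W0 y" "(2 * n / (s * R)) * W0 y \<le> c * W0 y" for y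
    using W0nn[of y] c mult_right_mono[of "2 * n / (s * R)" c "W0 y"] mult_right_mono[of 1 c "W0 y"]
    by (auto simp: c_def)
  show thesis
  proof (rule that[of r "\<lambda>y. c * W0 y"])
    show "integrable \<nu> (\<lambda>y. c * W0 y)" using W0i by auto
    show "tilt x y \<le> c * W0 y" "norm y * tilt x y \<le> c * W0 y" if "x \<in> ball x0 r" for x y
      using key[OF that, of y] le[of y] by linarith+
    show "ball x0 r \<subseteq> dom"
    proof -
      have "r \<le> R" using n R by (simp add: r_def divide_le_eq)
      then show ?thesis using R subset_ball[of r \<rho> x0] \<rho>(2) by auto
    qed
  qed (rule r)
qed

lemma tilt_continuous: "isCont (\<lambda>x. tilt x y) x" unfolding tilt_def by (intro continuous_intros)

lemma integrable_moment:
  assumes "x \<in> interior dom" shows "integrable \<nu> (\<lambda>y. tilt x y *\<^sub>R y)"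
proof -
  obtain r W where r: "r > 0" and W: "integrable \<nu> W" and le: "\<And>x' y. x' \<in> ball x r \<Longrightarrow> norm y * tilt x' y \<le> W y"
    by (rule local_domination[OF assms]) blast
  show ?thesis
    by (rule Bochner_Integration.integrable_bound[OF W])
      (use le[of x] r tilt_pos[of x] in \<open>auto intro!: AE_I2 intro: order_trans[OF _ abs_ge_self] simp: mult.commute abs_of_pos\<close>)
qed

lemma continuous_mass_moment:
  "continuous_on (interior dom) mass" "continuous_on (interior dom) moment"
proof -
  have "isCont mass x0 \<and> isCont moment x0" if x0: "x0 \<in> interior dom" for x0
  proof -
    obtain r W where r: "r > 0" and W: "integrable \<nu> W" and le: "\<And>x y. x \<in> ball x0 r \<Longrightarrow> tilt x y \<le> W y"
      "\<And>x y. x \<in> ball x0 r \<Longrightarrow> norm y * tilt x y \<le> W y" by (rule local_domination[OF x0]) blast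
    have "(\<lambda>n. mass (u n)) \<longlonglongrightarrow> mass x0 \<and> (\<lambda>n. moment (u n)) \<longlonglongrightarrow> moment x0" if u: "u \<longlonglongrightarrow> x0" for u
    proof -
      obtain N where N: "\<And>n. n \<ge> N \<Longrightarrow> u n \<in> ball x0 r"
        using u r by (metis LIMSEQ_iff_nz dist_commute mem_ball metric_LIMSEQ_D)
      have v: "(\<lambda>n. u (n + N)) \<longlonglongrightarrow> x0" using u by (rule LIMSEQ_ignore_initial_segment)
      have vt: "(\<lambda>n. tilt (u (n + N)) y) \<longlonglongrightarrow> tilt x0 y" for y
        by (rule isCont_tendsto_compose[OF tilt_continuous v])
      have "(\<lambda>n. mass (u (n + N))) \<longlonglongrightarrow> mass x0" unfolding mass_def
        by (rule integral_dominated_convergence[where w=W])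
          (use W vt le(1)[OF N] tilt_pos in \<open>auto intro!: AE_I2 simp: abs_of_pos\<close>)
      moreover have "(\<lambda>n. moment (u (n + N))) \<longlonglongrightarrow> moment x0" unfolding moment_def
        by (rule integral_dominated_convergence[where w=W])
          (use W vt le(2)[OF N] tilt_pos in \<open>auto intro!: AE_I2 tendsto_intros simp: abs_of_pos mult.commute\<close>)
      ultimately show ?thesis
        using LIMSEQ_offset[of "\<lambda>n. mass (u n)" N] LIMSEQ_offset[of "\<lambda>n. moment (u n)" N] by simp
    qed
    then show ?thesis unfolding continuous_at_sequentially by (auto simp: comp_def)
  qed
  then show "continuous_on (interior dom) mass" "continuous_on (interior dom) moment"
    by (auto intro!: continuous_at_imp_continuous_on)
qed

text \<open>Differentiation under the integral; \<open>exp_diff_le\<close> and \<open>local_domination\<close> dominate the difference quotients.\<close>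

lemma mass_derivative:
  assumes x0: "x0 \<in> interior dom" and i: "i \<in> Basis"
  shows "((\<lambda>t. mass (x0 + t *\<^sub>R i)) has_real_derivative s * (moment x0 \<bullet> i)) (at 0)"
proof -
  obtain r W where r: "r > 0" and W: "integrable \<nu> W" and le: "\<And>x y. x \<in> ball x0 r \<Longrightarrow> tilt x y \<le> W y"
    "\<And>x y. x \<in> ball x0 r \<Longrightarrow> norm y * tilt x y \<le> W y" and sub: "ball x0 r \<subseteq> dom"
    by (rule local_domination[OF x0]) blast
  have i1: "norm i = 1" using i by simp
  have x0r: "x0 \<in> ball x0 r" using r by simp
  have "(\<lambda>n. (mass (x0 + (0 + u n) *\<^sub>R i) - mass (x0 + 0 *\<^sub>R i)) / u n) \<longlonglongrightarrow> s * (moment x0 \<bullet> i)"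
    if u0: "\<And>n. u n \<noteq> 0" and u: "u \<longlonglongrightarrow> 0" for u
  proof -
    obtain N where N: "\<And>n. n \<ge> N \<Longrightarrow> \<bar>u n\<bar> < r"
      using LIMSEQ_D[OF u r] by auto
    define v where "v n = u (n + N)" for n
    have v: "v \<longlonglongrightarrow> 0" "\<And>n. v n \<noteq> 0" "\<And>n. \<bar>v n\<bar> < r"
      using u0 N LIMSEQ_ignore_initial_segment[OF u, of N] by (auto simp: v_def[abs_def])
    have vb: "x0 + v n *\<^sub>R i \<in> ball x0 r" for n using v(3)[of n] i1 by (simp add: dist_norm)
    let ?q = "\<lambda>n y. (tilt (x0 + v n *\<^sub>R i) y - tilt x0 y) / v n"
    have pt: "(\<lambda>n. ?q n y) \<longlonglongrightarrow> s * (tilt x0 y * (y \<bullet> i))" for y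
    proof -
      have "((\<lambda>t. tilt (x0 + t *\<^sub>R i) y) has_real_derivative s * (tilt x0 y * (y \<bullet> i))) (at 0)"
        unfolding tilt_def
        by (auto intro!: derivative_eq_intros simp: inner_add_left inner_commute algebra_simps)
      then have "(\<lambda>t. (tilt (x0 + t *\<^sub>R i) y - tilt x0 y) / t) \<midarrow>0\<rightarrow> s * (tilt x0 y * (y \<bullet> i))"
        by (simp add: DERIV_def)
      then show ?thesis using v by (auto simp: LIMSEQ_SEQ_conv[symmetric])
    qed
    have bd: "\<bar>?q n y\<bar> \<le> 2 * s * W y" for n y
    proof -
      have yi: "\<bar>y \<bullet> i\<bar> \<le> norm y" using Basis_le_norm[OF i] .
      have "\<bar>tilt (x0 + v n *\<^sub>R i) y - tilt x0 y\<bar> = w y * \<bar>exp (s * ((x0 + v n *\<^sub>R i) \<bullet> y)) - exp (s * (x0 \<bullet> y))\<bar>"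
        using w_pos[of y] by (simp add: tilt_def abs_mult right_diff_distrib[symmetric])
      also have "\<dots> \<le> w y * (\<bar>s * ((x0 + v n *\<^sub>R i) \<bullet> y) - s * (x0 \<bullet> y)\<bar> * (exp (s * (x0 \<bullet> y)) + exp (s * ((x0 + v n *\<^sub>R i) \<bullet> y))))"
        using w_pos[of y] by (intro mult_left_mono exp_diff_le) auto
      also have "\<bar>s * ((x0 + v n *\<^sub>R i) \<bullet> y) - s * (x0 \<bullet> y)\<bar> = s * \<bar>v n\<bar> * \<bar>y \<bullet> i\<bar>"
      proof -
        have "s * ((x0 + v n *\<^sub>R i) \<bullet> y) - s * (x0 \<bullet> y) = s * v n * (y \<bullet> i)"
          by (simp add: inner_add_left inner_add_right inner_commute algebra_simps)
        then show ?thesis unfolding \<open>s * ((x0 + v n *\<^sub>R i) \<bullet> y) - s * (x0 \<bullet> y) = s * v n * (y \<bullet> i)\<close> abs_mult using s_pos by simp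
      qed
      also have "w y * (s * \<bar>v n\<bar> * \<bar>y \<bullet> i\<bar> * (exp (s * (x0 \<bullet> y)) + exp (s * ((x0 + v n *\<^sub>R i) \<bullet> y))))
        = s * \<bar>v n\<bar> * (\<bar>y \<bullet> i\<bar> * tilt x0 y + \<bar>y \<bullet> i\<bar> * tilt (x0 + v n *\<^sub>R i) y)"
        by (simp add: tilt_def algebra_simps)
      also have "\<dots> \<le> s * \<bar>v n\<bar> * (W y + W y)"
      proof (intro mult_left_mono add_mono)
        show "\<bar>y \<bullet> i\<bar> * tilt x0 y \<le> W y"
          by (rule order_trans[OF mult_right_mono[OF yi] le(2)[OF x0r]]) (simp add: tilt_pos less_imp_le)
        show "\<bar>y \<bullet> i\<bar> * tilt (x0 + v n *\<^sub>R i) y \<le> W y"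
          by (rule order_trans[OF mult_right_mono[OF yi] le(2)[OF vb]]) (simp add: tilt_pos less_imp_le)
      qed (use s_pos in auto)
      finally have "\<bar>tilt (x0 + v n *\<^sub>R i) y - tilt x0 y\<bar> \<le> \<bar>v n\<bar> * (2 * s * W y)" by (simp add: algebra_simps)
      then show ?thesis using v(2)[of n] by (simp add: abs_divide divide_le_eq mult.commute)
    qed
    have l: "(\<lambda>n. \<integral>y. ?q n y \<partial>\<nu>) \<longlonglongrightarrow> (\<integral>y. s * (tilt x0 y * (y \<bullet> i)) \<partial>\<nu>)"
    proof (rule integral_dominated_convergence[where w="\<lambda>y. 2 * s * W y"])
      show "AE y in \<nu>. norm (?q n y) \<le> 2 * s * W y" for n by (rule AE_I2) (simp only: real_norm_def bd)
      show "AE y in \<nu>. (\<lambda>n. ?q n y) \<longlonglongrightarrow> s * (tilt x0 y * (y \<bullet> i))" by (rule AE_I2) (rule pt)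
    qed (use W in simp_all)
    have e1: "(\<integral>y. ?q n y \<partial>\<nu>) = (mass (x0 + v n *\<^sub>R i) - mass x0) / v n" for n
      using subsetD[OF sub vb[of n]] subsetD[OF sub x0r] by (simp add: mass_def dom_def)
    have e2: "(\<integral>y. s * (tilt x0 y * (y \<bullet> i)) \<partial>\<nu>) = s * (moment x0 \<bullet> i)"
      using integral_inner_left[of i, OF integrable_moment[OF x0]] by (simp add: moment_def)
    have "(\<lambda>n. (mass (x0 + v n *\<^sub>R i) - mass x0) / v n) \<longlonglongrightarrow> s * (moment x0 \<bullet> i)"
      using l unfolding e1 e2 .
    then show ?thesis unfolding v_def by - (rule LIMSEQ_offset[of _ N], simp)
  qed
  then show ?thesis unfolding DERIV_def LIMSEQ_SEQ_conv[symmetric] by simp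
qed

end

section \<open>Weak gradients of continuously differentiable functions\<close>

text \<open>The integral of every difference quotient vanishes because Lebesgue measure is translation invariant. The
quotients are bounded by the mean value theorem and vanish off a fixed compact set.\<close>

lemma integral_partial_derivative_0:
  fixes F :: "'a::euclidean_space \<Rightarrow> real"
  assumes i: "i \<in> Basis" and K: "compact K" and out: "\<And>x. x \<notin> K \<Longrightarrow> F x = 0"
    and F: "continuous_on UNIV F" and F': "continuous_on UNIV F'"
    and der: "\<And>x. ((\<lambda>t. F (x + t *\<^sub>R i)) has_real_derivative F' x) (at 0)"
  shows "(\<integral>x. F' x \<partial>lborel) = 0"
proof -
  have [measurable]: "F \<in> borel_measurable borel" "F' \<in> borel_measurable borel"
    using F F' by (auto intro: borel_measurable_continuous_onI)
  have der': "((\<lambda>t. F (x + t *\<^sub>R i)) has_real_derivative F' (x + u *\<^sub>R i)) (at u)" for x u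
    using der[of "x + u *\<^sub>R i"] unfolding DERIV_def by (simp add: algebra_simps)
  have out': "F' x = 0" if x: "x \<notin> K" for x
  proof -
    have "open (- K)" using K by (simp add: compact_imp_closed open_Compl)
    then obtain r where r: "r > 0" "ball x r \<subseteq> - K" using x by (auto simp: open_contains_ball)
    have ev: "\<forall>\<^sub>F t in nhds (0::real). F (x + t *\<^sub>R i) = 0"
      unfolding eventually_nhds_metric
    proof (intro exI[of _ r] conjI allI impI)
      fix t :: real assume "dist t 0 < r"
      then have "x + t *\<^sub>R i \<in> ball x r" using i by (simp add: dist_norm)
      then show "F (x + t *\<^sub>R i) = 0" using r out by auto
    qed (rule r)
    have "((\<lambda>t. F (x + t *\<^sub>R i)) has_real_derivative 0) (at 0)"
      by (rule DERIV_cong_ev[OF refl ev refl, THEN iffD2]) simp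
    then show ?thesis using der[of x] DERIV_unique by blast
  qed
  obtain B where B: "\<And>x. x \<in> K \<Longrightarrow> \<bar>F' x\<bar> \<le> B"
    using compact_imp_bounded[OF compact_continuous_image[OF continuous_on_subset[OF F'] K]]
    by (auto simp: bounded_iff)
  have B': "\<bar>F' x\<bar> \<le> \<bar>B\<bar>" for x using B[of x] out'[of x] by (cases "x \<in> K") auto
  define t where "t n = inverse (real (Suc n))" for n
  have t: "0 < t n" "t n \<le> 1" "t n \<noteq> 0" for n by (auto simp: t_def field_simps)
  have t0: "t \<longlonglongrightarrow> 0" unfolding t_def[abs_def] by (rule LIMSEQ_inverse_real_of_nat)
  define D where "D n x = (F (x + t n *\<^sub>R i) - F x) / t n" for n x
  have [measurable]: "D n \<in> borel_measurable borel" for n unfolding D_def[abs_def] by measurable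
  define K' where "K' = (\<lambda>(k, \<tau>). k - \<tau> *\<^sub>R i) ` (K \<times> {0..1::real})"
  have K': "compact K'" unfolding K'_def
    by (rule compact_continuous_image) (auto intro!: continuous_intros compact_Times K simp: case_prod_beta')
  have Dle: "\<bar>D n x\<bar> \<le> indicator K' x * \<bar>B\<bar>" for n x
  proof (cases "x \<in> K'")
    case True
    have "\<exists>z. 0 < z \<and> z < t n \<and> F (x + t n *\<^sub>R i) - F (x + 0 *\<^sub>R i) = (t n - 0) * F' (x + z *\<^sub>R i)"
      using MVT2[OF t(1)[of n], of "\<lambda>\<tau>. F (x + \<tau> *\<^sub>R i)" "\<lambda>\<tau>. F' (x + \<tau> *\<^sub>R i)"] der' by blast
    then obtain z where "F (x + t n *\<^sub>R i) - F x = t n * F' (x + z *\<^sub>R i)" by auto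
    then have "D n x = F' (x + z *\<^sub>R i)" using t[of n] by (simp add: D_def)
    then show ?thesis using B' True by simp
  next
    case False
    have "x \<notin> K" using False unfolding K'_def by (force simp: image_iff)
    moreover have "x + t n *\<^sub>R i \<notin> K"
    proof
      assume "x + t n *\<^sub>R i \<in> K"
      then have "(\<lambda>(k, \<tau>). k - \<tau> *\<^sub>R i) (x + t n *\<^sub>R i, t n) \<in> K'"
        unfolding K'_def using t[of n] by (intro imageI) auto
      then show False using False by simp
    qed
    ultimately show ?thesis using out by (simp add: D_def)
  qed
  have Fi: "integrable lborel F"
  proof -
    have "integrable lborel (\<lambda>x. indicator K x *\<^sub>R F x)" by (rule borel_integrable_compact[OF K continuous_on_subset[OF F]]) simp
    moreover have "(\<lambda>x. indicator K x *\<^sub>R F x) = F" using out by (auto simp: indicator_def fun_eq_iff)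
    ultimately show ?thesis by simp
  qed
  have shift: "integrable lborel (\<lambda>x. F (x + c))" "(\<integral>x. F (x + c) \<partial>lborel) = (\<integral>x. F x \<partial>lborel)" for c
    using integrable_distr_eq[of "(+) c" lborel borel F] Fi integral_distr[of "(+) c" lborel borel F]
    by (simp_all add: lborel_distr_plus add.commute)
  have D0: "(\<integral>x. D n x \<partial>lborel) = 0" for n unfolding D_def using shift Fi by simp
  have "integrable lborel (\<lambda>x. indicator K' x *\<^sub>R \<bar>B\<bar>)" by (rule borel_integrable_compact[OF K']) auto
  then have "(\<lambda>n. \<integral>x. D n x \<partial>lborel) \<longlonglongrightarrow> (\<integral>x. F' x \<partial>lborel)"
  proof (intro integral_dominated_convergence[where w="\<lambda>x. indicator K' x *\<^sub>R \<bar>B\<bar>"])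
    show "AE x in lborel. (\<lambda>n. D n x) \<longlonglongrightarrow> F' x"
    proof (rule AE_I2)
      fix x
      have "(\<lambda>t. (F (x + t *\<^sub>R i) - F x) / t) \<midarrow>0\<rightarrow> F' x" using der[of x] by (simp add: DERIV_def)
      then show "(\<lambda>n. D n x) \<longlonglongrightarrow> F' x" unfolding D_def LIMSEQ_SEQ_conv[symmetric] using t(3) t0 by auto
    qed
  qed (use Dle in auto)
  then show ?thesis unfolding D0 using LIMSEQ_unique tendsto_const by blast
qed

lemma test_funD:
  assumes "test_fun U \<phi>"
  defines "S \<equiv> closure {x. \<phi> x \<noteq> 0}"
  shows "compact S" "S \<subseteq> U" "continuous_on UNIV \<phi>" "\<And>x. x \<notin> S \<Longrightarrow> \<phi> x = 0"
    "i \<in> Basis \<Longrightarrow> continuous_on UNIV (\<lambda>x. frechet_derivative \<phi> (at x) i)"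
    "i \<in> Basis \<Longrightarrow> ((\<lambda>t. \<phi> (x + t *\<^sub>R i)) has_real_derivative frechet_derivative \<phi> (at x) i) (at 0)"
    "\<And>x. x \<notin> S \<Longrightarrow> frechet_derivative \<phi> (at x) i = 0"
proof -
  have ck: "ck_fun 0 \<phi>" "ck_fun (Suc 0) \<phi>" using assms unfolding test_fun_def by blast+
  show "compact S" "S \<subseteq> U" using assms(1) unfolding test_fun_def S_def by blast+
  show "continuous_on UNIV \<phi>" using ck by simp
  show z: "\<phi> x = 0" if "x \<notin> S" for x
    using that subsetD[OF closure_subset, of x "{x. \<phi> x \<noteq> 0}"] unfolding S_def by blast
  show "continuous_on UNIV (\<lambda>x. frechet_derivative \<phi> (at x) i)" if "i \<in> Basis" using ck that by simp
  have d: "(\<phi> has_derivative frechet_derivative \<phi> (at x)) (at x)" for x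
    using ck by (simp add: frechet_derivative_works[symmetric])
  show "((\<lambda>t. \<phi> (x + t *\<^sub>R i)) has_real_derivative frechet_derivative \<phi> (at x) i) (at 0)" if "i \<in> Basis"
  proof -
    have "((\<lambda>t. x + t *\<^sub>R i) has_derivative (\<lambda>t. t *\<^sub>R i)) (at 0)" by (auto intro!: derivative_eq_intros)
    moreover have "(\<phi> has_derivative frechet_derivative \<phi> (at x)) (at (x + 0 *\<^sub>R i))" using d by simp
    ultimately have "((\<lambda>t. \<phi> (x + t *\<^sub>R i)) has_derivative (\<lambda>t. frechet_derivative \<phi> (at x) (t *\<^sub>R i))) (at 0)"
      by (rule has_derivative_compose)
    moreover have "frechet_derivative \<phi> (at x) (t *\<^sub>R i) = frechet_derivative \<phi> (at x) i * t" for t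
      using linear_scale[OF has_derivative_linear[OF d], of x t i] by (simp add: mult.commute)
    ultimately show ?thesis by (simp add: has_field_derivative_def)
  qed
  show "frechet_derivative \<phi> (at x) i = 0" if "x \<notin> S" for x
  proof -
    have "(\<phi> has_derivative (\<lambda>_. 0)) (at x)"
    proof (rule has_derivative_transform_within_open)
      show "((\<lambda>_. 0) has_derivative (\<lambda>_. 0)) (at x)" by simp
      show "open (- S)" by (simp add: S_def open_Compl)
      show "x \<in> - S" using that by simp
      show "0 = \<phi> y" if "y \<in> - S" for y using z that by simp
    qed
    from fun_cong[OF frechet_derivative_at[OF this], of i] show ?thesis by simp
  qed
qed

text \<open>Multiplied by a test function, \<open>h\<close> extends by 0 to a continuously differentiable function with compact
support, to which \<open>integral_partial_derivative_0\<close> applies.\<close>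

lemma smooth_is_weak_gradient:
  fixes h :: "'a::euclidean_space \<Rightarrow> real" and g :: "'a \<Rightarrow> 'a"
  assumes U: "open U" and [measurable]: "h \<in> borel_measurable borel" "g \<in> borel_measurable borel"
    and h: "continuous_on U h" and g: "continuous_on U g"
    and der: "\<And>x i. x \<in> U \<Longrightarrow> i \<in> Basis \<Longrightarrow> ((\<lambda>t. h (x + t *\<^sub>R i)) has_real_derivative g x \<bullet> i) (at 0)"
  shows "is_weak_gradient U h g"
  unfolding is_weak_gradient_def
proof (intro conjI allI impI ballI)
  show "locally_integrable_on h U" "locally_integrable_on g U"
    unfolding locally_integrable_on_def set_integrable_def
    by (intro allI impI borel_integrable_compact continuous_on_subset[OF h] continuous_on_subset[OF g]; simp)+
  fix \<phi> :: "'a \<Rightarrow> real" and i :: 'a assume tf: "test_fun U \<phi>" and i: "i \<in> Basis"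
  define S where "S = closure {x. \<phi> x \<noteq> 0}"
  note T = test_funD[OF tf, folded S_def]
  let ?d = "\<lambda>x. frechet_derivative \<phi> (at x) i"
  define F where "F x = h x * \<phi> x" for x
  define F1 where "F1 x = h x * ?d x" for x
  define F2 where "F2 x = (g x \<bullet> i) * \<phi> x" for x
  have cover: "UNIV = \<Union>{U, - S}" and op: "open (- S)" using T(2) by (auto simp: S_def)
  have cont: "continuous_on UNIV f" if "continuous_on U f" "\<And>x. x \<notin> S \<Longrightarrow> f x = 0" for f :: "'a \<Rightarrow> real"
    unfolding cover
  proof (rule continuous_on_open_Union)
    show "continuous_on s f" if s: "s \<in> {U, - S}" for s
    proof (cases "s = U")
      case False
      then have "s = - S" using s by simp
      then show ?thesis using \<open>\<And>x. x \<notin> S \<Longrightarrow> f x = 0\<close>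
        by (subst continuous_on_cong[OF refl, of _ _ "\<lambda>_. 0"]) auto
    qed (use \<open>continuous_on U f\<close> in simp)
  qed (use U op in auto)
  have c: "continuous_on UNIV F" "continuous_on UNIV F1" "continuous_on UNIV F2"
    unfolding F_def F1_def F2_def
    by (intro cont continuous_intros h g continuous_on_subset[OF T(3)] continuous_on_subset[OF T(5)[OF i]]; use T in simp)+
  have intg: "integrable lborel f" if "continuous_on UNIV f" "\<And>x. x \<notin> S \<Longrightarrow> f x = 0" for f :: "'a \<Rightarrow> real"
  proof -
    have "integrable lborel (\<lambda>x. indicator S x *\<^sub>R f x)" by (rule borel_integrable_compact[OF T(1) continuous_on_subset[OF that(1)]]) simp
    moreover have "(\<lambda>x. indicator S x *\<^sub>R f x) = f" using that(2) by (auto simp: indicator_def fun_eq_iff)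
    ultimately show ?thesis by simp
  qed
  have z: "F1 x = 0" "F2 x = 0" if "x \<notin> S" for x using T that by (auto simp: F1_def F2_def)
  have "(\<integral>x. F1 x + F2 x \<partial>lborel) = 0"
  proof (rule integral_partial_derivative_0[OF i T(1) _ c(1)])
    show "continuous_on UNIV (\<lambda>x. F1 x + F2 x)" by (intro continuous_intros c)
    show "F x = 0" if "x \<notin> S" for x using T that by (simp add: F_def)
    show "((\<lambda>t. F (x + t *\<^sub>R i)) has_real_derivative F1 x + F2 x) (at 0)" for x
    proof (cases "x \<in> U")
      case True
      show ?thesis unfolding F_def F1_def F2_def
        by (rule derivative_eq_intros der[OF True i] T(6)[OF i] refl)+ (simp add: algebra_simps)
    next
      case False
      then have x: "x \<in> - S" using T by auto
      then obtain r where r: "r > 0" "ball x r \<subseteq> - S" using op by (auto simp: open_contains_ball)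
      have ev: "\<forall>\<^sub>F t in nhds (0::real). F (x + t *\<^sub>R i) = 0"
        unfolding eventually_nhds_metric
      proof (intro exI[of _ r] conjI allI impI)
        fix t :: real assume "dist t 0 < r"
        then have "x + t *\<^sub>R i \<in> ball x r" using i by (simp add: dist_norm)
        then show "F (x + t *\<^sub>R i) = 0" using r T(4) by (auto simp: F_def)
      qed (rule r)
      have "((\<lambda>t. F (x + t *\<^sub>R i)) has_real_derivative 0) (at 0)"
        by (rule DERIV_cong_ev[OF refl ev refl, THEN iffD2]) simp
      then show ?thesis using z x by simp
    qed
  qed
  moreover have "integrable lborel F1" "integrable lborel F2" using intg c z by auto
  ultimately have "(\<integral>x. F1 x \<partial>lborel) = - (\<integral>x. F2 x \<partial>lborel)" by simp
  moreover have "(LINT x:U|lborel. h x * ?d x) = (\<integral>x. F1 x \<partial>lborel)"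
    unfolding set_lebesgue_integral_def using T(2) z
    by (intro Bochner_Integration.integral_cong) (auto simp: F1_def indicator_def)
  moreover have "(LINT x:U|lborel. (g x \<bullet> i) * \<phi> x) = (\<integral>x. F2 x \<partial>lborel)"
    unfolding set_lebesgue_integral_def using T(2) z
    by (intro Bochner_Integration.integral_cong) (auto simp: F2_def indicator_def)
  ultimately show "(LINT x:U|lborel. h x * ?d x) = - (LINT x:U|lborel. (g x \<bullet> i) * \<phi> x)" by simp
qed auto

section \<open>Mean displacement and entropy\<close>

text \<open>The Gaussian with mean \<open>a\<close> and covariance \<open>\<epsilon>/2\<close>, a product of one-dimensional normal densities.\<close>

lemma gaussian_density:
  fixes a :: "'a::euclidean_space" and \<epsilon> :: real
  assumes eps: "\<epsilon> > 0"
  defines "q \<equiv> \<lambda>y. exp (- (norm (y - a))\<^sup>2 / \<epsilon> - real DIM('a) / 2 * ln (pi * \<epsilon>))"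
  shows "(\<integral>\<^sup>+y. ennreal (q y) \<partial>lborel) = 1"
proof -
  define \<sigma> where "\<sigma> = sqrt (\<epsilon> / 2)"
  have \<sigma>: "\<sigma> > 0" "2 * \<sigma>\<^sup>2 = \<epsilon>" using eps by (auto simp: \<sigma>_def)
  have nd: "normal_density m \<sigma> x = exp (- (x - m)\<^sup>2 / \<epsilon> - ln (pi * \<epsilon>) / 2)" for m x
  proof -
    have "sqrt (2 * pi * \<sigma>\<^sup>2) = exp (ln (pi * \<epsilon>) / 2)"
      using eps \<sigma> by (simp add: mult.commute mult.left_commute ln_sqrt[symmetric])
    then show ?thesis using \<sigma> by (simp add: normal_density_def exp_diff)
  qed
  have "q y = (\<Prod>b\<in>Basis. normal_density (a \<bullet> b) \<sigma> (y \<bullet> b))" for y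
  proof -
    have "(norm (y - a))\<^sup>2 = (\<Sum>b\<in>Basis. (y \<bullet> b - a \<bullet> b)\<^sup>2)"
      unfolding norm_eq_sqrt_inner euclidean_inner[of "y - a" "y - a"]
      by (simp add: inner_diff_left power2_eq_square sum_nonneg)
    then have "- (norm (y - a))\<^sup>2 / \<epsilon> - real DIM('a) / 2 * ln (pi * \<epsilon>) = (\<Sum>b\<in>Basis. - (y \<bullet> b - a \<bullet> b)\<^sup>2 / \<epsilon> - ln (pi * \<epsilon>) / 2)"
      by (simp add: sum_subtractf sum_divide_distrib sum_negf)
    then show ?thesis unfolding q_def nd by (simp add: exp_sum)
  qed
  then have "(\<integral>\<^sup>+y. ennreal (q y) \<partial>lborel) = (\<integral>\<^sup>+y. (\<Prod>b\<in>Basis. ennreal (normal_density (a \<bullet> b) \<sigma> (y \<bullet> b))) \<partial>lborel)"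
    by (simp add: prod_ennreal)
  also have "\<dots> = (\<Prod>b\<in>Basis. \<integral>\<^sup>+x. ennreal (normal_density (a \<bullet> b) \<sigma> x) \<partial>lborel)"
    by (rule nn_integral_lborel_prod) auto
  also have "\<dots> = (\<Prod>b\<in>(Basis::'a set). 1)"
  proof (rule prod.cong[OF refl])
    fix b
    interpret N: prob_space "density lborel (normal_density (a \<bullet> b) \<sigma>)" by (rule prob_space_normal_density[OF \<sigma>(1)])
    show "(\<integral>\<^sup>+x. ennreal (normal_density (a \<bullet> b) \<sigma> x) \<partial>lborel) = 1"
      using N.emeasure_space_1 by (simp add: emeasure_density)
  qed
  finally show ?thesis by simp
qed

text \<open>Let \<open>m\<close> be the mean of \<open>x - y\<close> under \<open>p \<nu>\<close>. The relative entropy of \<open>p \<nu>\<close> with respect to the Gaussian of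
variance \<open>\<epsilon>/2\<close> centred at \<open>x - m\<close> is nonnegative. Moving the centre to \<open>x\<close> costs exactly \<open>|m|\<^sup>2 / \<epsilon>\<close>, and the
Gaussian exponent at \<open>x\<close> cancels the transport cost in \<open>ln p\<close>. This is the transport--entropy inequality
for the Gaussian, restricted to means.\<close>

lemma squared_mean_le_entropy:
  fixes \<nu> :: "'a::euclidean_space measure"
  assumes "prob_space \<nu>" and [measurable_cong]: "sets \<nu> = sets borel" and eps: "\<epsilon> > 0"
    and nu: "\<nu> = density lborel (\<lambda>y. ennreal (n y))" and nm[measurable]: "n \<in> borel_measurable borel" and n0: "\<And>y. 0 \<le> n y"
    and [measurable]: "p \<in> borel_measurable borel" "f \<in> borel_measurable borel"
    and p0: "\<And>y. 0 < p y" and lnp: "\<And>y. ln (p y) = f y - (norm (x - y))\<^sup>2 / \<epsilon>"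
    and pint: "integrable \<nu> p" and p1: "(\<integral>y. p y \<partial>\<nu>) = 1"
    and sq: "integrable \<nu> (\<lambda>y. p y * (norm (x - y))\<^sup>2)"
    and ent: "integrable \<nu> (\<lambda>y. p y * (f y + ln (n y)))"
  shows "integrable \<nu> (\<lambda>y. p y *\<^sub>R (x - y))"
    "(norm (\<integral>y. p y *\<^sub>R (x - y) \<partial>\<nu>))\<^sup>2 / \<epsilon> \<le> (\<integral>y. p y * (f y + ln (n y)) \<partial>\<nu>) + real DIM('a) / 2 * ln (pi * \<epsilon>)"
proof -
  interpret prob_space \<nu> by fact
  show mi: "integrable \<nu> (\<lambda>y. p y *\<^sub>R (x - y))"
  proof (rule Bochner_Integration.integrable_bound)
    show "integrable \<nu> (\<lambda>y. p y + p y * (norm (x - y))\<^sup>2)" using pint sq by auto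
    show "AE y in \<nu>. norm (p y *\<^sub>R (x - y)) \<le> norm (p y + p y * (norm (x - y))\<^sup>2)"
    proof (rule AE_I2)
      fix y
      have "norm (x - y) \<le> 1 + (norm (x - y))\<^sup>2"
      proof -
        have "2 * norm (x - y) \<le> (norm (x - y))\<^sup>2 + 1"
          using zero_le_power2[of "norm (x - y) - 1"] by (simp add: power2_diff)
        then show ?thesis using norm_ge_zero[of "x - y"] by linarith
      qed
      then have "p y * norm (x - y) \<le> p y * (1 + (norm (x - y))\<^sup>2)" using p0[of y] by (intro mult_left_mono) auto
      then show "norm (p y *\<^sub>R (x - y)) \<le> norm (p y + p y * (norm (x - y))\<^sup>2)"
        using p0[of y] by (simp add: distrib_left)
    qed
  qed measurable
  define m where "m = (\<integral>y. p y *\<^sub>R (x - y) \<partial>\<nu>)"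
  define c where "c = real DIM('a) / 2 * ln (pi * \<epsilon>)"
  define q where "q y = exp (- (norm (y - (x - m)))\<^sup>2 / \<epsilon> - c)" for y
  have [measurable]: "q \<in> borel_measurable borel" unfolding q_def[abs_def] by measurable
  have q1: "(\<integral>\<^sup>+y. ennreal (q y) \<partial>lborel) = 1"
    unfolding q_def c_def by (rule gaussian_density[OF eps])
  have qn: "(\<integral>\<^sup>+y. ennreal (q y / n y) \<partial>\<nu>) \<le> 1"
  proof -
    have "(\<integral>\<^sup>+y. ennreal (q y / n y) \<partial>\<nu>) = (\<integral>\<^sup>+y. ennreal (n y) * ennreal (q y / n y) \<partial>lborel)"
      unfolding nu by (rule nn_integral_density) auto
    also have "\<dots> \<le> (\<integral>\<^sup>+y. ennreal (q y) \<partial>lborel)"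
    proof (rule nn_integral_mono)
      fix y
      show "ennreal (n y) * ennreal (q y / n y) \<le> ennreal (q y)"
        using n0[of y] by (cases "n y = 0") (auto simp: ennreal_mult[symmetric] q_def)
    qed
    finally show ?thesis using q1 by simp
  qed
  have qi: "integrable \<nu> (\<lambda>y. q y / n y)"
    using qn n0 by (intro integrableI_nonneg) (auto simp: q_def intro: le_less_trans)
  have qle: "(\<integral>y. q y / n y \<partial>\<nu>) \<le> 1"
  proof -
    have "ennreal (\<integral>y. q y / n y \<partial>\<nu>) \<le> ennreal 1"
      using qn nn_integral_eq_integral[OF qi] n0 by (simp add: q_def)
    then show ?thesis by (subst (asm) ennreal_le_iff) auto
  qed
  have npos: "AE y in \<nu>. 0 < n y"
    unfolding nu by (subst AE_density) auto
  \<comment> \<open>\<open>?G\<close> is \<open>p\<close> times the logarithm of the density of \<open>p \<nu>\<close> relative to the shifted Gaussian.\<close>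
  let ?G = "\<lambda>y. p y * (f y + ln (n y)) + ((-2 / \<epsilon>) * ((p y *\<^sub>R (x - y)) \<bullet> m) + ((norm m)\<^sup>2 / \<epsilon> + c) * p y)"
  have ge: "AE y in \<nu>. p y - q y / n y \<le> ?G y"
    using npos
  proof eventually_elim
    case (elim y)
    have r: "0 < p y * n y" "0 < q y" using p0[of y] elim by (auto simp: q_def)
    have nrm: "(norm (y - (x - m)))\<^sup>2 = (norm (x - y))\<^sup>2 - 2 * ((x - y) \<bullet> m) + (norm m)\<^sup>2"
      unfolding power2_norm_eq_inner by (simp add: inner_diff_left inner_diff_right inner_commute algebra_simps)
    have "ln (q y / (p y * n y)) \<le> q y / (p y * n y) - 1" using r by (intro ln_le_minus_one) simp
    then have "p y * ln (q y / (p y * n y)) \<le> p y * (q y / (p y * n y) - 1)" using p0[of y] by (intro mult_left_mono) auto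
    also have "\<dots> = q y / n y - p y" using p0[of y] elim by (simp add: right_diff_distrib)
    finally have "p y - q y / n y \<le> - (p y * ln (q y / (p y * n y)))" by simp
    also have "ln (q y / (p y * n y)) = ln (q y) - (ln (p y) + ln (n y))"
      using r p0[of y] elim by (simp add: ln_div ln_mult)
    also have "ln (q y) = - (norm (y - (x - m)))\<^sup>2 / \<epsilon> - c" by (simp add: q_def)
    finally have "p y - q y / n y \<le> - (p y * (- (norm (y - (x - m)))\<^sup>2 / \<epsilon> - c - (f y - (norm (x - y))\<^sup>2 / \<epsilon> + ln (n y))))"
      by (simp only: lnp)
    also have "\<dots> = ?G y" unfolding nrm
      by (simp add: algebra_simps add_divide_distrib diff_divide_distrib)
    finally show ?case .
  qed
  have inner: "integrable \<nu> (\<lambda>y. (p y *\<^sub>R (x - y)) \<bullet> m)" "(\<integral>y. (p y *\<^sub>R (x - y)) \<bullet> m \<partial>\<nu>) = (norm m)\<^sup>2"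
  proof -
    show "integrable \<nu> (\<lambda>y. (p y *\<^sub>R (x - y)) \<bullet> m)" by (rule integrable_inner_left) (rule mi)
    show "(\<integral>y. (p y *\<^sub>R (x - y)) \<bullet> m \<partial>\<nu>) = (norm m)\<^sup>2"
      using integral_inner_left[of m, OF mi] unfolding m_def[symmetric] by (simp only: power2_norm_eq_inner)
  qed
  have "(\<integral>y. p y - q y / n y \<partial>\<nu>) \<le> (\<integral>y. ?G y \<partial>\<nu>)"
  proof (rule integral_mono_AE[OF _ _ ge])
    show "integrable \<nu> (\<lambda>y. p y - q y / n y)" using pint qi by auto
    show "integrable \<nu> ?G"
      by (intro Bochner_Integration.integrable_add integrable_mult_right ent inner pint)
  qed
  also have "(\<integral>y. p y - q y / n y \<partial>\<nu>) = 1 - (\<integral>y. q y / n y \<partial>\<nu>)" using pint qi p1 by simp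
  also have "(\<integral>y. ?G y \<partial>\<nu>) = (\<integral>y. p y * (f y + ln (n y)) \<partial>\<nu>) + ((-2 / \<epsilon>) * (norm m)\<^sup>2 + ((norm m)\<^sup>2 / \<epsilon> + c) * 1)"
    by (subst Bochner_Integration.integral_add Bochner_Integration.integral_mult_right, (intro Bochner_Integration.integrable_add integrable_mult_right ent inner pint)+)+
      (simp only: inner(2) p1)
  finally show "(norm (\<integral>y. p y *\<^sub>R (x - y) \<partial>\<nu>))\<^sup>2 / \<epsilon> \<le> (\<integral>y. p y * (f y + ln (n y)) \<partial>\<nu>) + real DIM('a) / 2 * ln (pi * \<epsilon>)"
    using qle unfolding m_def[symmetric] c_def[symmetric] by simp
qed

section \<open>Clipping\<close>

text \<open>A bounded, odd, increasing, 1-Lipschitz and smooth approximation of the identity. Smoothness keeps the chain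
rule classical; oddness and the Lipschitz bound give \<open>soft_clip_add_le\<close>.\<close>

definition soft_clip :: "real \<Rightarrow> real \<Rightarrow> real" where "soft_clip k t = k * arctan (t / k)"

lemma soft_clip_meas [measurable]: "soft_clip k \<in> borel_measurable borel"
  unfolding soft_clip_def[abs_def] by measurable

lemma soft_clip_bounded: "k > 0 \<Longrightarrow> \<bar>soft_clip k t\<bar> \<le> k * (pi / 2)"
proof -
  assume k: "k > 0"
  have "\<bar>arctan (t / k)\<bar> \<le> pi / 2" using arctan_bounded[of "t / k"] by linarith
  then show ?thesis using k mult_left_mono[of "\<bar>arctan (t / k)\<bar>" "pi / 2" k] by (simp add: soft_clip_def abs_mult)
qed

lemma soft_clip_derivative:
  "k > 0 \<Longrightarrow> (soft_clip k has_real_derivative 1 / (1 + (t / k)\<^sup>2)) (at t)"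
  unfolding soft_clip_def[abs_def] by (auto intro!: derivative_eq_intros simp: power2_eq_square field_simps)

lemma soft_clip_0 [simp]: "soft_clip k 0 = 0" by (simp add: soft_clip_def)

lemma soft_clip_minus [simp]: "soft_clip k (- t) = - soft_clip k t" by (simp add: soft_clip_def arctan_minus)

lemma soft_clip_mono: "k > 0 \<Longrightarrow> s \<le> t \<Longrightarrow> soft_clip k s \<le> soft_clip k t"
  by (simp add: soft_clip_def arctan_le_iff divide_right_mono)

lemma soft_clip_nonexpansive:
  assumes k: "k > 0" and st: "s \<le> t"
  shows "soft_clip k t - soft_clip k s \<le> t - s"
proof -
  have "s - soft_clip k s \<le> t - soft_clip k t"
  proof (rule DERIV_nonneg_imp_nondecreasing[OF st])
    fix x
    have "0 < 1 + (x / k)\<^sup>2" by (rule add_pos_nonneg) auto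
    then have "1 / (1 + (x / k)\<^sup>2) \<le> 1" by (subst divide_le_eq_1_pos) auto
    moreover have "((\<lambda>x. x - soft_clip k x) has_real_derivative 1 - 1 / (1 + (x / k)\<^sup>2)) (at x)"
      by (intro DERIV_diff DERIV_ident soft_clip_derivative k)
    ultimately show "\<exists>y. ((\<lambda>x. x - soft_clip k x) has_real_derivative y) (at x) \<and> 0 \<le> y" by force
  qed
  then show ?thesis by simp
qed

text \<open>Clipping two numbers separately does not push their sum beyond \<open>max 0 (a + b)\<close>, although the sum of the clipped
numbers may exceed \<open>a + b\<close>. This dominates the clipped Gibbs densities.\<close>

lemma soft_clip_add_le:
  assumes k: "k > 0" shows "soft_clip k a + soft_clip k b \<le> max 0 (a + b)"
proof (cases "a \<le> - b")
  case True
  from soft_clip_mono[OF k this] show ?thesis by simp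
next
  case False
  then have "soft_clip k a - soft_clip k (- b) \<le> a - (- b)" by (intro soft_clip_nonexpansive[OF k]) simp
  then show ?thesis by simp
qed

lemma soft_clip_abs_le: "k > 0 \<Longrightarrow> \<bar>soft_clip k t\<bar> \<le> \<bar>t\<bar>"
  using soft_clip_add_le[of k t 0] soft_clip_add_le[of k "- t" 0] by (simp add: abs_le_iff) linarith

lemma soft_clip_tendsto: "(\<lambda>n. soft_clip (real (Suc n)) t) \<longlonglongrightarrow> t"
proof (cases "t = 0")
  case False
  have "(arctan has_real_derivative inverse (1 + 0\<^sup>2)) (at (0::real))" by (rule DERIV_arctan)
  then have A: "(\<lambda>h. arctan h / h) \<midarrow>0\<rightarrow> 1" by (simp add: DERIV_def)
  have "(\<lambda>n. t * inverse (real (Suc n))) \<longlonglongrightarrow> t * 0" by (intro tendsto_intros LIMSEQ_inverse_real_of_nat)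
  then have "(\<lambda>n. t / real (Suc n)) \<longlonglongrightarrow> 0" by (simp add: divide_inverse)
  then have "(\<lambda>n. arctan (t / real (Suc n)) / (t / real (Suc n))) \<longlonglongrightarrow> 1"
    using A[unfolded LIMSEQ_SEQ_conv[symmetric], rule_format, of "\<lambda>n. t / real (Suc n)"] False by auto
  then have "(\<lambda>n. t * (arctan (t / real (Suc n)) / (t / real (Suc n)))) \<longlonglongrightarrow> t * 1" by (intro tendsto_intros)
  moreover have "t * (arctan (t / real (Suc n)) / (t / real (Suc n))) = soft_clip (real (Suc n)) t" for n
    using False by (simp add: soft_clip_def)
  ultimately show ?thesis by simp
qed simp

lemma soft_clip_integral_tendsto:
  assumes f: "integrable M f"
  shows "(\<lambda>n. \<integral>x. soft_clip (real (Suc n)) (f x) \<partial>M) \<longlonglongrightarrow> (\<integral>x. f x \<partial>M)"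
proof (rule integral_dominated_convergence[where w="\<lambda>x. \<bar>f x\<bar>"])
  have [measurable]: "f \<in> borel_measurable M" using f by simp
  show "f \<in> borel_measurable M" by measurable
  show "(\<lambda>x. soft_clip (real (Suc n)) (f x)) \<in> borel_measurable M" for n by measurable
  show "integrable M (\<lambda>x. \<bar>f x\<bar>)" using f by simp
  show "AE x in M. (\<lambda>n. soft_clip (real (Suc n)) (f x)) \<longlonglongrightarrow> f x" by (rule AE_I2) (rule soft_clip_tendsto)
  show "AE x in M. norm (soft_clip (real (Suc n)) (f x)) \<le> \<bar>f x\<bar>" for n
    by (rule AE_I2) (simp add: soft_clip_abs_le del: of_nat_Suc)
qed

section \<open>Gradient of a potential and the dual Sobolev norm\<close>

lemma norm2_diff_expand: "(norm (x - y))\<^sup>2 = (norm x)\<^sup>2 + (norm y)\<^sup>2 - 2 * (x \<bullet> (y::'a::real_inner))"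
  unfolding power2_norm_eq_inner by (simp add: inner_diff_left inner_diff_right inner_commute)

context eot_problem
begin

definition weight :: "('a \<Rightarrow> real) \<Rightarrow> 'a \<Rightarrow> real" where
  "weight \<psi> y = exp ((\<psi> y - (norm y)\<^sup>2) / \<epsilon>)"

lemma laplace_weight:
  assumes [measurable]: "\<psi> \<in> borel_measurable borel"
  shows "laplace_transform \<nu> (weight \<psi>) (2 / \<epsilon>)"
proof
  show "weight \<psi> \<in> borel_measurable borel" unfolding weight_def[abs_def] by measurable
qed (use eps in \<open>auto simp: weight_def\<close>)

lemma section_mass:
  assumes Z: "plan_density Z"
  shows "AE x in \<mu>. (\<integral>\<^sup>+y. ennreal (Z (x, y)) \<partial>\<nu>) = 1"
proof -
  note [measurable] = plan_density_meas[OF Z]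
  have [measurable]: "(\<lambda>x. \<integral>\<^sup>+y. ennreal (Z (x, y)) \<partial>\<nu>) \<in> borel_measurable borel" by measurable
  have "density \<mu> (\<lambda>x. \<integral>\<^sup>+y. ennreal (Z (x, y)) \<partial>\<nu>) = density \<mu> (\<lambda>_. 1)"
  proof (rule measure_eqI)
    fix A assume "A \<in> sets (density \<mu> (\<lambda>x. \<integral>\<^sup>+y. ennreal (Z (x, y)) \<partial>\<nu>))"
    then have A[measurable]: "A \<in> sets borel" by simp
    have "(\<integral>\<^sup>+x. (\<integral>\<^sup>+y. ennreal (Z (x, y)) \<partial>\<nu>) * indicator A x \<partial>\<mu>) = (\<integral>\<^sup>+x. \<integral>\<^sup>+y. ennreal (Z (x, y)) * indicator A (fst (x, y)) \<partial>\<nu> \<partial>\<mu>)"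
      by (intro nn_integral_cong) (simp add: nn_integral_multc)
    also have "\<dots> = (\<integral>\<^sup>+z. ennreal (Z z) * indicator A (fst z) \<partial>P)"
      by (rule nu.nn_integral_fst) measurable
    also have "\<dots> = emeasure \<mu> A" using plan_density_iff[of Z] Z plan_density_nonneg[OF Z] A by auto
    finally show "emeasure (density \<mu> (\<lambda>x. \<integral>\<^sup>+y. ennreal (Z (x, y)) \<partial>\<nu>)) A = emeasure (density \<mu> (\<lambda>_. 1)) A"
      by (simp add: emeasure_density)
  qed simp
  from mu.density_unique[OF _ _ this] show ?thesis by simp
qed

lemma cost_plan_integrable:
  assumes pd: "plan_density Z" and fin: "excess Z < \<infinity>"
  shows "integrable P (\<lambda>z. Z z * cost z)"
proof -
  note [measurable] = plan_density_meas[OF pd]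
  note nn = plan_density_nonneg[OF pd]
  have "excess Z + 1 < \<infinity>" using fin by simp
  then have "ennreal (1 / \<epsilon>) * (\<integral>\<^sup>+z. ennreal (cost z) \<partial>density P (\<lambda>z. ennreal (Z z))) < \<infinity>"
    unfolding excess_plus_one[OF pd] by (simp add: ennreal_add_less_top)
  then have "(\<integral>\<^sup>+z. ennreal (cost z) \<partial>density P (\<lambda>z. ennreal (Z z))) < \<infinity>"
    using eps by (auto simp: ennreal_mult_less_top)
  then have "(\<integral>\<^sup>+z. ennreal (Z z * cost z) \<partial>P) < \<infinity>"
    using nn by (simp add: nn_integral_density ennreal_mult)
  then show ?thesis using nn by (intro integrableI_nonneg) auto
qed

text \<open>The marginal constraint determines \<open>\<phi>\<close> from \<open>\<psi>\<close> through the Laplace transform of \<open>weight \<psi>\<close>. On its domain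
\<open>dual_mean \<psi> x\<close> is the mean of the conditional law of \<open>y\<close> given \<open>x\<close>.\<close>

definition dual_domain :: "('a \<Rightarrow> real) \<Rightarrow> 'a set" where
  "dual_domain \<psi> = laplace_transform.dom \<nu> (weight \<psi>) (2 / \<epsilon>)"

definition dual_mean :: "('a \<Rightarrow> real) \<Rightarrow> 'a \<Rightarrow> 'a" where
  "dual_mean \<psi> x = laplace_transform.moment \<nu> (weight \<psi>) (2 / \<epsilon>) x /\<^sub>R laplace_transform.mass \<nu> (weight \<psi>) (2 / \<epsilon>) x"

definition dual_potential :: "('a \<Rightarrow> real) \<Rightarrow> 'a \<Rightarrow> real" where
  "dual_potential \<psi> x = (norm x)\<^sup>2 - \<epsilon> * ln (laplace_transform.mass \<nu> (weight \<psi>) (2 / \<epsilon>) x)"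

text \<open>The logarithmic derivative of the Laplace transform is the tilted mean, which gives the gradient
\<open>2 (x - dual_mean \<psi> x)\<close>.\<close>

lemma dual_potential_smooth:
  assumes [measurable]: "\<psi> \<in> borel_measurable borel"
  shows "convex (dual_domain \<psi>)"
    "dual_potential \<psi> \<in> borel_measurable borel" "dual_mean \<psi> \<in> borel_measurable borel"
    "continuous_on (interior (dual_domain \<psi>)) (dual_potential \<psi>)"
    "continuous_on (interior (dual_domain \<psi>)) (dual_mean \<psi>)"
    "\<And>x i. x \<in> interior (dual_domain \<psi>) \<Longrightarrow> i \<in> Basis \<Longrightarrow>
      ((\<lambda>t. dual_potential \<psi> (x + t *\<^sub>R i)) has_real_derivative (2 *\<^sub>R (x - dual_mean \<psi> x)) \<bullet> i) (at 0)"
proof -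
  interpret L: laplace_transform \<nu> "weight \<psi>" "2 / \<epsilon>" by (rule laplace_weight) measurable
  show "convex (dual_domain \<psi>)" unfolding dual_domain_def by (rule L.convex_dom)
  show "dual_potential \<psi> \<in> borel_measurable borel" "dual_mean \<psi> \<in> borel_measurable borel"
    unfolding dual_potential_def[abs_def] dual_mean_def[abs_def] by measurable
  have pos: "L.mass x > 0" if "x \<in> interior (dual_domain \<psi>)" for x
    using that interior_subset[of "L.dom"] L.mass_pos[of x] by (auto simp: dual_domain_def)
  show "continuous_on (interior (dual_domain \<psi>)) (dual_potential \<psi>)"
    unfolding dual_potential_def[abs_def] using pos
    by (intro continuous_intros L.continuous_mass_moment(1)[folded dual_domain_def]) (auto simp: less_imp_neq[symmetric])
  show "continuous_on (interior (dual_domain \<psi>)) (dual_mean \<psi>)"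
    unfolding dual_mean_def[abs_def] using pos
    by (intro continuous_intros L.continuous_mass_moment[folded dual_domain_def]) (auto simp: less_imp_neq[symmetric])
  fix x i :: 'a assume x: "x \<in> interior (dual_domain \<psi>)" and i: "i \<in> Basis"
  have D: "((\<lambda>t. L.mass (x + t *\<^sub>R i)) has_real_derivative (2 / \<epsilon>) * (L.moment x \<bullet> i)) (at 0)"
    using x by (intro L.mass_derivative i) (simp add: dual_domain_def)
  have N: "((\<lambda>t. (norm (x + t *\<^sub>R i))\<^sup>2) has_real_derivative 2 * (x \<bullet> i)) (at 0)"
  proof -
    have "(norm (x + t *\<^sub>R i))\<^sup>2 = (norm x)\<^sup>2 + 2 * t * (x \<bullet> i) + t\<^sup>2 * (i \<bullet> i)" for t
      unfolding power2_norm_eq_inner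
      by (simp add: inner_add_left inner_add_right inner_commute power2_eq_square algebra_simps)
    then show ?thesis by (auto intro!: derivative_eq_intros)
  qed
  have "((\<lambda>t. ln (L.mass (x + t *\<^sub>R i))) has_real_derivative inverse (L.mass x) * ((2 / \<epsilon>) * (L.moment x \<bullet> i))) (at 0)"
  proof -
    have "((\<lambda>t. ln (L.mass (x + t *\<^sub>R i))) has_real_derivative (1 / L.mass (x + 0 *\<^sub>R i)) * ((2 / \<epsilon>) * (L.moment x \<bullet> i))) (at 0)"
      by (rule DERIV_chain2[OF _ D]) (use pos[OF x] in \<open>auto intro!: DERIV_ln_divide\<close>)
    then show ?thesis by (simp add: inverse_eq_divide)
  qed
  from DERIV_diff[OF N DERIV_cmult[OF this, of \<epsilon>]]
  have "((\<lambda>t. dual_potential \<psi> (x + t *\<^sub>R i)) has_real_derivative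
      2 * (x \<bullet> i) - \<epsilon> * (inverse (L.mass x) * ((2 / \<epsilon>) * (L.moment x \<bullet> i)))) (at 0)"
    unfolding dual_potential_def .
  moreover have "2 * (x \<bullet> i) - \<epsilon> * (inverse (L.mass x) * ((2 / \<epsilon>) * (L.moment x \<bullet> i))) = (2 *\<^sub>R (x - dual_mean \<psi> x)) \<bullet> i"
    using eps by (simp add: dual_mean_def inner_diff_left right_diff_distrib)
  ultimately show "((\<lambda>t. dual_potential \<psi> (x + t *\<^sub>R i)) has_real_derivative (2 *\<^sub>R (x - dual_mean \<psi> x)) \<bullet> i) (at 0)"
    by simp
qed

lemma gibbs_density_tilt:
  "gibbs_density \<phi> \<psi> (x, y) = exp ((\<phi> x - (norm x)\<^sup>2) / \<epsilon>) * (weight \<psi> y * exp (2 / \<epsilon> * (x \<bullet> y)))"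
  unfolding gibbs_density_def cost_def weight_def exp_add[symmetric] fst_conv snd_conv norm2_diff_expand
  by (rule arg_cong[where f=exp]) (simp add: algebra_simps add_divide_distrib diff_divide_distrib)

lemma gibbs_section:
  assumes [measurable]: "\<phi> \<in> borel_measurable borel" "\<psi> \<in> borel_measurable borel"
    and pd: "plan_density (gibbs_density \<phi> \<psi>)"
  shows "AE x in \<mu>. x \<in> dual_domain \<psi> \<and> \<phi> x = dual_potential \<psi> x \<and>
    integrable \<nu> (\<lambda>y. gibbs_density \<phi> \<psi> (x, y)) \<and> (\<integral>y. gibbs_density \<phi> \<psi> (x, y) \<partial>\<nu>) = 1 \<and>
    dual_mean \<psi> x = (\<integral>y. gibbs_density \<phi> \<psi> (x, y) *\<^sub>R y \<partial>\<nu>)"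
proof -
  interpret L: laplace_transform \<nu> "weight \<psi>" "2 / \<epsilon>" by (rule laplace_weight) measurable
  show ?thesis using section_mass[OF pd]
  proof eventually_elim
    case (elim x)
    define e where "e = exp ((\<phi> x - (norm x)\<^sup>2) / \<epsilon>)"
    have e0: "e > 0" by (simp add: e_def)
    have ge: "gibbs_density \<phi> \<psi> (x, y) = e * L.tilt x y" for y
      by (simp add: gibbs_density_tilt L.tilt_def e_def)
    have [measurable]: "(\<lambda>y. gibbs_density \<phi> \<psi> (x, y)) \<in> borel_measurable borel"
      unfolding ge by measurable
    have i: "integrable \<nu> (\<lambda>y. gibbs_density \<phi> \<psi> (x, y))"
      by (rule integrableI_nonneg) (use elim in \<open>auto simp: less_imp_le\<close>)
    have one: "(\<integral>y. gibbs_density \<phi> \<psi> (x, y) \<partial>\<nu>) = 1"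
      using elim by (subst integral_eq_nn_integral) (auto simp: less_imp_le)
    have "integrable \<nu> (\<lambda>y. inverse e * (e * L.tilt x y))" using i unfolding ge by (rule integrable_mult_right)
    then have dom: "x \<in> L.dom" using e0 by (simp add: L.dom_def)
    have em: "e * L.mass x = 1" using one unfolding ge L.mass_def by simp
    then have mass: "L.mass x = inverse e" using e0 by (simp add: field_simps)
    have "ln (L.mass x) = - ((\<phi> x - (norm x)\<^sup>2) / \<epsilon>)" unfolding mass e_def by (simp add: exp_minus[symmetric])
    then have "\<phi> x = dual_potential \<psi> x" using eps by (simp add: dual_potential_def)
    moreover have "dual_mean \<psi> x = (\<integral>y. gibbs_density \<phi> \<psi> (x, y) *\<^sub>R y \<partial>\<nu>)"
      unfolding dual_mean_def mass ge L.moment_def by (simp flip: scaleR_scaleR)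
    ultimately show ?case using dom i one by (simp add: dual_domain_def)
  qed
qed

lemma excess_gibbs_density_finite:
  assumes "integrable \<mu> \<phi>" "integrable \<nu> \<psi>" "plan_density (gibbs_density \<phi> \<psi>)"
  shows "excess (gibbs_density \<phi> \<psi>) < \<infinity>"
proof (rule ccontr)
  assume "\<not> excess (gibbs_density \<phi> \<psi>) < \<infinity>"
  then have "enn2ereal (excess (gibbs_density \<phi> \<psi>)) = \<infinity>" by (simp add: top.not_eq_extremum[symmetric])
  then show False using excess_gibbs_density[OF assms] eps by simp
qed

text \<open>Makes the estimates for \<open>\<phi>\<close> available for \<open>\<psi>\<close> by exchanging the roles of the marginals.\<close>

lemma swapped_plan_density:
  assumes [measurable]: "\<phi> \<in> borel_measurable borel" "\<psi> \<in> borel_measurable borel"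
    and pd: "plan_density (gibbs_density \<phi> \<psi>)"
  shows "eot_problem.plan_density \<nu> \<mu> (gibbs_density \<psi> \<phi>)"
proof -
  interpret S: eot_problem \<nu> \<mu> \<epsilon> by standard (rule eps nu_P2 mu_P2)+
  have sym: "gibbs_density \<psi> \<phi> (snd z, fst z) = gibbs_density \<phi> \<psi> z" for z
    by (simp add: gibbs_density_def cost_def norm_minus_commute add.commute)
  have sw: "(\<integral>\<^sup>+z. F z \<partial>S.P) = (\<integral>\<^sup>+z. F (snd z, fst z) \<partial>P)"
    if [measurable]: "F \<in> borel_measurable (borel \<Otimes>\<^sub>M borel)" for F :: "'a \<times> 'a \<Rightarrow> ennreal"
  proof -
    have "S.P = distr P S.P (\<lambda>z. (snd z, fst z))" using S.P.distr_pair_swap by (simp add: case_prod_beta')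
    then have "(\<integral>\<^sup>+z. F z \<partial>S.P) = (\<integral>\<^sup>+z. F z \<partial>distr P S.P (\<lambda>z. (snd z, fst z)))" by simp
    also have "\<dots> = (\<integral>\<^sup>+z. F (snd z, fst z) \<partial>P)" by (rule nn_integral_distr) measurable
    finally show ?thesis .
  qed
  have m: "gibbs_density \<psi> \<phi> \<in> borel_measurable (borel \<Otimes>\<^sub>M borel)" by measurable
  have nn: "0 \<le> gibbs_density \<psi> \<phi> z" for z by (simp add: less_imp_le)
  have marg: "(\<integral>\<^sup>+z. ennreal (gibbs_density \<phi> \<psi> z) * indicator A (fst z) \<partial>P) = emeasure \<mu> A"
    "(\<integral>\<^sup>+z. ennreal (gibbs_density \<phi> \<psi> z) * indicator A (snd z) \<partial>P) = emeasure \<nu> A" if "A \<in> sets borel" for A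
    using plan_density_iff[OF plan_density_meas[OF pd] plan_density_nonneg[OF pd]] pd that by auto
  show ?thesis
    unfolding S.plan_density_iff[OF m nn]
  proof
    fix A :: "'a set" assume A[measurable]: "A \<in> sets borel"
    have "(\<integral>\<^sup>+z. ennreal (gibbs_density \<psi> \<phi> z) * indicator A (fst z) \<partial>S.P) = emeasure \<nu> A"
      by (subst sw) (simp_all add: sym marg)
    moreover have "(\<integral>\<^sup>+z. ennreal (gibbs_density \<psi> \<phi> z) * indicator A (snd z) \<partial>S.P) = emeasure \<mu> A"
      by (subst sw) (simp_all add: sym marg)
    ultimately show "(\<integral>\<^sup>+z. ennreal (gibbs_density \<psi> \<phi> z) * indicator A (fst z) \<partial>S.P) = emeasure \<nu> A \<and>
      (\<integral>\<^sup>+z. ennreal (gibbs_density \<psi> \<phi> z) * indicator A (snd z) \<partial>S.P) = emeasure \<mu> A" by simp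
  qed
qed

text \<open>Apply \<open>squared_mean_le_entropy\<close> to the conditional law given \<open>x\<close> and integrate over \<open>\<mu>\<close>. The conditional entropies
integrate to the sum of the potential integrals and the entropy of \<open>\<nu>\<close>.\<close>

lemma gradient_bound:
  assumes \<phi>: "integrable \<mu> \<phi>" and \<psi>: "integrable \<nu> \<psi>"
    and \<phi>m[measurable]: "\<phi> \<in> borel_measurable borel" and \<psi>m[measurable]: "\<psi> \<in> borel_measurable borel"
    and pd: "plan_density (gibbs_density \<phi> \<psi>)"
    and nu: "\<nu> = density lborel (\<lambda>y. ennreal (n y))" and nm[measurable]: "n \<in> borel_measurable borel" and n0: "\<And>y. 0 \<le> n y"
    and lnn: "integrable \<nu> (\<lambda>y. ln (n y))"
  defines "K \<equiv> (\<integral>x. \<phi> x \<partial>\<mu>) + (\<integral>y. \<psi> y \<partial>\<nu>) + \<epsilon> * (\<integral>y. ln (n y) \<partial>\<nu>) + real DIM('a) * \<epsilon> / 2 * ln (pi * \<epsilon>)"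
  shows "0 \<le> K" "(\<integral>\<^sup>+x. ennreal ((norm (2 *\<^sub>R (x - dual_mean \<psi> x)))\<^sup>2) \<partial>\<mu>) \<le> ennreal (4 * K)"
proof -
  define \<rho> where "\<rho> = gibbs_density \<phi> \<psi>"
  have [measurable]: "\<rho> \<in> borel_measurable (borel \<Otimes>\<^sub>M borel)" unfolding \<rho>_def by measurable
  have [measurable]: "dual_mean \<psi> \<in> borel_measurable borel" by (rule dual_potential_smooth) measurable
  note pd' = pd[folded \<rho>_def]
  define E where "E z = \<rho> z * ((\<phi> (fst z) + \<psi> (snd z)) / \<epsilon> + ln (n (snd z)))" for z
  note i = integral_plan_fst[OF pd' \<phi>] integral_plan_snd[OF pd' \<psi>] integral_plan_snd[OF pd' lnn]
  have E_eq: "E z = (\<rho> z * \<phi> (fst z) + \<rho> z * \<psi> (snd z)) / \<epsilon> + \<rho> z * ln (n (snd z))" for z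
    by (simp add: E_def distrib_left add_divide_distrib)
  have Ei: "integrable P E" unfolding E_eq[abs_def] using i by auto
  have EI: "(\<integral>z. E z \<partial>P) = ((\<integral>x. \<phi> x \<partial>\<mu>) + (\<integral>y. \<psi> y \<partial>\<nu>)) / \<epsilon> + (\<integral>y. ln (n y) \<partial>\<nu>)"
    unfolding E_eq using i by simp
  define c where "c = real DIM('a) / 2 * ln (pi * \<epsilon>)"
  define f where "f x = (\<integral>y. E (x, y) \<partial>\<nu>)" for x
  have fi: "integrable \<mu> f" unfolding f_def[abs_def] by (rule P.integrable_fst'[OF Ei])
  have fI: "(\<integral>x. f x \<partial>\<mu>) = (\<integral>z. E z \<partial>P)" unfolding f_def by (rule P.integral_fst'[OF Ei])
  have K: "K = \<epsilon> * ((\<integral>x. f x \<partial>\<mu>) + c)"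
    unfolding K_def fI EI c_def using eps by (simp add: field_simps)
  have ae: "AE x in \<mu>. (norm (x - dual_mean \<psi> x))\<^sup>2 / \<epsilon> \<le> f x + c"
    using gibbs_section[OF \<phi>m \<psi>m pd] P.AE_integrable_fst'[OF Ei] P.AE_integrable_fst'[OF cost_plan_integrable[OF pd excess_gibbs_density_finite[OF \<phi> \<psi> pd]]]
  proof eventually_elim
    case (elim x)
    define p where "p y = gibbs_density \<phi> \<psi> (x, y)" for y
    have [measurable]: "p \<in> borel_measurable borel" unfolding p_def[abs_def] gibbs_density_tilt weight_def by measurable
    have pi: "integrable \<nu> p" and p1: "(\<integral>y. p y \<partial>\<nu>) = 1" and dm: "dual_mean \<psi> x = (\<integral>y. p y *\<^sub>R y \<partial>\<nu>)"
      using elim by (auto simp: p_def[abs_def])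
    note R = squared_mean_le_entropy[OF nu.prob_space_axioms sets_nu eps nu nm n0, of p "\<lambda>y. (\<phi> x + \<psi> y) / \<epsilon>" x]
    have A: "integrable \<nu> (\<lambda>y. p y *\<^sub>R (x - y))"
      "(norm (\<integral>y. p y *\<^sub>R (x - y) \<partial>\<nu>))\<^sup>2 / \<epsilon> \<le> (\<integral>y. p y * ((\<phi> x + \<psi> y) / \<epsilon> + ln (n y)) \<partial>\<nu>) + real DIM('a) / 2 * ln (pi * \<epsilon>)"
      by (rule R; use elim pi p1 in \<open>simp add: p_def E_def \<rho>_def cost_def gibbs_density_def diff_divide_distrib\<close>)+
    have "integrable \<nu> (\<lambda>y. p y *\<^sub>R x - p y *\<^sub>R (x - y))" using pi A(1) by auto
    then have piy: "integrable \<nu> (\<lambda>y. p y *\<^sub>R y)" by (simp add: scaleR_diff_right)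
    have "(\<integral>y. p y *\<^sub>R (x - y) \<partial>\<nu>) = (\<integral>y. p y *\<^sub>R x \<partial>\<nu>) - (\<integral>y. p y *\<^sub>R y \<partial>\<nu>)"
      unfolding scaleR_diff_right using pi piy by (intro Bochner_Integration.integral_diff) auto
    also have "\<dots> = x - dual_mean \<psi> x" using pi p1 dm by simp
    finally show ?case using A(2) by (simp add: f_def E_def \<rho>_def p_def c_def)
  qed
  have f0: "AE x in \<mu>. 0 \<le> f x + c"
    using ae by eventually_elim (use eps in \<open>auto intro: order_trans[rotated]\<close>)
  have fci: "integrable \<mu> (\<lambda>x. f x + c)" using fi by auto
  have fcI: "(\<integral>x. f x + c \<partial>\<mu>) = (\<integral>x. f x \<partial>\<mu>) + c" using fi mu.prob_space by simp
  have "0 \<le> (\<integral>x. f x + c \<partial>\<mu>)" using f0 by (rule integral_nonneg_AE)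
  then show "0 \<le> K" unfolding K fcI using eps by simp
  have "(\<integral>\<^sup>+x. ennreal ((norm (2 *\<^sub>R (x - dual_mean \<psi> x)))\<^sup>2) \<partial>\<mu>) \<le> (\<integral>\<^sup>+x. ennreal (4 * \<epsilon> * (f x + c)) \<partial>\<mu>)"
  proof (rule nn_integral_mono_AE)
    show "AE x in \<mu>. ennreal ((norm (2 *\<^sub>R (x - dual_mean \<psi> x)))\<^sup>2) \<le> ennreal (4 * \<epsilon> * (f x + c))"
      using ae
    proof eventually_elim
      case (elim x)
      have "(norm (x - dual_mean \<psi> x))\<^sup>2 \<le> \<epsilon> * (f x + c)" using elim eps by (simp add: divide_le_eq mult.commute)
      then show ?case by (intro ennreal_leI) (simp add: power_mult_distrib)
    qed
  qed
  also have "\<dots> = ennreal (\<integral>x. 4 * \<epsilon> * (f x + c) \<partial>\<mu>)"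
    using fci f0 eps by (intro nn_integral_eq_integral) (auto elim!: AE_mp)
  also have "(\<integral>x. 4 * \<epsilon> * (f x + c) \<partial>\<mu>) = 4 * K"
    unfolding K fcI[symmetric] using fci by simp
  finally show "(\<integral>\<^sup>+x. ennreal ((norm (2 *\<^sub>R (x - dual_mean \<psi> x)))\<^sup>2) \<partial>\<mu>) \<le> ennreal (4 * K)" .
qed

text \<open>The domain is convex and has full measure, so the support of \<open>\<mu>\<close> lies in its closure, and a convex set and its
closure have the same interior. If instead \<open>\<nu>\<close> has bounded support, convergence of the Laplace transform
at one point implies convergence everywhere.\<close>

lemma dual_domain_covers:
  assumes \<psi>m[measurable]: "\<psi> \<in> borel_measurable borel" and D: "AE x in \<mu>. x \<in> dual_domain \<psi>"
    and adm: "emeasure \<mu> (frontier (msupport \<mu>)) = 0 \<or> bounded (msupport \<nu>)"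
  shows "grad_domain \<mu> \<subseteq> interior (dual_domain \<psi>)"
proof (cases "emeasure \<mu> (frontier (msupport \<mu>)) = 0")
  case True
  have "msupport \<mu> \<subseteq> closure (dual_domain \<psi>)"
  proof
    fix x assume x: "x \<in> msupport \<mu>"
    show "x \<in> closure (dual_domain \<psi>)"
    proof (rule ccontr)
      assume "x \<notin> closure (dual_domain \<psi>)"
      then obtain r where r: "r > 0" "\<And>y. y \<in> dual_domain \<psi> \<Longrightarrow> y \<notin> ball x r"
        unfolding closure_approachable by (auto simp: dist_commute)
      have "AE y in \<mu>. y \<notin> ball x r" using D by eventually_elim (use r in blast)
      then have "emeasure \<mu> {y \<in> space \<mu>. y \<in> ball x r} = 0" by (rule emeasure_eq_0_AE)
      moreover have "{y \<in> space \<mu>. y \<in> ball x r} = ball x r" by auto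
      ultimately have "emeasure \<mu> (ball x r) = 0" by (simp only:)
      then show False using x r(1) by (auto simp: msupport_def)
    qed
  qed
  then have "interior (msupport \<mu>) \<subseteq> interior (closure (dual_domain \<psi>))" by (rule interior_mono)
  also have "\<dots> = interior (dual_domain \<psi>)"
    by (rule convex_interior_closure) (rule dual_potential_smooth(1)[OF \<psi>m])
  finally show ?thesis using True by (simp add: grad_domain_def)
next
  case False
  interpret L: laplace_transform \<nu> "weight \<psi>" "2 / \<epsilon>" by (rule laplace_weight) measurable
  from prob_space_AE_ex[OF mu.prob_space_axioms D] obtain x0 where x0: "x0 \<in> dual_domain \<psi>" by blast
  obtain R where R: "\<And>y. y \<in> msupport \<nu> \<Longrightarrow> norm y \<le> R" using adm False by (auto simp: bounded_iff)
  have "x \<in> L.dom" for x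
  proof -
    have "integrable \<nu> (\<lambda>y. exp (2 / \<epsilon> * (norm (x - x0) * R)) * L.tilt x0 y)"
      using x0 by (intro integrable_mult_right) (simp add: dual_domain_def L.dom_def)
    then have "integrable \<nu> (L.tilt x)"
    proof (rule Bochner_Integration.integrable_bound)
      show "AE y in \<nu>. norm (L.tilt x y) \<le> norm (exp (2 / \<epsilon> * (norm (x - x0) * R)) * L.tilt x0 y)"
        using AE_msupport[OF sets_nu]
      proof eventually_elim
        case (elim y)
        have "(x - x0) \<bullet> y \<le> norm (x - x0) * norm y" by (rule norm_cauchy_schwarz)
        also have "\<dots> \<le> norm (x - x0) * R" using R[OF elim] by (intro mult_left_mono) auto
        finally have "x \<bullet> y \<le> norm (x - x0) * R + x0 \<bullet> y" by (simp add: inner_diff_left)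
        then have "exp (2 / \<epsilon> * (x \<bullet> y)) \<le> exp (2 / \<epsilon> * (norm (x - x0) * R)) * exp (2 / \<epsilon> * (x0 \<bullet> y))"
          unfolding exp_add[symmetric] distrib_left[symmetric] using eps by (intro exp_le_cancel_iff[THEN iffD2] mult_left_mono) auto
        then have "L.tilt x y \<le> exp (2 / \<epsilon> * (norm (x - x0) * R)) * L.tilt x0 y"
          unfolding L.tilt_def using mult_left_mono[of _ _ "weight \<psi> y"] by (simp add: weight_def mult.left_commute)
        then show ?case using L.tilt_pos by (simp add: abs_of_pos)
      qed
    qed simp
    then show ?thesis by (simp add: L.dom_def)
  qed
  then have "dual_domain \<psi> = UNIV" by (auto simp: dual_domain_def)
  then show ?thesis by simp
qed

text \<open>The clipped potential, divided by \<open>2 sqrt K\<close>, belongs to the unit ball over which the dual norm is a supremum. With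
\<open>4 * pi * \<epsilon>\<close> in place of the sharp \<open>pi * \<epsilon>\<close>, \<open>K\<close> exceeds the gradient bound strictly, so it is positive
and the division is legitimate even if the gradient vanishes.\<close>

lemma clipped_potential_pairing:
  assumes \<phi>: "integrable \<mu> \<phi>" and \<psi>: "integrable \<nu> \<psi>"
    and \<phi>m[measurable]: "\<phi> \<in> borel_measurable borel" and \<psi>m[measurable]: "\<psi> \<in> borel_measurable borel"
    and pd: "plan_density (gibbs_density \<phi> \<psi>)"
    and nu: "\<nu> = density lborel (\<lambda>y. ennreal (n y))" and nm[measurable]: "n \<in> borel_measurable borel" and n0: "\<And>y. 0 \<le> n y"
    and lnn: "integrable \<nu> (\<lambda>y. ln (n y))"
    and adm: "emeasure \<mu> (frontier (msupport \<mu>)) = 0 \<or> bounded (msupport \<nu>)"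
    and mu': "prob_space \<mu>'" "sets \<mu>' = sets borel" "absolutely_continuous \<mu> \<mu>'"
    and k: "k > 0"
  defines "K \<equiv> (\<integral>x. \<phi> x \<partial>\<mu>) + (\<integral>y. \<psi> y \<partial>\<nu>) + \<epsilon> * (\<integral>y. ln (n y) \<partial>\<nu>) + real DIM('a) * \<epsilon> / 2 * ln (4 * pi * \<epsilon>)"
  shows "0 < K" "ereal \<bar>(\<integral>x. soft_clip k (\<phi> x) \<partial>\<mu>) - (\<integral>x. soft_clip k (\<phi> x) \<partial>\<mu>')\<bar> \<le> 2 * (ereal (sqrt K) * hdot_neg1_norm \<mu> \<mu> \<mu>')"
proof -
  interpret mu': prob_space \<mu>' by fact
  define U where "U = grad_domain \<mu>"
  have sec: "AE x in \<mu>. x \<in> dual_domain \<psi> \<and> \<phi> x = dual_potential \<psi> x"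
    using gibbs_section[OF \<phi>m \<psi>m pd] by eventually_elim auto
  have Usub: "U \<subseteq> interior (dual_domain \<psi>)" unfolding U_def
    by (rule dual_domain_covers[OF \<psi>m _ adm]) (use sec in \<open>eventually_elim, simp\<close>)
  have Uop: "open U" by (simp add: U_def grad_domain_def)
  note sm = dual_potential_smooth[OF \<psi>m]
  have [measurable]: "dual_potential \<psi> \<in> borel_measurable borel" "dual_mean \<psi> \<in> borel_measurable borel" by (fact sm)+
  note gb = gradient_bound[OF \<phi> \<psi> \<phi>m \<psi>m pd nu nm n0 lnn]
  have Kgt: "(\<integral>x. \<phi> x \<partial>\<mu>) + (\<integral>y. \<psi> y \<partial>\<nu>) + \<epsilon> * (\<integral>y. ln (n y) \<partial>\<nu>) + real DIM('a) * \<epsilon> / 2 * ln (pi * \<epsilon>) < K"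
  proof -
    have "ln (pi * \<epsilon>) < ln (4 * pi * \<epsilon>)" using eps by simp
    then have "real DIM('a) * \<epsilon> / 2 * ln (pi * \<epsilon>) < real DIM('a) * \<epsilon> / 2 * ln (4 * pi * \<epsilon>)"
      using eps by (intro mult_strict_left_mono) auto
    then show ?thesis by (simp add: K_def)
  qed
  with gb(1) show K0: "0 < K" by linarith
  define s where "s = 1 / (2 * sqrt K)"
  have s: "s > 0" "2 * sqrt K * s = 1" using K0 by (auto simp: s_def)
  define h where "h x = s * soft_clip k (dual_potential \<psi> x)" for x
  define g where "g x = (s * (1 / (1 + (dual_potential \<psi> x / k)\<^sup>2))) *\<^sub>R (2 *\<^sub>R (x - dual_mean \<psi> x))" for x
  have hm[measurable]: "h \<in> borel_measurable borel" unfolding h_def[abs_def] by measurable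
  have gm[measurable]: "g \<in> borel_measurable borel" unfolding g_def[abs_def] by measurable
  have cont: "continuous_on U (dual_potential \<psi>)" "continuous_on U (dual_mean \<psi>)"
    using sm(4,5) Usub continuous_on_subset by blast+
  have pos: "1 + (dual_potential \<psi> x / k)\<^sup>2 \<noteq> 0" for x using zero_le_power2[of "dual_potential \<psi> x / k"] by linarith
  have weak: "is_weak_gradient U h g"
  proof (rule smooth_is_weak_gradient[OF Uop hm gm])
    show "continuous_on U h" unfolding h_def[abs_def] soft_clip_def using k by (intro continuous_intros cont) auto
    show "continuous_on U g" unfolding g_def[abs_def] using k pos by (intro continuous_intros cont) auto
    fix x i :: 'a assume x: "x \<in> U" and i: "i \<in> Basis"
    have d: "((\<lambda>t. dual_potential \<psi> (x + t *\<^sub>R i)) has_real_derivative (2 *\<^sub>R (x - dual_mean \<psi> x)) \<bullet> i) (at 0)"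
      using sm(6) x i Usub by blast
    have "((\<lambda>t. soft_clip k (dual_potential \<psi> (x + t *\<^sub>R i))) has_real_derivative
        (1 / (1 + (dual_potential \<psi> (x + 0 *\<^sub>R i) / k)\<^sup>2)) * ((2 *\<^sub>R (x - dual_mean \<psi> x)) \<bullet> i)) (at 0)"
      by (rule DERIV_chain2[OF soft_clip_derivative[OF k] d])
    from DERIV_cmult[OF this, of s]
    show "((\<lambda>t. h (x + t *\<^sub>R i)) has_real_derivative g x \<bullet> i) (at 0)"
      unfolding h_def g_def by (simp add: mult.assoc)
  qed
  have "(\<integral>\<^sup>+x. ennreal ((norm (g x))\<^sup>2) \<partial>\<mu>) \<le> (\<integral>\<^sup>+x. ennreal (s\<^sup>2) * ennreal ((norm (2 *\<^sub>R (x - dual_mean \<psi> x)))\<^sup>2) \<partial>\<mu>)"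
  proof (rule nn_integral_mono)
    fix x
    let ?r = "1 / (1 + (dual_potential \<psi> x / k)\<^sup>2)"
    have "0 < 1 + (dual_potential \<psi> x / k)\<^sup>2" by (rule add_pos_nonneg) auto
    then have r: "0 \<le> ?r" "?r \<le> 1" by (simp, subst divide_le_eq_1_pos, simp, simp)
    have "norm (g x) = ?r * (s * norm (2 *\<^sub>R (x - dual_mean \<psi> x)))"
      unfolding g_def norm_scaleR using r s by (simp add: abs_mult)
    also have "\<dots> \<le> s * norm (2 *\<^sub>R (x - dual_mean \<psi> x))" using r s by (intro mult_left_le_one_le) auto
    finally have "(norm (g x))\<^sup>2 \<le> (s * norm (2 *\<^sub>R (x - dual_mean \<psi> x)))\<^sup>2" by (intro power_mono) auto
    then show "ennreal ((norm (g x))\<^sup>2) \<le> ennreal (s\<^sup>2) * ennreal ((norm (2 *\<^sub>R (x - dual_mean \<psi> x)))\<^sup>2)"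
      by (simp add: ennreal_mult[symmetric] ennreal_leI power_mult_distrib)
  qed
  also have "\<dots> = ennreal (s\<^sup>2) * (\<integral>\<^sup>+x. ennreal ((norm (2 *\<^sub>R (x - dual_mean \<psi> x)))\<^sup>2) \<partial>\<mu>)"
    by (rule nn_integral_cmult) measurable
  also have "\<dots> \<le> ennreal (s\<^sup>2) * ennreal (4 * K)"
    using gb(2) Kgt by (intro mult_left_mono order_trans[OF gb(2)] ennreal_leI) auto
  also have "\<dots> = 1" using K0 by (simp add: ennreal_mult[symmetric] s_def power_mult_distrib power_divide)
  finally have ball: "h \<in> hdot1_unit_ball \<mu>" using weak unfolding hdot1_unit_ball_def U_def by auto
  have hb: "\<bar>h x\<bar> \<le> s * (k * (pi / 2))" for x
    using mult_left_mono[OF soft_clip_bounded[OF k, of "dual_potential \<psi> x"], of s] s by (simp add: h_def abs_mult)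
  have hi: "integrable \<mu> h" "integrable \<mu>' h"
    using hb mu' by (auto intro!: mu.integrable_const_bound[of _ "s * (k * (pi / 2))"] mu'.integrable_const_bound[of _ "s * (k * (pi / 2))"]
      simp: measurable_cong_sets[OF mu'(2) refl])
  have le: "ereal \<bar>(\<integral>x. h x \<partial>\<mu>) - (\<integral>x. h x \<partial>\<mu>')\<bar> \<le> hdot_neg1_norm \<mu> \<mu> \<mu>'"
    unfolding hdot_neg1_norm_def by (rule SUP_upper) (use ball hi in simp)
  have ae': "AE x in \<mu>'. \<phi> x = dual_potential \<psi> x"
    by (rule absolutely_continuous_AE[OF _ mu'(3)]) (use sec mu' in \<open>auto elim!: AE_mp\<close>)
  have m': "f \<in> borel_measurable \<mu>'" if "f \<in> borel_measurable borel" for f :: "'a \<Rightarrow> real"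
    using that measurable_cong_sets[OF mu'(2) refl] by blast
  have "(\<integral>x. h x \<partial>\<mu>) = (\<integral>x. s * soft_clip k (\<phi> x) \<partial>\<mu>)"
  proof (rule integral_cong_AE)
    show "AE x in \<mu>. h x = s * soft_clip k (\<phi> x)" using sec by eventually_elim (simp add: h_def)
  qed measurable
  moreover have "(\<integral>x. h x \<partial>\<mu>') = (\<integral>x. s * soft_clip k (\<phi> x) \<partial>\<mu>')"
  proof (rule integral_cong_AE)
    show "AE x in \<mu>'. h x = s * soft_clip k (\<phi> x)" using ae' by eventually_elim (simp add: h_def)
    show "h \<in> borel_measurable \<mu>'" by (rule m') measurable
    show "(\<lambda>x. s * soft_clip k (\<phi> x)) \<in> borel_measurable \<mu>'" by (rule m') measurable
  qed
  ultimately have eq: "\<bar>(\<integral>x. h x \<partial>\<mu>) - (\<integral>x. h x \<partial>\<mu>')\<bar> = s * \<bar>(\<integral>x. soft_clip k (\<phi> x) \<partial>\<mu>) - (\<integral>x. soft_clip k (\<phi> x) \<partial>\<mu>')\<bar>"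
    using s by (simp add: right_diff_distrib[symmetric] abs_mult)
  have "ereal \<bar>(\<integral>x. soft_clip k (\<phi> x) \<partial>\<mu>) - (\<integral>x. soft_clip k (\<phi> x) \<partial>\<mu>')\<bar>
    = ereal (2 * sqrt K) * ereal (s * \<bar>(\<integral>x. soft_clip k (\<phi> x) \<partial>\<mu>) - (\<integral>x. soft_clip k (\<phi> x) \<partial>\<mu>')\<bar>)"
    using s(2) by (simp add: mult.assoc[symmetric])
  also have "\<dots> \<le> ereal (2 * sqrt K) * hdot_neg1_norm \<mu> \<mu> \<mu>'"
    using le K0 unfolding eq by (intro ereal_mult_left_mono) auto
  also have "ereal (2 * sqrt K) = 2 * ereal (sqrt K)" by simp
  finally show "ereal \<bar>(\<integral>x. soft_clip k (\<phi> x) \<partial>\<mu>) - (\<integral>x. soft_clip k (\<phi> x) \<partial>\<mu>')\<bar> \<le> 2 * (ereal (sqrt K) * hdot_neg1_norm \<mu> \<mu> \<mu>')"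
    by (simp only: mult.assoc)
qed

end

section \<open>Stability of cost and plan\<close>

context eot_problem
begin

lemma gibbs_density_clip_le:
  assumes k: "k > 0"
  shows "gibbs_density (\<lambda>x. soft_clip k (\<phi> x)) (\<lambda>y. soft_clip k (\<psi> y)) z \<le> 1 + gibbs_density \<phi> \<psi> z"
proof -
  let ?a = "\<phi> (fst z)" and ?b = "\<psi> (snd z)"
  have "(soft_clip k ?a + soft_clip k ?b - cost z) / \<epsilon> \<le> (max 0 (?a + ?b) - cost z) / \<epsilon>"
    using soft_clip_add_le[OF k, of ?a ?b] eps by (intro divide_right_mono) auto
  then have "gibbs_density (\<lambda>x. soft_clip k (\<phi> x)) (\<lambda>y. soft_clip k (\<psi> y)) z \<le> exp ((max 0 (?a + ?b) - cost z) / \<epsilon>)"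
    by (simp add: gibbs_density_def)
  also have "\<dots> \<le> 1 + gibbs_density \<phi> \<psi> z"
  proof (cases "?a + ?b \<le> 0")
    case True
    then have "(max 0 (?a + ?b) - cost z) / \<epsilon> \<le> 0" using eps by (simp add: divide_nonpos_pos)
    then have "exp ((max 0 (?a + ?b) - cost z) / \<epsilon>) \<le> 1" by simp
    then show ?thesis using gibbs_density_pos[of \<phi> \<psi> z] by linarith
  qed (simp add: gibbs_density_def)
  finally show ?thesis .
qed

lemma clipped_mass_tendsto:
  assumes [measurable]: "\<phi> \<in> borel_measurable borel" "\<psi> \<in> borel_measurable borel"
    and pd: "plan_density (gibbs_density \<phi> \<psi>)"
  defines "\<rho> \<equiv> \<lambda>n. gibbs_density (\<lambda>x. soft_clip (real (Suc n)) (\<phi> x)) (\<lambda>y. soft_clip (real (Suc n)) (\<psi> y))"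
  shows "\<And>n. integrable P (\<rho> n)" "(\<lambda>n. \<integral>z. \<rho> n z \<partial>P) \<longlonglongrightarrow> 1" "\<And>z. (\<lambda>n. \<rho> n z) \<longlonglongrightarrow> gibbs_density \<phi> \<psi> z"
proof -
  have [measurable]: "\<rho> n \<in> borel_measurable (borel \<Otimes>\<^sub>M borel)" for n unfolding \<rho>_def by measurable
  have dom: "integrable P (\<lambda>z. 1 + gibbs_density \<phi> \<psi> z)" using plan_density_integrable[OF pd] by simp
  have le: "norm (\<rho> n z) \<le> 1 + gibbs_density \<phi> \<psi> z" for n z
    unfolding \<rho>_def using gibbs_density_clip_le[of "real (Suc n)" \<phi> \<psi> z] by (simp add: less_imp_le abs_of_pos del: of_nat_Suc)
  show "integrable P (\<rho> n)" for n
    by (rule Bochner_Integration.integrable_bound[OF dom], measurable) (rule AE_I2, rule order_trans[OF le], simp)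
  show lim: "(\<lambda>n. \<rho> n z) \<longlonglongrightarrow> gibbs_density \<phi> \<psi> z" for z
    unfolding \<rho>_def gibbs_density_def using eps by (intro tendsto_intros soft_clip_tendsto) auto
  have "(\<lambda>n. \<integral>z. \<rho> n z \<partial>P) \<longlonglongrightarrow> (\<integral>z. gibbs_density \<phi> \<psi> z \<partial>P)"
    by (rule integral_dominated_convergence[OF _ _ dom]) (measurable, rule AE_I2, rule lim, rule AE_I2, rule le)
  then show "(\<lambda>n. \<integral>z. \<rho> n z \<partial>P) \<longlonglongrightarrow> 1" using plan_density_integral[OF pd] by simp
qed

text \<open>For the clipped potentials the expansion of \<open>ln (d\<pi> / d\<rho>)\<close> is a sum of integrable terms, where \<open>\<rho>\<close> is the
clipped Gibbs density. As the clipping is removed the total mass of \<open>\<rho>\<close> tends to 1, the \<open>\<mu>\<close>- and \<open>\<nu>\<close>-integrals converge,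
the integrals over \<open>\<mu>'\<close> and \<open>\<nu>'\<close> are compared with them through \<open>A1\<close> and \<open>A2\<close>, and the divergence of the limit
is controlled by Fatou's lemma.\<close>

lemma entropy_of_competitor_le:
  assumes \<phi>: "integrable \<mu> \<phi>" and \<psi>: "integrable \<nu> \<psi>"
    and \<phi>m[measurable]: "\<phi> \<in> borel_measurable borel" and \<psi>m[measurable]: "\<psi> \<in> borel_measurable borel"
    and pd: "plan_density (gibbs_density \<phi> \<psi>)"
    and mu': "\<mu>' \<in> P2" "rel_entropy \<mu>' \<mu> = ereal h1" and nu': "\<nu>' \<in> P2" "rel_entropy \<nu>' \<nu> = ereal h2"
    and \<pi>: "\<pi> \<in> couplings \<mu>' \<nu>'" "eot_objective \<epsilon> \<mu>' \<nu>' \<pi> = ereal c"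
    and A1: "\<And>n. (\<integral>x. soft_clip (real (Suc n)) (\<phi> x) \<partial>\<mu>) - (\<integral>x. soft_clip (real (Suc n)) (\<phi> x) \<partial>\<mu>') \<le> A1"
    and A2: "\<And>n. (\<integral>y. soft_clip (real (Suc n)) (\<psi> y) \<partial>\<nu>) - (\<integral>y. soft_clip (real (Suc n)) (\<psi> y) \<partial>\<nu>') \<le> A2"
  shows "rel_entropy \<pi> (density P (\<lambda>z. ennreal (gibbs_density \<phi> \<psi> z)))
    \<le> ereal ((c - ((\<integral>x. \<phi> x \<partial>\<mu>) + (\<integral>y. \<psi> y \<partial>\<nu>)) + A1 + A2) / \<epsilon> + h1 + h2)"
proof -
  interpret E': eot_problem \<mu>' \<nu>' \<epsilon> by standard (rule eps mu' nu')+
  obtain u where u: "u \<in> borel_measurable \<mu>" "\<And>x. 0 \<le> u x" "\<mu>' = density \<mu> (\<lambda>x. ennreal (u x))"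
    "integrable \<mu>' (\<lambda>x. ln (u x))" "h1 = (\<integral>x. ln (u x) \<partial>\<mu>')"
    using rel_entropy_cases[OF mu.sigma_finite_measure_axioms E'.mu.prob_space_axioms] mu'(2) by (metis E'.sets_mu PInfty_neq_ereal(1) ereal.inject sets_mu)
  obtain v where v: "v \<in> borel_measurable \<nu>" "\<And>x. 0 \<le> v x" "\<nu>' = density \<nu> (\<lambda>x. ennreal (v x))"
    "integrable \<nu>' (\<lambda>x. ln (v x))" "h2 = (\<integral>x. ln (v x) \<partial>\<nu>')"
    using rel_entropy_cases[OF nu.sigma_finite_measure_axioms E'.nu.prob_space_axioms] nu'(2) by (metis E'.sets_nu PInfty_neq_ereal(1) ereal.inject sets_nu)
  have um[measurable]: "u \<in> borel_measurable borel" using u(1) measurable_cong_sets[OF sets_mu refl] by blast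
  have vm[measurable]: "v \<in> borel_measurable borel" using v(1) measurable_cong_sets[OF sets_nu refl] by blast
  have pp: "prob_space \<pi>" and s\<pi>: "sets \<pi> = sets borel" and d1: "distr \<pi> borel fst = \<mu>'" and d2: "distr \<pi> borel snd = \<nu>'"
    using \<pi>(1) by (auto simp: couplings_def)
  interpret \<pi>: prob_space \<pi> by (fact pp)
  have s\<pi>'[measurable_cong]: "sets \<pi> = sets (borel \<Otimes>\<^sub>M borel :: ('a \<times> 'a) measure)" unfolding s\<pi> borel_prod ..
  have fin: "rel_entropy \<pi> E'.P \<noteq> \<infinity>"
  proof
    assume "rel_entropy \<pi> E'.P = \<infinity>"
    then show False using \<pi>(2) eps by (simp add: eot_objective_def)
  qed
  obtain f where f: "f \<in> borel_measurable E'.P" "\<And>z. 0 \<le> f z" "\<pi> = density E'.P (\<lambda>z. ennreal (f z))"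
    "integrable \<pi> (\<lambda>z. ln (f z))" "rel_entropy \<pi> E'.P = ereal (\<integral>z. ln (f z) \<partial>\<pi>)"
    using rel_entropy_cases[OF E'.P.sigma_finite_measure_axioms pp _ fin] s\<pi> E'.sets_P by metis
  have fm[measurable]: "f \<in> borel_measurable (borel \<Otimes>\<^sub>M borel)" using f(1) E'.meas_P by blast
  have costfin: "(\<integral>\<^sup>+z. ennreal (cost z) \<partial>\<pi>) < \<infinity>"
  proof (rule ccontr)
    assume "\<not> (\<integral>\<^sup>+z. ennreal (cost z) \<partial>\<pi>) < \<infinity>"
    then have "enn2ereal (\<integral>\<^sup>+z. ennreal (cost z) \<partial>\<pi>) = \<infinity>" by (simp add: top.not_eq_extremum[symmetric])
    then show False using \<pi>(2) unfolding eot_objective_def f(5) cost_def by simp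
  qed
  have ci: "integrable \<pi> cost" using costfin by (intro integrableI_nonneg) auto
  have c: "c = (\<integral>z. cost z \<partial>\<pi>) + \<epsilon> * (\<integral>z. ln (f z) \<partial>\<pi>)"
  proof -
    have "(\<integral>\<^sup>+z. ennreal (cost z) \<partial>\<pi>) = ennreal (\<integral>z. cost z \<partial>\<pi>)" using ci by (intro nn_integral_eq_integral) auto
    moreover have "0 \<le> (\<integral>z. cost z \<partial>\<pi>)" by simp
    ultimately show ?thesis using \<pi>(2) unfolding eot_objective_def f(5) cost_def by (simp add: enn2ereal_ennreal)
  qed
  define w where "w z = u (fst z) * v (snd z) * f z" for z
  have wm[measurable]: "w \<in> borel_measurable (borel \<Otimes>\<^sub>M borel)" unfolding w_def[abs_def] by measurable
  have w0: "0 \<le> w z" for z unfolding w_def using u v f by simp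
  have dP: "E'.P = density P (\<lambda>z. ennreal (u (fst z) * v (snd z)))"
  proof -
    have "density \<mu> (\<lambda>x. ennreal (u x)) \<Otimes>\<^sub>M density \<nu> (\<lambda>x. ennreal (v x)) = density P (\<lambda>(x, y). ennreal (u x) * ennreal (v y))"
      by (rule pair_measure_density) (use E'.nu.sigma_finite_measure_axioms nu.sigma_finite_measure_axioms v(3) in auto)
    then show ?thesis using u v by (simp add: case_prod_beta' ennreal_mult)
  qed
  have dw: "\<pi> = density P (\<lambda>z. ennreal (w z))"
    unfolding f(3) dP by (subst density_density_eq) (auto simp: w_def u v f ennreal_mult mult_nonneg_nonneg)
  have ae: "AE z in \<pi>. 0 < w z" unfolding dw by (subst AE_density) auto
  have lnu: "integrable \<pi> (\<lambda>z. ln (u (fst z)))" "(\<integral>z. ln (u (fst z)) \<partial>\<pi>) = h1"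
    using u(4,5) integrable_distr_eq[of fst \<pi> borel "\<lambda>x. ln (u x)"] integral_distr[of fst \<pi> borel "\<lambda>x. ln (u x)"] unfolding d1 by auto
  have lnv: "integrable \<pi> (\<lambda>z. ln (v (snd z)))" "(\<integral>z. ln (v (snd z)) \<partial>\<pi>) = h2"
    using v(4,5) integrable_distr_eq[of snd \<pi> borel "\<lambda>x. ln (v x)"] integral_distr[of snd \<pi> borel "\<lambda>x. ln (v x)"] unfolding d2 by auto
  define Tf where "Tf n x = soft_clip (real (Suc n)) (\<phi> x)" for n x
  define Ts where "Ts n y = soft_clip (real (Suc n)) (\<psi> y)" for n y
  have Tm[measurable]: "Tf n \<in> borel_measurable borel" "Ts n \<in> borel_measurable borel" for n
    unfolding Tf_def[abs_def] Ts_def[abs_def] by measurable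
  define \<rho> where "\<rho> n = gibbs_density (Tf n) (Ts n)" for n
  have \<rho>m[measurable]: "\<rho> n \<in> borel_measurable (borel \<Otimes>\<^sub>M borel)" for n unfolding \<rho>_def by measurable
  note cm = clipped_mass_tendsto[OF \<phi>m \<psi>m pd, folded Tf_def Ts_def, folded \<rho>_def]
  have Tfi: "integrable \<pi> (\<lambda>z. Tf n (fst z))" "(\<integral>z. Tf n (fst z) \<partial>\<pi>) = (\<integral>x. Tf n x \<partial>\<mu>')" for n
  proof -
    show "integrable \<pi> (\<lambda>z. Tf n (fst z))"
    proof (rule \<pi>.integrable_const_bound[of _ "real (Suc n) * (pi / 2)"])
      show "AE z in \<pi>. norm (Tf n (fst z)) \<le> real (Suc n) * (pi / 2)"
        unfolding Tf_def real_norm_def by (rule AE_I2, rule soft_clip_bounded) simp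
    qed measurable
    show "(\<integral>z. Tf n (fst z) \<partial>\<pi>) = (\<integral>x. Tf n x \<partial>\<mu>')"
      using integral_distr[of fst \<pi> borel "Tf n"] unfolding d1 by simp
  qed
  have Tsi: "integrable \<pi> (\<lambda>z. Ts n (snd z))" "(\<integral>z. Ts n (snd z) \<partial>\<pi>) = (\<integral>x. Ts n x \<partial>\<nu>')" for n
  proof -
    show "integrable \<pi> (\<lambda>z. Ts n (snd z))"
    proof (rule \<pi>.integrable_const_bound[of _ "real (Suc n) * (pi / 2)"])
      show "AE z in \<pi>. norm (Ts n (snd z)) \<le> real (Suc n) * (pi / 2)"
        unfolding Ts_def real_norm_def by (rule AE_I2, rule soft_clip_bounded) simp
    qed measurable
    show "(\<integral>z. Ts n (snd z) \<partial>\<pi>) = (\<integral>x. Ts n x \<partial>\<nu>')"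
      using integral_distr[of snd \<pi> borel "Ts n"] unfolding d2 by simp
  qed
  \<comment> \<open>\<open>g n\<close> is \<open>ln (w / \<rho> n)\<close> wherever \<open>w\<close> is positive.\<close>
  define g where "g n z = ln (f z) + ln (u (fst z)) + ln (v (snd z)) - (Tf n (fst z) + Ts n (snd z) - cost z) / \<epsilon>" for n z
  have gm[measurable]: "g n \<in> borel_measurable (borel \<Otimes>\<^sub>M borel)" for n unfolding g_def[abs_def] by measurable
  have gi: "integrable \<pi> (g n)" for n unfolding g_def[abs_def] using f(4) lnu(1) lnv(1) Tfi(1) Tsi(1) ci by auto
  have gI: "(\<integral>z. g n z \<partial>\<pi>) = (c - (\<integral>x. Tf n x \<partial>\<mu>') - (\<integral>y. Ts n y \<partial>\<nu>')) / \<epsilon> + h1 + h2" for n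
    unfolding g_def c using f(4) lnu lnv Tfi Tsi ci eps by (simp add: field_simps)
  have wgi: "integrable P (\<lambda>z. w z * g n z)" "(\<integral>z. w z * g n z \<partial>P) = (\<integral>z. g n z \<partial>\<pi>)" for n
    using gi[of n] w0 unfolding dw by (auto simp: integrable_real_density integral_real_density)
  have wi: "integrable P w" and wI: "(\<integral>z. w z \<partial>P) = 1"
  proof -
    have e: "(\<integral>\<^sup>+z. ennreal (w z) \<partial>P) = 1"
      using \<pi>.emeasure_space_1 unfolding dw by (simp add: emeasure_density cong: nn_integral_cong)
    then show "integrable P w" using w0 by (intro integrableI_nonneg) auto
    show "(\<integral>z. w z \<partial>P) = 1" using e w0 by (subst integral_eq_nn_integral) auto
  qed
  have klw: "w z * ln (w z / \<rho> n z) - w z + \<rho> n z = w z * g n z - w z + \<rho> n z" for n z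
  proof (cases "w z = 0")
    case False
    then have p: "0 < f z" "0 < u (fst z)" "0 < v (snd z)" "0 < w z"
      using f(2)[of z] u(2)[of "fst z"] v(2)[of "snd z"] w0[of z] by (auto simp: w_def order_less_le)
    have "0 < \<rho> n z" by (simp add: \<rho>_def)
    then have "ln (w z / \<rho> n z) = ln (w z) - ln (\<rho> n z)" using p by (simp add: ln_div)
    also have "ln (w z) = ln (u (fst z)) + ln (v (snd z)) + ln (f z)" unfolding w_def using p by (simp add: ln_mult)
    also have "ln (\<rho> n z) = (Tf n (fst z) + Ts n (snd z) - cost z) / \<epsilon>" by (simp add: \<rho>_def gibbs_density_def)
    finally show ?thesis by (simp add: g_def)
  qed simp
  define X where "X n = (\<integral>z. w z * g n z - w z + \<rho> n z \<partial>P)" for n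
  have kn: "0 \<le> w z * g n z - w z + \<rho> n z" for n z
    unfolding klw[symmetric] by (intro kl_real_nonneg w0) (simp add: \<rho>_def)
  have X: "(\<integral>\<^sup>+z. kl (w z) (\<rho> n z) \<partial>P) = ennreal (X n)" for n
  proof -
    have "(\<integral>\<^sup>+z. kl (w z) (\<rho> n z) \<partial>P) = (\<integral>\<^sup>+z. ennreal (w z * g n z - w z + \<rho> n z) \<partial>P)"
    proof (rule nn_integral_cong)
      fix z
      have "0 < \<rho> n z" by (simp add: \<rho>_def)
      then show "kl (w z) (\<rho> n z) = ennreal (w z * g n z - w z + \<rho> n z)" by (simp only: kl_pos klw)
    qed
    also have "\<dots> = ennreal (X n)"
      unfolding X_def using wgi(1) wi cm(1) kn by (intro nn_integral_eq_integral) auto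
    finally show ?thesis .
  qed
  have X0: "0 \<le> X n" for n unfolding X_def using kn by (intro integral_nonneg_AE) auto
  \<comment> \<open>\<open>Y n\<close> replaces the integrals over \<open>\<mu>'\<close> and \<open>\<nu>'\<close>, of unknown limit, by convergent ones.\<close>
  define Y where "Y n = (c - ((\<integral>x. Tf n x \<partial>\<mu>) + (\<integral>y. Ts n y \<partial>\<nu>)) + A1 + A2) / \<epsilon> + h1 + h2 - 1 + (\<integral>z. \<rho> n z \<partial>P)" for n
  have XY: "X n \<le> Y n" for n
  proof -
    have "X n = (c - (\<integral>x. Tf n x \<partial>\<mu>') - (\<integral>y. Ts n y \<partial>\<nu>')) / \<epsilon> + h1 + h2 - 1 + (\<integral>z. \<rho> n z \<partial>P)"
      unfolding X_def using wgi[of n] wi wI cm(1)[of n] gI[of n] by simp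
    also have "\<dots> \<le> Y n"
    proof -
      have "(\<integral>x. Tf n x \<partial>\<mu>) - (\<integral>x. Tf n x \<partial>\<mu>') \<le> A1" "(\<integral>y. Ts n y \<partial>\<nu>) - (\<integral>y. Ts n y \<partial>\<nu>') \<le> A2"
        using A1[of n] A2[of n] unfolding Tf_def Ts_def .
      then have "c - (\<integral>x. Tf n x \<partial>\<mu>') - (\<integral>y. Ts n y \<partial>\<nu>') \<le> c - ((\<integral>x. Tf n x \<partial>\<mu>) + (\<integral>y. Ts n y \<partial>\<nu>)) + A1 + A2"
        by linarith
      then show ?thesis unfolding Y_def using eps by (intro add_right_mono diff_right_mono divide_right_mono) auto
    qed
    finally show ?thesis .
  qed
  let ?Y = "(c - ((\<integral>x. \<phi> x \<partial>\<mu>) + (\<integral>y. \<psi> y \<partial>\<nu>)) + A1 + A2) / \<epsilon> + h1 + h2"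
  have Ylim: "Y \<longlonglongrightarrow> ?Y - 1 + 1"
    unfolding Y_def[abs_def]
    by (intro tendsto_intros cm(2) soft_clip_integral_tendsto[OF \<phi>, folded Tf_def] soft_clip_integral_tendsto[OF \<psi>, folded Ts_def])
      (use eps in auto)
  then have Ylim': "Y \<longlonglongrightarrow> ?Y" by simp
  have Y0: "0 \<le> ?Y" using LIMSEQ_le_const[OF Ylim'] X0 XY order_trans by blast
  have "rel_entropy \<pi> (density P (\<lambda>z. ennreal (gibbs_density \<phi> \<psi> z))) = enn2ereal (\<integral>\<^sup>+z. kl (w z) (gibbs_density \<phi> \<psi> z) \<partial>P)"
    unfolding dw by (rule rel_entropy_density_density)
      (use w0 pp pd in \<open>auto simp: dw[symmetric] plan_density_def couplings_def\<close>)
  also have "(\<integral>\<^sup>+z. kl (w z) (gibbs_density \<phi> \<psi> z) \<partial>P) \<le> ennreal ?Y"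
  proof -
    have "(\<integral>\<^sup>+z. kl (w z) (gibbs_density \<phi> \<psi> z) \<partial>P) \<le> (\<integral>\<^sup>+z. liminf (\<lambda>n. kl (w z) (\<rho> n z)) \<partial>P)"
      by (intro nn_integral_mono kl_lsc tendsto_const cm(3) w0) (simp add: \<rho>_def less_imp_le)
    also have "\<dots> \<le> liminf (\<lambda>n. \<integral>\<^sup>+z. kl (w z) (\<rho> n z) \<partial>P)" by (rule nn_integral_liminf) measurable
    also have "\<dots> \<le> liminf (\<lambda>n. ennreal (Y n))"
      unfolding X by (intro Liminf_mono always_eventually allI ennreal_leI XY)
    also have "\<dots> = ennreal ?Y" by (intro lim_imp_Liminf tendsto_ennrealI Ylim') auto
    finally show ?thesis .
  qed
  finally show ?thesis using Y0 by (simp add: enn2ereal_ennreal less_eq_ennreal.rep_eq)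
qed

lemma (in eot_problem) lebesgue_density:
  assumes "\<bar>rel_entropy \<nu> lborel\<bar> \<noteq> \<infinity>"
  obtains n where "n \<in> borel_measurable borel" "\<And>y. 0 \<le> n y" "\<nu> = density lborel (\<lambda>y. ennreal (n y))"
    "integrable \<nu> (\<lambda>y. ln (n y))" "rel_entropy \<nu> lborel = ereal (\<integral>y. ln (n y) \<partial>\<nu>)"
proof -
  have fin: "rel_entropy \<nu> lborel \<noteq> \<infinity>" and s: "sets \<nu> = sets lborel" using assms by auto
  obtain n where n: "n \<in> borel_measurable lborel" "\<And>y. 0 \<le> n y" "\<nu> = density lborel (\<lambda>y. ennreal (n y))"
    "integrable \<nu> (\<lambda>y. ln (n y))" "rel_entropy \<nu> lborel = ereal (\<integral>y. ln (n y) \<partial>\<nu>)"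
    by (rule rel_entropy_cases[OF sigma_finite_lborel nu.prob_space_axioms s fin]) blast
  show thesis by (rule that[OF _ n(2-5)]) (use n(1) in simp)
qed

end

text \<open>The one-sided inequality for the plan of \<open>(\<mu>', \<nu>')\<close> relative to the plan of \<open>(\<mu>, \<nu>)\<close>. The bound is stated for finite
\<open>B\<close> because the dual norms may be infinite. The theorem combines it with its mirror image.\<close>

lemma plan_stability:
  fixes \<mu> \<nu> \<mu>' \<nu>' :: "'a::euclidean_space measure" and \<epsilon> C :: real
  assumes eps: "\<epsilon> > 0" and P2: "\<mu> \<in> P2" "\<nu> \<in> P2" "\<mu>' \<in> P2" "\<nu>' \<in> P2"
    and ent: "\<bar>rel_entropy \<mu> lborel\<bar> \<noteq> \<infinity>" "\<bar>rel_entropy \<nu> lborel\<bar> \<noteq> \<infinity>"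
    and adm: "admissible_pair \<mu> \<nu>"
    and h: "rel_entropy \<mu>' \<mu> = ereal h1" "rel_entropy \<nu>' \<nu> = ereal h2"
    and C: "C = real DIM('a) * \<epsilon> / 2 * ln (4 * pi * \<epsilon>)"
  defines "B \<equiv> 2 * (ereal_sqrt (eot_cost \<epsilon> \<mu> \<nu> + ereal \<epsilon> * rel_entropy \<nu> lborel + ereal C) * hdot_neg1_norm \<mu> \<mu> \<mu>'
      + ereal_sqrt (eot_cost \<epsilon> \<mu> \<nu> + ereal \<epsilon> * rel_entropy \<mu> lborel + ereal C) * hdot_neg1_norm \<nu> \<nu> \<nu>')"
  obtains S S' where "eot_cost \<epsilon> \<mu> \<nu> = ereal S" "eot_cost \<epsilon> \<mu>' \<nu>' = ereal S'" "0 \<le> B"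
    "rel_entropy \<mu>' \<mu> \<le> rel_entropy (eot_plan \<epsilon> \<mu>' \<nu>') (eot_plan \<epsilon> \<mu> \<nu>)"
    "rel_entropy \<nu>' \<nu> \<le> rel_entropy (eot_plan \<epsilon> \<mu>' \<nu>') (eot_plan \<epsilon> \<mu> \<nu>)"
    "\<And>b. B = ereal b \<Longrightarrow> rel_entropy (eot_plan \<epsilon> \<mu>' \<nu>') (eot_plan \<epsilon> \<mu> \<nu>) \<le> ereal ((S' - S + b) / \<epsilon> + h1 + h2)"
proof -
  interpret E: eot_problem \<mu> \<nu> \<epsilon> by standard (rule eps P2)+
  interpret E': eot_problem \<mu>' \<nu>' \<epsilon> by standard (rule eps P2)+
  interpret Sw: eot_problem \<nu> \<mu> \<epsilon> by standard (rule eps P2)+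
  obtain \<phi> \<psi> where \<phi>: "integrable \<mu> \<phi>" and \<psi>: "integrable \<nu> \<psi>" and opt: "E.optimal (E.gibbs_density \<phi> \<psi>)"
    by (rule E.potentials_exist)
  obtain \<phi>' \<psi>' where \<phi>': "integrable \<mu>' \<phi>'" and \<psi>': "integrable \<nu>' \<psi>'" and opt': "E'.optimal (E.gibbs_density \<phi>' \<psi>')"
    by (rule E'.potentials_exist)
  have pd: "E.plan_density (E.gibbs_density \<phi> \<psi>)" using opt by (simp add: E.optimal_def)
  have pd': "E'.plan_density (E.gibbs_density \<phi>' \<psi>')" using opt' by (simp add: E'.optimal_def)
  have \<phi>m: "\<phi> \<in> borel_measurable borel" and \<psi>m: "\<psi> \<in> borel_measurable borel"
    using borel_measurable_of_integrable[OF \<phi> E.sets_mu] borel_measurable_of_integrable[OF \<psi> E.sets_nu] .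
  define S where "S = (\<integral>x. \<phi> x \<partial>\<mu>) + (\<integral>y. \<psi> y \<partial>\<nu>)"
  define S' where "S' = (\<integral>x. \<phi>' x \<partial>\<mu>') + (\<integral>y. \<psi>' y \<partial>\<nu>')"
  have S: "eot_cost \<epsilon> \<mu> \<nu> = ereal S" unfolding S_def by (rule E.eot_cost_eq[OF \<phi> \<psi> opt])
  have S': "eot_cost \<epsilon> \<mu>' \<nu>' = ereal S'" unfolding S'_def by (rule E'.eot_cost_eq[OF \<phi>' \<psi>' opt'])
  let ?p = "density E.P (\<lambda>z. ennreal (E.gibbs_density \<phi> \<psi> z))"
  let ?p' = "density E'.P (\<lambda>z. ennreal (E.gibbs_density \<phi>' \<psi>' z))"
  have p: "eot_plan \<epsilon> \<mu> \<nu> = ?p" by (rule E.eot_plan_eq[OF opt])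
  have p': "eot_plan \<epsilon> \<mu>' \<nu>' = ?p'" by (rule E'.eot_plan_eq[OF opt'])
  have pc: "?p \<in> couplings \<mu> \<nu>" using pd by (simp add: E.plan_density_def)
  have pc': "?p' \<in> couplings \<mu>' \<nu>'" using pd' by (simp add: E'.plan_density_def)
  have obj': "eot_objective \<epsilon> \<mu>' \<nu>' ?p' = ereal S'"
    unfolding E'.objective_eq[OF pd'] S'_def by (rule E'.excess_gibbs_density[OF \<phi>' \<psi>' pd'])
  obtain n where n: "n \<in> borel_measurable borel" "\<And>y. 0 \<le> n y" "\<nu> = density lborel (\<lambda>y. ennreal (n y))"
    "integrable \<nu> (\<lambda>y. ln (n y))" "rel_entropy \<nu> lborel = ereal (\<integral>y. ln (n y) \<partial>\<nu>)"
    by (rule E.lebesgue_density[OF ent(2)]) blast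
  obtain m where m: "m \<in> borel_measurable borel" "\<And>y. 0 \<le> m y" "\<mu> = density lborel (\<lambda>y. ennreal (m y))"
    "integrable \<mu> (\<lambda>y. ln (m y))" "rel_entropy \<mu> lborel = ereal (\<integral>y. ln (m y) \<partial>\<mu>)"
    by (rule Sw.lebesgue_density[OF ent(1)]) blast
  have ac: "absolutely_continuous \<mu> \<mu>'" "absolutely_continuous \<nu> \<nu>'"
    using h by (auto simp: rel_entropy_def split: if_splits)
  have ad: "emeasure \<mu> (frontier (msupport \<mu>)) = 0 \<or> bounded (msupport \<nu>)"
    "emeasure \<nu> (frontier (msupport \<nu>)) = 0 \<or> bounded (msupport \<mu>)"
    using adm by (auto simp: admissible_pair_def bounded_compactly_supported_def locally_bounded_below_def compact_imp_bounded)
  define K1 where "K1 = S + \<epsilon> * (\<integral>y. ln (n y) \<partial>\<nu>) + C"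
  define K2 where "K2 = S + \<epsilon> * (\<integral>y. ln (m y) \<partial>\<mu>) + C"
  have pdS: "Sw.plan_density (E.gibbs_density \<psi> \<phi>)" by (rule E.swapped_plan_density[OF \<phi>m \<psi>m pd])
  have g1: "0 < K1" "ereal \<bar>(\<integral>x. soft_clip k (\<phi> x) \<partial>\<mu>) - (\<integral>x. soft_clip k (\<phi> x) \<partial>\<mu>')\<bar> \<le> 2 * (ereal (sqrt K1) * hdot_neg1_norm \<mu> \<mu> \<mu>')" if "k > 0" for k
    using E.clipped_potential_pairing[OF \<phi> \<psi> \<phi>m \<psi>m pd n(3,1,2,4) ad(1) E'.mu.prob_space_axioms E'.sets_mu ac(1) that]
    unfolding K1_def S_def C by auto
  have K2': "K2 = (\<integral>y. \<psi> y \<partial>\<nu>) + (\<integral>x. \<phi> x \<partial>\<mu>) + \<epsilon> * (\<integral>y. ln (m y) \<partial>\<mu>) + real DIM('a) * \<epsilon> / 2 * ln (4 * pi * \<epsilon>)"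
    by (simp add: K2_def S_def C)
  have g2: "0 < K2" "ereal \<bar>(\<integral>x. soft_clip k (\<psi> x) \<partial>\<nu>) - (\<integral>x. soft_clip k (\<psi> x) \<partial>\<nu>')\<bar> \<le> 2 * (ereal (sqrt K2) * hdot_neg1_norm \<nu> \<nu> \<nu>')" if "k > 0" for k
    using Sw.clipped_potential_pairing[OF \<psi> \<phi> \<psi>m \<phi>m pdS m(3,1,2,4) ad(2) E'.nu.prob_space_axioms E'.sets_nu ac(2) that]
    unfolding K2' by auto
  define X1 where "X1 = ereal (sqrt K1) * hdot_neg1_norm \<mu> \<mu> \<mu>'"
  define X2 where "X2 = ereal (sqrt K2) * hdot_neg1_norm \<nu> \<nu> \<nu>'"
  have B: "B = 2 * (X1 + X2)"
    unfolding B_def X1_def X2_def S n(5) m(5) by (simp add: ereal_sqrt_def K1_def K2_def)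
  have X0: "0 \<le> X1" "0 \<le> X2"
  proof -
    have "0 \<le> 2 * X1" using g1(2)[of 1] unfolding X1_def by (meson abs_ge_zero ereal_less_eq(5) order_trans zero_less_one)
    then show "0 \<le> X1" by (cases X1) auto
    have "0 \<le> 2 * X2" using g2(2)[of 1] unfolding X2_def by (meson abs_ge_zero ereal_less_eq(5) order_trans zero_less_one)
    then show "0 \<le> X2" by (cases X2) auto
  qed
  have prob: "prob_space ?p" "prob_space ?p'" "sets ?p = sets borel" "sets ?p' = sets borel"
    "distr ?p borel fst = \<mu>" "distr ?p borel snd = \<nu>" "distr ?p' borel fst = \<mu>'" "distr ?p' borel snd = \<nu>'"
    using pc pc' unfolding couplings_def by auto
  have meas: "fst \<in> measurable ?p borel" "snd \<in> measurable ?p borel"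
    using measurable_cong_sets[OF prob(3) refl] by (auto intro: borel_measurable_continuous_onI continuous_intros)
  show thesis
  proof (rule that[OF S S'])
    show "0 \<le> B" unfolding B using X0 by simp
    show "rel_entropy \<mu>' \<mu> \<le> rel_entropy (eot_plan \<epsilon> \<mu>' \<nu>') (eot_plan \<epsilon> \<mu> \<nu>)"
      using rel_entropy_distr_le[OF prob(1,2) _ meas(1)] h prob unfolding p p' by simp
    show "rel_entropy \<nu>' \<nu> \<le> rel_entropy (eot_plan \<epsilon> \<mu>' \<nu>') (eot_plan \<epsilon> \<mu> \<nu>)"
      using rel_entropy_distr_le[OF prob(1,2) _ meas(2)] h prob unfolding p p' by simp
    fix b assume b: "B = ereal b"
    obtain x1 x2 where x: "X1 = ereal x1" "X2 = ereal x2" "b = 2 * x1 + 2 * x2"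
      using b X0 unfolding B by (cases X1; cases X2) auto
    have a1: "(\<integral>x. soft_clip (real (Suc k)) (\<phi> x) \<partial>\<mu>) - (\<integral>x. soft_clip (real (Suc k)) (\<phi> x) \<partial>\<mu>') \<le> 2 * x1" for k
      using g1(2)[of "real (Suc k)"] unfolding X1_def[symmetric] x(1) by (simp del: of_nat_Suc)
    have a2: "(\<integral>x. soft_clip (real (Suc k)) (\<psi> x) \<partial>\<nu>) - (\<integral>x. soft_clip (real (Suc k)) (\<psi> x) \<partial>\<nu>') \<le> 2 * x2" for k
      using g2(2)[of "real (Suc k)"] unfolding X2_def[symmetric] x(2) by (simp del: of_nat_Suc)
    show "rel_entropy (eot_plan \<epsilon> \<mu>' \<nu>') (eot_plan \<epsilon> \<mu> \<nu>) \<le> ereal ((S' - S + b) / \<epsilon> + h1 + h2)"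
      using E.entropy_of_competitor_le[OF \<phi> \<psi> \<phi>m \<psi>m pd P2(3) h(1) P2(4) h(2) pc' obj' a1 a2]
      unfolding p p' x(3) S_def by (simp add: add.assoc)
  qed
qed

theorem mainTheorem6:
  fixes \<mu> \<nu> \<mu>' \<nu>' :: "'a::euclidean_space measure" and \<epsilon> C :: real
  assumes "\<epsilon> > 0"
    and "\<mu> \<in> P2" "\<nu> \<in> P2" "\<mu>' \<in> P2" "\<nu>' \<in> P2"
    and "\<bar>rel_entropy \<mu> lborel\<bar> \<noteq> \<infinity>" "\<bar>rel_entropy \<nu> lborel\<bar> \<noteq> \<infinity>"
      "\<bar>rel_entropy \<mu>' lborel\<bar> \<noteq> \<infinity>" "\<bar>rel_entropy \<nu>' lborel\<bar> \<noteq> \<infinity>"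
    and "admissible_pair \<mu> \<nu>" "admissible_pair \<mu>' \<nu>'"
    and "sym_entropy \<mu> \<mu>' < \<infinity>" "sym_entropy \<nu> \<nu>' < \<infinity>"
    and "C = real DIM('a) * \<epsilon> / 2 * ln (4 * pi * \<epsilon>)"
  shows "(\<bar>eot_cost \<epsilon> \<mu>' \<nu>' - eot_cost \<epsilon> \<mu> \<nu>\<bar> \<le>
      ereal \<epsilon> * min (sym_entropy \<mu> \<mu>') (sym_entropy \<nu> \<nu>')
      + 2 * (ereal_sqrt (eot_cost \<epsilon> \<mu> \<nu> + ereal \<epsilon> * rel_entropy \<nu> lborel + ereal C)
               * hdot_neg1_norm \<mu> \<mu> \<mu>'
           + ereal_sqrt (eot_cost \<epsilon> \<mu> \<nu> + ereal \<epsilon> * rel_entropy \<mu> lborel + ereal C)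
               * hdot_neg1_norm \<nu> \<nu> \<nu>')
      + 2 * (ereal_sqrt (eot_cost \<epsilon> \<mu>' \<nu>' + ereal \<epsilon> * rel_entropy \<nu>' lborel + ereal C)
               * hdot_neg1_norm \<mu>' \<mu>' \<mu>
           + ereal_sqrt (eot_cost \<epsilon> \<mu>' \<nu>' + ereal \<epsilon> * rel_entropy \<mu>' lborel + ereal C)
               * hdot_neg1_norm \<nu>' \<nu>' \<nu>))
    \<and> (ereal \<epsilon> * sym_entropy (eot_plan \<epsilon> \<mu> \<nu>) (eot_plan \<epsilon> \<mu>' \<nu>') \<le>
      ereal \<epsilon> * sym_entropy \<mu> \<mu>' + ereal \<epsilon> * sym_entropy \<nu> \<nu>'
      + 2 * (ereal_sqrt (eot_cost \<epsilon> \<mu> \<nu> + ereal \<epsilon> * rel_entropy \<nu> lborel + ereal C)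
               * hdot_neg1_norm \<mu> \<mu> \<mu>'
           + ereal_sqrt (eot_cost \<epsilon> \<mu> \<nu> + ereal \<epsilon> * rel_entropy \<mu> lborel + ereal C)
               * hdot_neg1_norm \<nu> \<nu> \<nu>')
      + 2 * (ereal_sqrt (eot_cost \<epsilon> \<mu>' \<nu>' + ereal \<epsilon> * rel_entropy \<nu>' lborel + ereal C)
               * hdot_neg1_norm \<mu>' \<mu>' \<mu>
           + ereal_sqrt (eot_cost \<epsilon> \<mu>' \<nu>' + ereal \<epsilon> * rel_entropy \<mu>' lborel + ereal C)
               * hdot_neg1_norm \<nu>' \<nu>' \<nu>))"
  (is "(_ \<le> _ + ?B + ?B') \<and> (_ \<le> _ + ?B + ?B')")
proof -
  note A = assms
  have nn: "0 \<le> rel_entropy \<mu> \<mu>'" "0 \<le> rel_entropy \<mu>' \<mu>" "0 \<le> rel_entropy \<nu> \<nu>'" "0 \<le> rel_entropy \<nu>' \<nu>"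
    using A(2-5) by (auto intro!: rel_entropy_nonneg simp: P2_def)
  obtain h1 k1 where h1: "rel_entropy \<mu>' \<mu> = ereal h1" "rel_entropy \<mu> \<mu>' = ereal k1" "0 \<le> h1" "0 \<le> k1"
    using nn(1,2) A(12) unfolding sym_entropy_def by (cases "rel_entropy \<mu>' \<mu>"; cases "rel_entropy \<mu> \<mu>'") auto
  obtain h2 k2 where h2: "rel_entropy \<nu>' \<nu> = ereal h2" "rel_entropy \<nu> \<nu>' = ereal k2" "0 \<le> h2" "0 \<le> k2"
    using nn(3,4) A(13) unfolding sym_entropy_def by (cases "rel_entropy \<nu>' \<nu>"; cases "rel_entropy \<nu> \<nu>'") auto
  define R where "R = rel_entropy (eot_plan \<epsilon> \<mu>' \<nu>') (eot_plan \<epsilon> \<mu> \<nu>)"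
  define R' where "R' = rel_entropy (eot_plan \<epsilon> \<mu> \<nu>) (eot_plan \<epsilon> \<mu>' \<nu>')"
  obtain S S' where S: "eot_cost \<epsilon> \<mu> \<nu> = ereal S" "eot_cost \<epsilon> \<mu>' \<nu>' = ereal S'" and B0: "0 \<le> ?B"
    and R: "ereal h1 \<le> R" "ereal h2 \<le> R" "\<And>b. ?B = ereal b \<Longrightarrow> R \<le> ereal ((S' - S + b) / \<epsilon> + h1 + h2)"
    using plan_stability[OF A(1-5) A(6,7) A(10) h1(1) h2(1) A(14)] unfolding R_def h1(1) h2(1) by metis
  obtain T T' where T: "eot_cost \<epsilon> \<mu>' \<nu>' = ereal T" "eot_cost \<epsilon> \<mu> \<nu> = ereal T'" and B0': "0 \<le> ?B'"
    and R'': "ereal k1 \<le> R'" "ereal k2 \<le> R'" "\<And>b. ?B' = ereal b \<Longrightarrow> R' \<le> ereal ((T' - T + b) / \<epsilon> + k1 + k2)"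
    using plan_stability[OF A(1) A(4,5,2,3) A(8,9) A(11) h1(2) h2(2) A(14)] unfolding R'_def h1(2) h2(2) by metis
  have R': "ereal k1 \<le> R'" "ereal k2 \<le> R'" "\<And>b. ?B' = ereal b \<Longrightarrow> R' \<le> ereal ((S - S' + b) / \<epsilon> + k1 + k2)"
    using R'' T S by auto
  define B where "B = ?B"
  define B' where "B' = ?B'"
  have sym: "sym_entropy \<mu> \<mu>' = ereal (k1 + h1)" "sym_entropy \<nu> \<nu>' = ereal (k2 + h2)"
    "sym_entropy (eot_plan \<epsilon> \<mu> \<nu>) (eot_plan \<epsilon> \<mu>' \<nu>') = R' + R"
    unfolding sym_entropy_def R_def R'_def using h1 h2 by auto
  show ?thesis
  proof (cases "B = \<infinity> \<or> B' = \<infinity>")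
    case True
    then have inf: "x + B + B' = \<infinity>" if "x \<noteq> -\<infinity>" for x
      using that B0 B0' unfolding B_def[symmetric] B'_def[symmetric] by (cases x; cases B; cases B') auto
    have i: "ereal \<epsilon> * min (sym_entropy \<mu> \<mu>') (sym_entropy \<nu> \<nu>') + B + B' = \<infinity>"
      "ereal \<epsilon> * sym_entropy \<mu> \<mu>' + ereal \<epsilon> * sym_entropy \<nu> \<nu>' + B + B' = \<infinity>"
      unfolding sym by (intro inf; simp add: min_def)+
    show ?thesis unfolding B_def[symmetric] B'_def[symmetric] i by simp
  next
    case False
    then obtain b b' where b: "B = ereal b" "B' = ereal b'" "0 \<le> b" "0 \<le> b'"
      using B0 B0' unfolding B_def[symmetric] B'_def[symmetric] by (cases B; cases B') auto
    have r1: "R \<le> ereal ((S' - S + b) / \<epsilon> + h1 + h2)" using R(3) b(1) unfolding B_def by blast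
    have r2: "R' \<le> ereal ((S - S' + b') / \<epsilon> + k1 + k2)" using R'(3) b(2) unfolding B'_def by blast
    obtain r where r: "R = ereal r" using R(1) r1 by (cases R) auto
    obtain r' where r': "R' = ereal r'" using R'(1) r2 by (cases R') auto
    have q1: "\<epsilon> * r \<le> S' - S + b + \<epsilon> * h1 + \<epsilon> * h2"
    proof -
      have "\<epsilon> * r \<le> \<epsilon> * ((S' - S + b) / \<epsilon> + h1 + h2)" using r1 A(1) unfolding r by (intro mult_left_mono) auto
      also have "\<dots> = S' - S + b + \<epsilon> * h1 + \<epsilon> * h2" using A(1) by (simp add: field_simps)
      finally show ?thesis .
    qed
    have q2: "\<epsilon> * r' \<le> S - S' + b' + \<epsilon> * k1 + \<epsilon> * k2"
    proof -
      have "\<epsilon> * r' \<le> \<epsilon> * ((S - S' + b') / \<epsilon> + k1 + k2)" using r2 A(1) unfolding r' by (intro mult_left_mono) auto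
      also have "\<dots> = S - S' + b' + \<epsilon> * k1 + \<epsilon> * k2" using A(1) by (simp add: field_simps)
      finally show ?thesis .
    qed
    have e: "\<epsilon> * h1 \<le> \<epsilon> * r" "\<epsilon> * h2 \<le> \<epsilon> * r" "\<epsilon> * k1 \<le> \<epsilon> * r'" "\<epsilon> * k2 \<le> \<epsilon> * r'"
      "0 \<le> \<epsilon> * h1" "0 \<le> \<epsilon> * h2" "0 \<le> \<epsilon> * k1" "0 \<le> \<epsilon> * k2"
      using R(1,2) R'(1,2) A(1) h1 h2 unfolding r r' by (auto intro!: mult_left_mono)
    have "\<bar>S' - S\<bar> \<le> \<epsilon> * (k1 + h1) + b + b'" "\<bar>S' - S\<bar> \<le> \<epsilon> * (k2 + h2) + b + b'"
      using q1 q2 e b(3,4) by (auto simp: distrib_left abs_le_iff)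
    then have one: "\<bar>S' - S\<bar> \<le> \<epsilon> * min (k1 + h1) (k2 + h2) + b + b'" by (auto simp: min_def)
    have two: "\<epsilon> * (r' + r) \<le> \<epsilon> * (k1 + h1) + \<epsilon> * (k2 + h2) + b + b'"
      using q1 q2 by (simp add: distrib_left)
    have mn: "min (ereal (k1 + h1)) (ereal (k2 + h2)) = ereal (min (k1 + h1) (k2 + h2))" by (simp add: min_def)
    have "\<bar>eot_cost \<epsilon> \<mu>' \<nu>' - eot_cost \<epsilon> \<mu> \<nu>\<bar> \<le> ereal \<epsilon> * min (sym_entropy \<mu> \<mu>') (sym_entropy \<nu> \<nu>') + B + B'"
      using one unfolding S sym(1,2) b mn
      by (simp only: ereal_minus abs_ereal.simps times_ereal.simps plus_ereal.simps ereal_less_eq)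
    moreover have "ereal \<epsilon> * sym_entropy (eot_plan \<epsilon> \<mu> \<nu>) (eot_plan \<epsilon> \<mu>' \<nu>')
        \<le> ereal \<epsilon> * sym_entropy \<mu> \<mu>' + ereal \<epsilon> * sym_entropy \<nu> \<nu>' + B + B'"
      unfolding sym b r r' using two by simp
    ultimately show ?thesis unfolding B_def B'_def by blast
  qed
qed

end
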